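(* The sets $E$, $E^{\mathbf S}$ ($\mathbf S\in\Lambda_e$) and $E_\infty$ are all zero-dimensional. Precisely: (i) $\dim_P E=0$; (ii) $\dim_B E^{\mathbf S}=0$ for every $\mathbf S\in\Lambda_e$; (iii) $\dim_H E_\infty=0$. Here $\dim_H,\dim_P,\dim_B$ denote Hausdorff, packing and box-counting dimension.
   Context: $\mathbb N=\{1,2,\dots\}$. Words are finite strings of nonnegative integers, ordered lexicographically. For $\mathbf w=w_1\dots w_m$ put $\mathbf w^+:=w_1\dots w_{m-1}(w_m+1)$ and, if $w_m>0$, $\mathbf w^-:=w_1\dots w_{m-1}(w_m-1)$. $\mathbb L(\mathbf w)$ is the lexicographically largest cyclic permutation of $\mathbf w$. A word is Lyndon if it is aperiodic (not a power of a shorter word) and lexicographically smallest among its cyclic permutations; $\mathcal L_e$ is the set of all Lyndon words except the word $0$. Farey words: $F_0=(0,1)$, and $F_{n+1}$ is obtained from the ordered list $F_n=(\mathbf w_1,\dots,\mathbf w_{2^n+1})$ by inserting the concatenation $\mathbf w_j\mathbf w_{j+1}$ between $\mathbf w_j$ and $\mathbf w_{j+1}$ for each $1\le j\le 2^n$. Let $\mathcal F:=\bigcup_{n\ge1}F_n\setminus\{0,1\}$ and $\hat{\mathcal F}:=\mathcal F\cup\{1\}$. Let $\theta$ be the map adding $1$ to each digit of a word, and $\mathcal F_e:=\{\theta^k(\mathbf w):\mathbf w\in\hat{\mathcal F},k=0,1,2,\dots\}$. Then $\mathcal F\subset\mathcal F_e\subseteq\mathcal L_e$. Substitution: for $\mathbf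 s\in\mathcal L_e$, define $\Phi_{\mathbf s}$ on finite words and infinite sequences over $\{0,1\}$ by $\Phi_{\mathbf s}(0^{k_1}1^{l_1}0^{k_2}1^{l_2}\dots)=\mathbf s^-\mathbb L(\mathbf s)^{k_1-1}\,\mathbb L(\mathbf s)^+\mathbf s^{l_1-1}\,\mathbf s^-\mathbb L(\mathbf s)^{k_2-1}\,\mathbb L(\mathbf s)^+\mathbf s^{l_2-1}\dots$ and $\Phi_{\mathbf s}(1^{k_1}0^{l_1}1^{k_2}0^{l_2}\dots)=\mathbb L(\mathbf s)^+\mathbf s^{k_1-1}\,\mathbf s^-\mathbb L(\mathbf s)^{l_1-1}\,\mathbb L(\mathbf s)^+\mathbf s^{k_2-1}\,\mathbf s^-\mathbb L(\mathbf s)^{l_2-1}\dots$ (all exponents $k_i,l_i\ge1$; one exponent may be $\infty$, in which case the remainder is ignored). For a finite word $\mathbf r\in\{0,1\}^*$ put $\mathbf s\bullet\mathbf r:=\Phi_{\mathbf s}(\mathbf r)$; if $\mathbf r$ is a Lyndon word over $\{0,1\}$ of length at least 2 then $\mathbf s\bullet\mathbf r\in\mathcal L_e$, and $\bullet$ is associative. For $m\in\mathbb N$ let $\Lambda_e(m):=\{\mathbf s_1\bullet\mathbf s_2\bullet\dots\bullet\mathbf s_m:\mathbf s_1\in\mathcal F_e,\ \mathbf s_2,\dots,\mathbf s_m\in\mathcal F\}$ and $\Lambda_e:=\bigcup_{m\ge1}\Lambda_e(m)$. For a sequence $(c_i)$ write $((c_i))_\beta:=\sum_{i\ge1}c_i\beta^{-i}$.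 For $\mathbf S\in\Lambda_e$ define $\beta_\ell^{\mathbf S},\beta_*^{\mathbf S},\beta_r^{\mathbf S}\in(1,\infty)$ by $(\mathbb L(\mathbf S)^\infty)_{\beta_\ell^{\mathbf S}}=(\mathbb L(\mathbf S)^+\mathbf S^-\mathbb L(\mathbf S)^\infty)_{\beta_*^{\mathbf S}}=(\mathbb L(\mathbf S)^+\mathbf S^\infty)_{\beta_r^{\mathbf S}}=1$, and $I^{\mathbf S}:=[\beta_\ell^{\mathbf S},\beta_*^{\mathbf S}]$, $J^{\mathbf S}:=[\beta_\ell^{\mathbf S},\beta_r^{\mathbf S}]$. Finally, $E:=(1,\infty)\setminus\bigcup_{\mathbf s\in\mathcal F_e}J^{\mathbf s}$; $E^{\mathbf S}:=(J^{\mathbf S}\setminus I^{\mathbf S})\setminus\bigcup_{\mathbf r\in\mathcal F}J^{\mathbf S\bullet\mathbf r}$ for $\mathbf S\in\Lambda_e$; $E_\infty:=\bigcap_{m=1}^\infty\bigcup_{\mathbf S\in\Lambda_e(m)}J^{\mathbf S}$. *)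

theory Defs
  imports "HOL-Analysis.Analysis" "HOL-Library.List_Lexorder" "HOL-Library.Stream"
begin

section \<open>Fractal dimensions\<close>

text \<open>
  In dimension 0 the empty set has weight 0 and every nonempty set has weight 1
  (note that \<^term>\<open>0 powr 0 = (0::real)\<close>).
\<close>
definition diam_pow :: "real \<Rightarrow> 'a::euclidean_space set \<Rightarrow> ennreal" where
  "diam_pow s U = (if U = {} then 0 else if s = 0 then 1 else ennreal (diameter U powr s))"

text \<open>
  \<^const>\<open>bounded\<close> is required explicitly because \<^const>\<open>diameter\<close> carries no information on
  unbounded sets.
\<close>
definition delta_covers :: "real \<Rightarrow> 'a::euclidean_space set \<Rightarrow> (nat \<Rightarrow> 'a set) set" where
  "delta_covers \<delta> A = {U. (\<forall>i. bounded (U i) \<and> diameter (U i) \<le> \<delta>) \<and> A \<subseteq> (\<Union>i. U i)}"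

definition hausdorff_premeasure :: "real \<Rightarrow> real \<Rightarrow> 'a::euclidean_space set \<Rightarrow> ennreal" where
  "hausdorff_premeasure s \<delta> A = (INF U\<in>delta_covers \<delta> A. \<Sum>i. diam_pow s (U i))"

definition hausdorff_measure :: "real \<Rightarrow> 'a::euclidean_space set \<Rightarrow> ennreal" where
  "hausdorff_measure s A = (SUP \<delta>\<in>{0<..}. hausdorff_premeasure s \<delta> A)"

definition hausdorff_dim :: "'a::euclidean_space set \<Rightarrow> ereal" where
  "hausdorff_dim A = (INF s\<in>{s. 0 \<le> s \<and> hausdorff_measure s A = 0}. ereal s)"

text \<open>
  A packing is a set of pairs (centre, radius) whose closed balls are pairwise disjoint.
\<close>
definition delta_packings :: "real \<Rightarrow> 'a::euclidean_space set \<Rightarrow> ('a \<times> real) set set" where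
  "delta_packings \<delta> A =
     {C. C \<subseteq> A \<times> {0<..\<delta>} \<and> disjoint_family_on (\<lambda>(x, r). cball x r) C}"

definition packing_premeasure_delta :: "real \<Rightarrow> real \<Rightarrow> 'a::euclidean_space set \<Rightarrow> ennreal" where
  "packing_premeasure_delta s \<delta> A =
     (SUP C\<in>delta_packings \<delta> A. \<Sum>\<^sub>\<infinity>(x, r)\<in>C. diam_pow s (cball x r))"

definition packing_premeasure :: "real \<Rightarrow> 'a::euclidean_space set \<Rightarrow> ennreal" where
  "packing_premeasure s A = (INF \<delta>\<in>{0<..}. packing_premeasure_delta s \<delta> A)"

definition packing_measure :: "real \<Rightarrow> 'a::euclidean_space set \<Rightarrow> ennreal" where
  "packing_measure s A =
     (INF F\<in>{F :: nat \<Rightarrow> 'a set. A \<subseteq> (\<Union>i. F i)}. \<Sum>i. packing_premeasure s (F i))"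

definition packing_dim :: "'a::euclidean_space set \<Rightarrow> ereal" where
  "packing_dim A = (INF s\<in>{s. 0 \<le> s \<and> packing_measure s A = 0}. ereal s)"

definition covering_number :: "real \<Rightarrow> 'a::euclidean_space set \<Rightarrow> enat" where
  "covering_number \<delta> A =
     (INF \<U>\<in>{\<U>. finite \<U> \<and> (\<forall>U\<in>\<U>. bounded U \<and> diameter U \<le> \<delta>) \<and> A \<subseteq> \<Union>\<U>}. enat (card \<U>))"

text \<open>
  For unbounded sets the ratio is infinite; for the empty set it is 0, as \<^term>\<open>ln 0 = (0::real)\<close>.
\<close>
definition box_ratio :: "'a::euclidean_space set \<Rightarrow> real \<Rightarrow> ereal" where
  "box_ratio A \<delta> =
     (case covering_number \<delta> A of enat n \<Rightarrow> ereal (ln (real n) / - ln \<delta>) | \<infinity> \<Rightarrow> \<infinity>)"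

definition lower_box_dim :: "'a::euclidean_space set \<Rightarrow> ereal" where
  "lower_box_dim A = Liminf (at_right 0) (box_ratio A)"

definition upper_box_dim :: "'a::euclidean_space set \<Rightarrow> ereal" where
  "upper_box_dim A = Limsup (at_right 0) (box_ratio A)"

definition has_box_dim :: "'a::euclidean_space set \<Rightarrow> ereal \<Rightarrow> bool" where
  "has_box_dim A d \<longleftrightarrow> lower_box_dim A = d \<and> upper_box_dim A = d"


section \<open>Words\<close>

type_synonym word = "nat list"

definition word_plus :: "word \<Rightarrow> word" where
  "word_plus w = butlast w @ [last w + 1]"

text \<open>Only meaningful if the last digit is positive.\<close>
definition word_minus :: "word \<Rightarrow> word" where
  "word_minus w = butlast w @ [last w - 1]"

definition word_pow :: "word \<Rightarrow> nat \<Rightarrow> word" where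
  "word_pow w n = concat (replicate n w)"

text \<open>The word \<open>\<bbbL>(w)\<close>; lists are ordered lexicographically.\<close>
definition max_rot :: "word \<Rightarrow> word" where
  "max_rot w = Max (range (\<lambda>k. rotate k w))"


section \<open>Farey words\<close>

fun insert_concats :: "word list \<Rightarrow> word list" where
  "insert_concats (u # v # ws) = u # (u @ v) # insert_concats (v # ws)"
| "insert_concats ws = ws"

primrec farey_list :: "nat \<Rightarrow> word list" where
  "farey_list 0 = [[0], [1]]"
| "farey_list (Suc n) = insert_concats (farey_list n)"

definition Farey :: "word set" where
  "Farey = (\<Union>n\<in>{1..}. set (farey_list n)) - {[0], [1]}"

definition Farey_hat :: "word set" where
  "Farey_hat = Farey \<union> {[1]}"

definition theta :: "word \<Rightarrow> word" where
  "theta = map Suc"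

definition Farey_e :: "word set" where
  "Farey_e = {(theta ^^ k) w | k w. w \<in> Farey_hat}"


section \<open>The substitution and its iterates\<close>

text \<open>
  \<open>subst_word s r\<close> is \<open>\<Phi>\<^sub>s(r) = s \<bullet> r\<close> for a finite 0-1-word \<open>r\<close>. Each step consumes a maximal run of
  equal digits: \<open>0\<^sup>k\<close> becomes \<open>s\<^sup>- \<bbbL>(s)\<^sup>k\<^sup>-\<^sup>1\<close> and \<open>1\<^sup>k\<close> becomes \<open>\<bbbL>(s)\<^sup>+ s\<^sup>k\<^sup>-\<^sup>1\<close>; the number of
  digits of the run after its first one is the exponent \<open>k - 1\<close>.
\<close>
function subst_word :: "word \<Rightarrow> word \<Rightarrow> word" where
  "subst_word s [] = []"
| "subst_word s (d # r) =
     (if d = 0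
      then word_minus s @ word_pow (max_rot s) (length (takeWhile (\<lambda>e. e = 0) r))
             @ subst_word s (dropWhile (\<lambda>e. e = 0) r)
      else word_plus (max_rot s) @ word_pow s (length (takeWhile (\<lambda>e. e \<noteq> 0) r))
             @ subst_word s (dropWhile (\<lambda>e. e \<noteq> 0) r))"
  by pat_completeness auto
termination
  by (relation "Wellfounded.measure (length \<circ> snd)") (auto simp: less_Suc_eq_le length_dropWhile_le)

text \<open>
  \<open>Lambda_e m\<close> consists of the words \<open>s\<^sub>1 \<bullet> \<dots> \<bullet> s\<^sub>m\<close>, bracketed to the left; it is empty for \<open>m = 0\<close>.
\<close>
definition Lambda_e :: "nat \<Rightarrow> word set" where
  "Lambda_e m =
     {foldl subst_word s1 ss | s1 ss. s1 \<in> Farey_e \<and> set ss \<subseteq> Farey \<and> 1 + length ss = m}"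

definition Lambda_all :: "word set" where
  "Lambda_all = (\<Union>m\<in>{1..}. Lambda_e m)"


section \<open>Bases, intervals and the exceptional sets\<close>

definition base_value :: "nat stream \<Rightarrow> real \<Rightarrow> real" where
  "base_value c \<beta> = (\<Sum>i. real (c !! i) / \<beta> ^ (i + 1))"

definition base_of :: "nat stream \<Rightarrow> real" where
  "base_of c = (THE \<beta>. 1 < \<beta> \<and> base_value c \<beta> = 1)"

definition beta_l :: "word \<Rightarrow> real" where
  "beta_l S = base_of (cycle (max_rot S))"

definition beta_star :: "word \<Rightarrow> real" where
  "beta_star S = base_of (word_plus (max_rot S) @- word_minus S @- cycle (max_rot S))"

definition beta_r :: "word \<Rightarrow> real" where
  "beta_r S = base_of (word_plus (max_rot S) @- cycle S)"

definition I_int :: "word \<Rightarrow> real set" where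
  "I_int S = {beta_l S .. beta_star S}"

definition J_int :: "word \<Rightarrow> real set" where
  "J_int S = {beta_l S .. beta_r S}"

definition E_set :: "real set" where
  "E_set = {1<..} - (\<Union>s\<in>Farey_e. J_int s)"

definition E_rel :: "word \<Rightarrow> real set" where
  "E_rel S = (J_int S - I_int S) - (\<Union>r\<in>Farey. J_int (subst_word S r))"

definition E_inf :: "real set" where
  "E_inf = (\<Inter>m\<in>{1..}. \<Union>S\<in>Lambda_e m. J_int S)"

end

theory Submission
  imports Defs "HOL-Real_Asymp.Real_Asymp"
begin

text \<open>
  All dimensions are nonnegative, so only economical covers have to be found. They come from one
  estimate, \<open>gap_common_prefix\<close>: if two digit sequences share a prefix of length \<open>n\<close>, then the bases
  \<open>x \<in> [\<rho>, M]\<close> for which the first sequence has value at most 1 and the second one value at least 1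
  form a set of diameter \<open>O(\<rho>^-n)\<close>. Indeed, the value of a sequence with a positive first digit
  decreases in \<open>x\<close> with slope at least \<open>1/M^2\<close> in absolute value, and the two values at the same base
  differ by \<open>O(\<rho>^-n)\<close>. The intervals \<open>J^S\<close> and the gaps between them have this form.

  For \<open>E\<close> and \<open>E^S\<close> the Farey words are organized as a binary tree of neighbours \<open>(u, v)\<close> with
  children \<open>(u, uv)\<close> and \<open>(uv, v)\<close>. A point of the gap between \<open>J^u\<close> and \<open>J^v\<close> that is not in
  \<open>J^uv\<close> lies in the gap of one of the children (\<open>farey_tree_cover\<close>). The gap of \<open>(u, v)\<close> is bounded
  by the sequences \<open>L(u)^+ u u u \<dots>\<close> and \<open>L(v) L(v) L(v) \<dots>\<close>, which agree on \<open>|u| + |v| - 1\<close> digits: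
  if \<open>u = 0p1\<close> and \<open>v = 0q1\<close>, then \<open>p10q = q01p\<close>, and both begin with \<open>1p10q\<close>
  (\<open>farey_pair_common_prefix\<close>). When the tree is cut where \<open>|u| + |v| > N\<close>, the identity
  \<open>1/ab = 1/a(a+b) + 1/(a+b)b\<close> bounds the number of leaves by \<open>N^2\<close>. So the part of the set in \<open>[\<rho>, M]\<close> is
  covered by \<open>N^2\<close> sets of diameter \<open>C \<rho>^-N\<close>, and polynomially many sets of exponentially small
  diameter give box dimension and packing premeasures zero.

  The argument for \<open>E^S\<close> is the same after applying \<open>\<Phi>_S\<close>. This substitution replaces each digit by a
  block of \<open>|S|\<close> digits that depends only on the digit and its predecessor, so it preserves common
  prefixes. What has to be shown is \<open>L(S \<bullet> r) = \<Phi>_S(L(r))\<close>, which identifies the end points of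
  \<open>J^(S \<bullet> r)\<close>. It follows from \<open>lyndon_block_code\<close>: such a code maps Lyndon words to Lyndon words; this is
  applied to the order \<open><\<close> for \<open>r\<close> and to the order \<open>>\<close> for \<open>L(r)\<close>. The map \<open>\<theta>^k\<close> is a
  block code as well, and this gives \<open>E\<close>.

  For \<open>E_\<infinity>\<close>, the length of \<open>s_1 \<bullet> \<dots> \<bullet> s_m\<close> is the product of the lengths, and the sum of \<open>|w|^-4\<close>
  over the Farey words is at most 1/8 (\<open>Farey_weight\<close>, by a second potential on the same tree). With
  the digits bounded by \<open>D\<close>, the sum of \<open>|S|^-4\<close> over \<open>\<Lambda>_e(m)\<close> is therefore \<open>O(8^-m)\<close>, whereas the
  diameter of \<open>J^S\<close> within \<open>[\<rho>, M]\<close> is \<open>O(\<rho>^-|S|)\<close>. So the covers of \<open>E_\<infinity>\<close> by these intervals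
  have arbitrarily small \<open>s\<close>-dimensional weight for each \<open>s > 0\<close>.
\<close>

section \<open>Sets with subexponential covering numbers\<close>

definition coverable :: "'a::euclidean_space set \<Rightarrow> real \<Rightarrow> real \<Rightarrow> bool" where
  "coverable A \<delta> c \<longleftrightarrow> (\<exists>\<U>. finite \<U> \<and> (\<forall>U\<in>\<U>. bounded U \<and> diameter U \<le> \<delta>) \<and> A \<subseteq> \<Union>\<U> \<and>
     real (card \<U>) \<le> c)"

lemma coverableE:
  assumes "coverable A \<delta> c"
  obtains \<U> where "finite \<U>" "\<forall>U\<in>\<U>. bounded U \<and> diameter U \<le> \<delta>" "A \<subseteq> \<Union>\<U>" "real (card \<U>) \<le> c"
  using assms unfolding coverable_def by blast

lemma coverable_mono: "coverable A \<delta> c \<Longrightarrow> c \<le> d \<Longrightarrow> coverable A \<delta> d"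
  unfolding coverable_def by (meson order_trans)

text \<open>
  The covering numbers at scale \<open>\<delta>\<close> grow at most like every positive power of \<open>1/\<delta>\<close>. This quantified form
  serves the box and the packing dimension at once.
\<close>
definition thin :: "'a::euclidean_space set \<Rightarrow> bool" where
  "thin A \<longleftrightarrow> (\<forall>t>0. \<exists>K. \<forall>\<delta>. 0 < \<delta> \<and> \<delta> < 1 \<longrightarrow>
     coverable A \<delta> (K * \<delta> powr (- t)))"

lemma thinD:
  assumes "thin A" "t > 0"
  shows "\<exists>K\<ge>1. \<forall>\<delta>. 0 < \<delta> \<and> \<delta> < 1 \<longrightarrow>
     coverable A \<delta> (K * \<delta> powr (- t))"
proof -
  from assms obtain K where K: "\<And>\<delta>. 0 < \<delta> \<and> \<delta> < 1 \<longrightarrow>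
     coverable A \<delta> (K * \<delta> powr (- t))"
    unfolding thin_def by blast
  have "K * \<delta> powr (- t) \<le> max K 1 * \<delta> powr (- t)" for \<delta>
    by (intro mult_right_mono) auto
  then have "\<forall>\<delta>. 0 < \<delta> \<and> \<delta> < 1 \<longrightarrow>
     coverable A \<delta> (max K 1 * \<delta> powr (- t))"
    using K coverable_mono by blast
  then show ?thesis by (intro exI[of _ "max K 1"]) simp
qed

lemma coverable_subset: "coverable B \<delta> c \<Longrightarrow> A \<subseteq> B \<Longrightarrow> coverable A \<delta> c"
  unfolding coverable_def by (meson order_trans)

lemma thin_subset: "thin B \<Longrightarrow> A \<subseteq> B \<Longrightarrow> thin A"
  unfolding thin_def by (metis coverable_subset)

lemma quartic_le_exponential:
  fixes q :: real assumes "1 < q"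
  obtains K where "K > 0" "\<And>n. (real n + 1) ^ 4 \<le> K * q ^ n"
proof -
  have "(\<lambda>n. (real n + 1) ^ 4 / q ^ n) \<longlonglongrightarrow> 0" using assms by real_asymp
  then have "Bseq (\<lambda>n. (real n + 1) ^ 4 / q ^ n)"
    by (intro convergent_imp_Bseq convergentI)
  then obtain K where K: "K > 0" "\<And>n. norm ((real n + 1) ^ 4 / q ^ n) \<le> K"
    by (auto elim: BseqE)
  have "(real n + 1) ^ 4 \<le> K * q ^ n" for n
    using K(2)[of n] assms by (simp add: field_simps)
  then show thesis using K(1) that by blast
qed

text \<open>
  A scale \<open>\<delta>\<close> is reached by the first exponent \<open>N\<close> with \<open>C / \<rho>^N \<le> \<delta>\<close>, which is logarithmic in \<open>1/\<delta>\<close>;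
  its square is dominated by any power of \<open>1/\<delta>\<close>.
\<close>
lemma thinI_polynomial:
  assumes rho: "1 < \<rho>"
    and cover: "\<And>N. 1 \<le> N \<Longrightarrow> coverable A (C / \<rho> ^ N) ((real N)\<^sup>2)"
  shows "thin A"
  unfolding thin_def
proof (intro allI impI)
  fix t :: real assume t: "0 < t"
  \<comment> \<open>With \<open>1 \<le> B\<close> the bound \<open>\<rho> ^ n \<le> B / \<delta>\<close> below holds for \<open>n = 0\<close> too, where minimality says nothing.\<close>
  define B where "B = max C 1"
  have B: "B \<ge> 1" "C \<le> B" by (auto simp: B_def)
  have q: "1 < \<rho> powr t" using rho t by simp
  obtain K where K: "K > 0" "\<And>n. (real n + 1) ^ 4 \<le> K * (\<rho> powr t) ^ n"
    using quartic_le_exponential[OF q] by blast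
  have sq: "(real n + 1)\<^sup>2 \<le> K * (\<rho> powr t) ^ n" for n
  proof -
    have "(real n + 1)\<^sup>2 \<le> (real n + 1) ^ 4" by (rule power_increasing) auto
    then show ?thesis using K(2)[of n] by linarith
  qed
  show "\<exists>K. \<forall>\<delta>. 0 < \<delta> \<and> \<delta> < 1 \<longrightarrow> coverable A \<delta> (K * \<delta> powr (- t))"
  proof (intro exI[of _ "K * B powr t"] allI impI, elim conjE)
    fix \<delta> :: real assume d: "0 < \<delta>" "\<delta> < 1"
    define n where "n = (LEAST n. B / \<rho> ^ Suc n \<le> \<delta>)"
    have ex: "\<exists>n. B / \<rho> ^ Suc n \<le> \<delta>"
    proof -
      obtain m where "B / \<delta> < \<rho> ^ m" using real_arch_pow[OF rho] by blast
      also have "\<dots> \<le> \<rho> ^ Suc m" using rho by (intro power_increasing) auto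
      finally have "B / \<rho> ^ Suc m \<le> \<delta>" using d rho by (simp add: field_simps)
      then show ?thesis by blast
    qed
    have n1: "B / \<rho> ^ Suc n \<le> \<delta>" unfolding n_def using LeastI_ex[OF ex] .
    have n2: "\<rho> ^ n \<le> B / \<delta>"
    proof (cases n)
      case 0 then show ?thesis using d B by (simp add: field_simps)
    next
      case (Suc m)
      then have "\<not> B / \<rho> ^ Suc m \<le> \<delta>" using not_less_Least[of m] unfolding n_def by force
      then show ?thesis using Suc d rho by (simp add: field_simps)
    qed
    have "coverable A (C / \<rho> ^ Suc n) ((real (Suc n))\<^sup>2)" by (rule cover) simp
    then obtain \<U> where U: "finite \<U>" "\<forall>U\<in>\<U>. bounded U \<and> diameter U \<le> C / \<rho> ^ Suc n"
       "A \<subseteq> \<Union>\<U>" "real (card \<U>) \<le> (real (Suc n))\<^sup>2"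
      by (rule coverableE)
    have "C / \<rho> ^ Suc n \<le> B / \<rho> ^ Suc n" using B rho by (intro divide_right_mono) auto
    then have diam: "\<forall>U\<in>\<U>. bounded U \<and> diameter U \<le> \<delta>" using U(2) n1 by force
    have "real (card \<U>) \<le> K * (\<rho> powr t) ^ n" using U(4) sq[of n] by (simp add: add.commute)
    also have "(\<rho> powr t) ^ n = (\<rho> ^ n) powr t"
      using rho by (simp add: powr_realpow[symmetric] powr_powr mult.commute)
    also have "K * (\<rho> ^ n) powr t \<le> K * (B / \<delta>) powr t"
      using K(1) n2 rho t by (intro mult_left_mono powr_mono2) auto
    also have "\<dots> = K * B powr t * \<delta> powr (- t)"
      using d B by (simp add: powr_divide powr_minus_divide)
    finally show "coverable A \<delta> (K * B powr t * \<delta> powr (- t))"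
      using U(1,3) diam unfolding coverable_def by blast
  qed
qed

lemma thin_covering_number:
  assumes "thin A" "t > 0"
  shows "\<exists>K\<ge>1. \<forall>\<delta>. 0 < \<delta> \<and> \<delta> < 1 \<longrightarrow>
     (\<exists>n. covering_number \<delta> A = enat n \<and> real n \<le> K * \<delta> powr (- t))"
proof -
  obtain K where K: "K \<ge> 1" "\<forall>\<delta>. 0 < \<delta> \<and> \<delta> < 1 \<longrightarrow>
     coverable A \<delta> (K * \<delta> powr (- t))"
    using thinD[OF assms] by blast
  have "\<exists>n. covering_number \<delta> A = enat n \<and> real n \<le> K * \<delta> powr (- t)"
    if d: "0 < \<delta> \<and> \<delta> < 1" for \<delta>
  proof -
    obtain \<U> where U: "finite \<U>" "\<forall>U\<in>\<U>. bounded U \<and> diameter U \<le> \<delta>" "A \<subseteq> \<Union>\<U>"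
      "real (card \<U>) \<le> K * \<delta> powr (- t)" by (rule coverableE[OF K(2)[rule_format, OF d]])
    have le: "covering_number \<delta> A \<le> enat (card \<U>)"
      unfolding covering_number_def using U by (intro INF_lower) auto
    then obtain n where n: "covering_number \<delta> A = enat n" by (metis enat_ile)
    then have "real n \<le> real (card \<U>)" using le by simp
    then show ?thesis using n U(4) by auto
  qed
  then show ?thesis using K(1) by blast
qed

lemma thin_has_box_dim_0:
  assumes "thin A" shows "has_box_dim A 0"
proof -
  have "(box_ratio A \<longlongrightarrow> 0) (at_right 0)"
  proof (rule order_tendstoI)
    fix a :: ereal assume a: "a < 0"
    obtain K where K: "K \<ge> 1" "\<forall>\<delta>. 0 < \<delta> \<and> \<delta> < 1 \<longrightarrow>
       (\<exists>n. covering_number \<delta> A = enat n \<and> real n \<le> K * \<delta> powr (- 1))"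
      using thin_covering_number[OF assms zero_less_one] by blast
    have "eventually (\<lambda>x::real. x \<in> {0<..<1}) (at_right 0)" by (rule eventually_at_right_real) simp
    then show "eventually (\<lambda>x. a < box_ratio A x) (at_right 0)"
    proof eventually_elim
      case (elim x)
      obtain n where n: "covering_number x A = enat n" using K(2) elim by auto
      have "0 \<le> ln (real n)" by (cases n) auto
      then have "0 \<le> ln (real n) / - ln x" using elim by (intro divide_nonneg_nonneg) auto
      then have "(0::ereal) \<le> ereal (ln (real n) / - ln x)" by simp
      then have "0 \<le> box_ratio A x" using n unfolding box_ratio_def by simp
      then show ?case using a by (rule less_le_trans[rotated])
    qed
  next
    fix a :: ereal assume a: "0 < a"
    obtain b where b: "0 < ereal b" "ereal b < a" using ereal_dense2[OF a] by blast
    define t where "t = b / 2"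
    have t: "t > 0" "ereal (2 * t) < a" using b by (auto simp: t_def)
    obtain K where K: "K \<ge> 1" "\<forall>\<delta>. 0 < \<delta> \<and> \<delta> < 1 \<longrightarrow>
       (\<exists>n. covering_number \<delta> A = enat n \<and> real n \<le> K * \<delta> powr (- t))"
      using thin_covering_number[OF assms t(1)] by blast
    have "eventually (\<lambda>x::real. x \<in> {0<..<min 1 (exp (- ln K / t))}) (at_right 0)"
      by (rule eventually_at_right_real) simp
    then show "eventually (\<lambda>x. box_ratio A x < a) (at_right 0)"
    proof eventually_elim
      case (elim x)
      obtain n where n: "covering_number x A = enat n" "real n \<le> K * x powr (- t)"
        using K(2) elim by auto
      have lx: "ln x < - ln K / t"
      using elim ln_less_cancel_iff[of x "exp (- ln K / t)"] by simp
      have l0: "ln x < 0" using elim by simp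
      have "ln (real n) \<le> ln K + t * - ln x"
      proof (cases "n = 0")
        case True
        have "t * ln x \<le> 0" using t(1) l0 by (simp add: mult_nonneg_nonpos)
        moreover have "0 \<le> ln K" using K(1) by simp
        ultimately show ?thesis using True by simp
      next
        case False
        then have "ln (real n) \<le> ln (K * x powr (- t))" using n K(1) elim by simp
        also have "\<dots> = ln K + t * - ln x" using K(1) elim by (simp add: ln_mult ln_powr)
        finally show ?thesis .
      qed
      also have "ln K \<le> t * - ln x" using lx t(1) by (simp add: field_simps)
      finally have "ln (real n) / - ln x \<le> 2 * t" using l0 by (simp add: field_simps)
      then have "box_ratio A x \<le> ereal (2 * t)" using n unfolding box_ratio_def by simp
      then show ?case using t(2) by simp
    qed
  qed
  then show ?thesis unfolding has_box_dim_def lower_box_dim_def upper_box_dim_def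
    by (simp add: lim_imp_Liminf lim_imp_Limsup)
qed

text \<open>
  Two centres in one covering set would be closer than either radius, so each centre would lie in
  the other ball.
\<close>
lemma packing_card_le:
  assumes C: "F \<subseteq> C" "C \<in> delta_packings \<delta> A" "finite F"
    and r: "\<And>x r. (x, r) \<in> F \<Longrightarrow> \<epsilon> < r"
    and U: "finite \<U>" "\<forall>U\<in>\<U>. bounded U \<and> diameter U \<le> \<epsilon>" "A \<subseteq> \<Union>\<U>"
  shows "card F \<le> card \<U>"
proof -
  have mem: "fst p \<in> A" "0 < snd p" if "p \<in> F" for p
    using that C unfolding delta_packings_def by auto
  have "\<forall>p\<in>F. \<exists>U. U \<in> \<U> \<and> fst p \<in> U" using mem U by blast
  then obtain g where g: "\<And>p. p \<in> F \<Longrightarrow> g p \<in> \<U> \<and> fst p \<in> g p" by metis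
  have "inj_on g F"
  proof (rule inj_onI, rule ccontr)
    fix p q assume pq: "p \<in> F" "q \<in> F" "g p = g q" "p \<noteq> q"
    have "dist (fst p) (fst q) \<le> diameter (g p)"
      using diameter_bounded_bound[of "g p" "fst p" "fst q"] g[of p] g[of q] pq U(2) by simp
    also have "\<dots> < snd p" using r[of "fst p" "snd p"] U(2) g[of p] pq by force
    finally have "fst q \<in> cball (fst p) (snd p)" by simp
    moreover have "fst q \<in> cball (fst q) (snd q)" using mem[of q] pq by simp
    moreover have "cball (fst p) (snd p) \<inter> cball (fst q) (snd q) = {}"
    proof -
      have "disjoint_family_on (\<lambda>(x, r). cball x r) C" "p \<in> C" "q \<in> C"
        using C pq unfolding delta_packings_def by auto
      from disjoint_family_onD[OF this pq(4)] show ?thesis by (simp add: case_prod_beta)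
    qed
    ultimately show False by blast
  qed
  then show ?thesis using g U(1) by (intro card_inj_on_le[of g]) auto
qed

lemma dyadic_scale:
  fixes r :: real assumes "0 < r" "r \<le> (1/2) ^ m"
  shows "\<exists>n\<ge>m. (1/2) ^ Suc n < r \<and> r \<le> (1/2) ^ n"
proof -
  define P where "P = (\<lambda>n. (1/2::real) ^ Suc n < r)"
  obtain n0 where "(1/2::real) ^ n0 < r" using real_arch_pow_inv[of r "1/2"] assms by auto
  moreover have "(1/2::real) ^ Suc n0 \<le> (1/2) ^ n0" by simp
  ultimately have "P n0" unfolding P_def by (rule le_less_trans[rotated])
  then have ex: "\<exists>n. P n" ..
  define n where "n = (LEAST n. P n)"
  have n: "P n" "\<And>k. k < n \<Longrightarrow> \<not> P k" unfolding n_def using LeastI_ex[OF ex] not_less_Least by auto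
  have "m \<le> n"
  proof (rule ccontr)
    assume "\<not> m \<le> n"
    then have "(1/2::real) ^ m \<le> (1/2) ^ Suc n" by (intro power_decreasing) auto
    then show False using n(1) assms unfolding P_def by simp
  qed
  moreover have "r \<le> (1/2) ^ n"
  proof (cases "n = m")
    case True then show ?thesis using assms by simp
  next
    case False
    then obtain k where "n = Suc k" using \<open>m \<le> n\<close> by (cases n) auto
    then show ?thesis using n(2)[of k] unfolding P_def by simp
  qed
  ultimately show ?thesis using n(1) unfolding P_def by blast
qed

lemma geometric_subsum_le:
  fixes q :: real assumes q: "0 \<le> q" "q < 1" and I: "finite I" "\<And>n. n \<in> I \<Longrightarrow> m \<le> n"
  shows "(\<Sum>n\<in>I. q ^ n) \<le> q ^ m / (1 - q)"
proof -
  have "(\<Sum>n\<in>I. q ^ n) = (\<Sum>n\<in>I. q ^ m * q ^ (n - m))"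
    using I by (intro sum.cong) (auto simp flip: power_add)
  also have "\<dots> = q ^ m * (\<Sum>k\<in>(\<lambda>n. n - m) ` I. q ^ k)"
    using I by (subst sum.reindex) (auto simp: sum_distrib_left inj_on_def eq_diff_iff)
  also have "(\<Sum>k\<in>(\<lambda>n. n - m) ` I. q ^ k) \<le> (\<Sum>k. q ^ k)"
    using I q by (intro sum_le_suminf) auto
  also have "(\<Sum>k. q ^ k) = 1 / (1 - q)" using q by (intro suminf_geometric) auto
  finally show ?thesis using q by (simp add: mult_left_mono)
qed

text \<open>
  The balls of a packing are grouped by dyadic size. By \<open>packing_card_le\<close> there are at most
  \<open>K 2^((n+1)t)\<close> balls of radius about \<open>2^-n\<close>. With \<open>t = s/2\<close> their total weight is \<open>O(2^(-nt))\<close>, so the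
  groups form a geometric series, whose tail vanishes as the packings become finer.
\<close>
lemma thin_packing_premeasure_0:
  fixes A :: "'a::euclidean_space set"
  assumes "thin A" and s: "0 < s"
  shows "packing_premeasure s A = 0"
proof -
  define t where "t = s / 2"
  have t: "0 < t" using s by (simp add: t_def)
  define q where "q = (1/2::real) powr t"
  have "1 < 2 powr t" using gr_one_powr[of 2 t] t by simp
  then have q: "0 < q" "q < 1" by (auto simp: q_def powr_divide)
  obtain K where K: "K \<ge> 1" "\<forall>\<delta>. 0 < \<delta> \<and> \<delta> < 1 \<longrightarrow>
     coverable A \<delta> (K * \<delta> powr (- t))"
    using thinD[OF assms(1) t] by blast
  define B where "B = K * 2 powr t * 2 powr s"
  have B: "B > 0" using K by (simp add: B_def)
  have main: "packing_premeasure_delta s ((1/2) ^ m) A \<le> ennreal (B * q ^ m / (1 - q))" for m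
    unfolding packing_premeasure_delta_def
  proof (rule SUP_least)
    fix C assume C: "C \<in> delta_packings ((1/2) ^ m) A"
    have Cr: "0 < snd p \<and> snd p \<le> (1/2) ^ m" if "p \<in> C" for p
      using that C unfolding delta_packings_def by auto
    have "\<forall>p\<in>C. \<exists>n\<ge>m. (1/2) ^ Suc n < snd p \<and> snd p \<le> (1/2) ^ n"
      using Cr dyadic_scale by blast
    then obtain g where g: "\<And>p. p \<in> C \<Longrightarrow> m \<le> g p \<and> (1/2) ^ Suc (g p) < snd p \<and> snd p \<le> (1/2) ^ g p"
      by metis
    have dp: "(case p of (x, r) \<Rightarrow> diam_pow s (cball x r)) = ennreal ((2 * snd p) powr s)" if "p \<in> C" for p
      using Cr[OF that] s by (auto simp: diam_pow_def case_prod_beta)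
    have "sum (\<lambda>(x, r). diam_pow s (cball x r)) F \<le> ennreal (B * q ^ m / (1 - q))"
      if F: "finite F" "F \<subseteq> C" for F
    proof -
      have level: "(\<Sum>p | p \<in> F \<and> g p = n. (2 * snd p) powr s) \<le> B * q ^ n" for n
      proof -
        let ?G = "{p \<in> F. g p = n}"
        have half: "0 < (1/2::real) ^ Suc n" "(1/2::real) ^ Suc n < 1" by (simp, rule power_Suc_less_one) simp_all
        obtain \<U> where U: "finite \<U>" "\<forall>U\<in>\<U>. bounded U \<and> diameter U \<le> (1/2) ^ Suc n" "A \<subseteq> \<Union>\<U>"
          "real (card \<U>) \<le> K * ((1/2) ^ Suc n) powr (- t)" by (rule coverableE[OF K(2)[rule_format, OF conjI[OF half]]])
        have "card ?G \<le> card \<U>"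
        proof (rule packing_card_le[OF _ C _ _ U(1-3)])
          show "\<And>x r. (x, r) \<in> ?G \<Longrightarrow> (1/2) ^ Suc n < r" using g F by force
        qed (use F in auto)
        then have card: "real (card ?G) \<le> K * ((1/2) ^ Suc n) powr (- t)" using U(4) by linarith
        have "(2 * snd p) powr s \<le> (2 * (1/2) ^ n) powr s" if "p \<in> ?G" for p
          using g[of p] Cr[of p] F that s by (intro powr_mono2) auto
        then have "(\<Sum>p\<in>?G. (2 * snd p) powr s) \<le> real (card ?G) * (2 * (1/2) ^ n) powr s"
          by (rule sum_bounded_above)
        also have "\<dots> \<le> (K * ((1/2) ^ Suc n) powr (- t)) * (2 * (1/2) ^ n) powr s"
          by (intro mult_right_mono card) simp
        also have "\<dots> = B * q ^ n"
        proof -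
          have half: "(1/2::real) powr a = 2 powr (- a)" for a by (simp add: powr_divide powr_minus_divide)
          have half_pow: "(1/2::real) ^ k = 2 powr (- real k)" for k
          proof -
            have "(2::real) powr (- real k) = inverse (2 ^ k)" by (simp add: powr_minus powr_realpow)
            then show ?thesis by (simp only: power_one_over inverse_eq_divide)
          qed
          have e1: "((1/2) ^ Suc n :: real) powr (- t) = 2 powr ((real n + 1) * t)"
            unfolding half_pow by (simp add: powr_powr algebra_simps)
          have e2: "(2 * (1/2) ^ n :: real) powr s = 2 powr s * 2 powr (- (real n * s))"
            unfolding half_pow by (subst powr_mult) (simp_all add: powr_powr)
          have e3: "q ^ n = 2 powr (- (real n * t))"
            unfolding q_def half by (simp add: powr_power mult.commute)
          show ?thesis unfolding e1 e2 e3 B_def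
            by (simp add: powr_add[symmetric] t_def field_simps)
        qed
        finally show ?thesis .
      qed
      have "(\<Sum>p\<in>F. (2 * snd p) powr s) = (\<Sum>n\<in>g ` F. \<Sum>p | p \<in> F \<and> g p = n. (2 * snd p) powr s)"
        by (rule sum.image_gen[OF F(1)])
      also have "\<dots> \<le> (\<Sum>n\<in>g ` F. B * q ^ n)" by (rule sum_mono[OF level])
      also have "\<dots> = B * (\<Sum>n\<in>g ` F. q ^ n)" by (simp add: sum_distrib_left)
      also have "\<dots> \<le> B * (q ^ m / (1 - q))"
        using F g q B by (intro mult_left_mono geometric_subsum_le) auto
      finally have fin: "(\<Sum>p\<in>F. (2 * snd p) powr s) \<le> B * q ^ m / (1 - q)" by simp
      have "sum (\<lambda>(x, r). diam_pow s (cball x r)) F = (\<Sum>p\<in>F. ennreal ((2 * snd p) powr s))"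
        using F dp by (intro sum.cong) auto
      also have "\<dots> = ennreal (\<Sum>p\<in>F. (2 * snd p) powr s)" by (simp add: sum_ennreal)
      finally show ?thesis using fin by (simp add: ennreal_leI)
    qed
    then show "(\<Sum>\<^sub>\<infinity>(x, r)\<in>C. diam_pow s (cball x r)) \<le> ennreal (B * q ^ m / (1 - q))"
      by (intro infsum_le_finite_sums nonneg_summable_on_complete) auto
  qed
  have "packing_premeasure s A \<le> ennreal (B * q ^ m / (1 - q))" for m
  proof -
    have "packing_premeasure s A \<le> packing_premeasure_delta s ((1/2) ^ m) A"
      unfolding packing_premeasure_def by (rule INF_lower) simp
    also note main
    finally show ?thesis .
  qed
  moreover have "(\<lambda>m. ennreal (B * q ^ m / (1 - q))) \<longlonglongrightarrow> ennreal 0"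
  proof (rule tendsto_ennrealI)
    have "(\<lambda>m. B * q ^ m / (1 - q)) \<longlonglongrightarrow> B * 0 / (1 - q)"
      using q by (intro tendsto_intros LIMSEQ_power_zero) auto
    then show "(\<lambda>m. B * q ^ m / (1 - q)) \<longlonglongrightarrow> 0" by simp
  qed
  ultimately have "packing_premeasure s A \<le> ennreal 0"
    by (intro LIMSEQ_le_const) auto
  then show ?thesis by simp
qed

lemma INF_ereal_eq_0:
  assumes "\<And>s. 0 < s \<Longrightarrow> s \<in> X" "\<And>s. s \<in> X \<Longrightarrow> 0 \<le> s"
  shows "(INF s\<in>X. ereal s) = 0"
proof (rule antisym)
  show "(INF s\<in>X. ereal s) \<le> 0"
  proof (rule ereal_le_epsilon2)
    fix e :: real assume "0 < e"
    then have "(INF s\<in>X. ereal s) \<le> ereal e" by (intro INF_lower assms(1))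
    then show "(INF s\<in>X. ereal s) \<le> 0 + ereal e" by simp
  qed
qed (use assms(2) in \<open>auto intro: INF_greatest\<close>)

text \<open>
  The packing measure admits countable decompositions, so it is enough that the pieces are thin;
  the whole set may be unbounded and of positive box dimension.
\<close>
lemma packing_dim_eq_0:
  assumes "A \<subseteq> (\<Union>i::nat. F i)" "\<And>i. thin (F i)"
  shows "packing_dim A = 0"
  unfolding packing_dim_def
proof (rule INF_ereal_eq_0)
  fix s :: real assume s: "0 < s"
  have "packing_measure s A \<le> (\<Sum>i. packing_premeasure s (F i))"
    unfolding packing_measure_def using assms by (intro INF_lower) auto
  also have "\<dots> = 0" by (simp add: thin_packing_premeasure_0[OF assms(2) s])
  finally show "s \<in> {s. 0 \<le> s \<and> packing_measure s A = 0}" using s by simp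
qed auto

lemma hausdorff_premeasure_UN_eq_0:
  fixes A :: "nat \<Rightarrow> 'a::euclidean_space set"
  assumes "\<And>k. hausdorff_premeasure s \<delta> (A k) = 0"
  shows "hausdorff_premeasure s \<delta> (\<Union>k. A k) = 0"
proof -
  have "hausdorff_premeasure s \<delta> (\<Union>k. A k) \<le> 0 + ennreal e" if e: "0 < e" for e
  proof -
    have "\<exists>U\<in>delta_covers \<delta> (A k). (\<Sum>i. diam_pow s (U i)) < ennreal (e * (1/2) ^ Suc k)" for k
    proof -
      have "hausdorff_premeasure s \<delta> (A k) < ennreal (e * (1/2) ^ Suc k)"
        using assms e by (simp add: ennreal_zero_less_mult_iff)
      then show ?thesis unfolding hausdorff_premeasure_def by (simp add: INF_less_iff)
    qed
    then obtain V where V: "\<And>k. V k \<in> delta_covers \<delta> (A k)"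
      "\<And>k. (\<Sum>i. diam_pow s (V k i)) < ennreal (e * (1/2) ^ Suc k)" by metis
    define W where "W = (\<lambda>n. case prod_decode n of (k, i) \<Rightarrow> V k i)"
    have W: "W \<in> delta_covers \<delta> (\<Union>k. A k)"
    proof -
      have "x \<in> (\<Union>n. W n)" if x: "x \<in> A k" for x k
      proof -
        have "A k \<subseteq> (\<Union>i. V k i)" using V(1)[of k] unfolding delta_covers_def by simp
        then obtain i where "x \<in> V k i" using x by blast
        then have "x \<in> W (prod_encode (k, i))" by (simp add: W_def)
        then show ?thesis by blast
      qed
      then show ?thesis using V(1) unfolding delta_covers_def W_def by (auto split: prod.split)
    qed
    have "(\<Sum>n. diam_pow s (W n)) = (\<Sum>k. \<Sum>i. diam_pow s (V k i))"
    proof -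
      have "(\<Sum>n. diam_pow s (W n)) = (\<Sum>n. (\<lambda>(k,i). diam_pow s (V k i)) (prod_decode n))"
        by (simp add: W_def case_prod_beta)
      also have "\<dots> = (\<Sum>k. \<Sum>i. diam_pow s (V k i))"
        by (rule suminf_ennreal_2dimen) simp
      finally show ?thesis .
    qed
    also have "\<dots> \<le> (\<Sum>k. ennreal (e * (1/2) ^ Suc k))"
      using V(2) by (intro suminf_le) (auto intro: less_imp_le)
    also have "\<dots> = ennreal e"
    proof -
      have "(\<lambda>k. e * (1/2) ^ Suc k) sums (e * 1)" by (intro sums_mult power_half_series)
      then show ?thesis using e by (intro suminf_ennreal_eq) auto
    qed
    finally show ?thesis
      unfolding hausdorff_premeasure_def by (intro order_trans[OF INF_lower[OF W]]) simp
  qed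
  then have "hausdorff_premeasure s \<delta> (\<Union>k. A k) \<le> 0" by (rule ennreal_le_epsilon)
  then show ?thesis by simp
qed

lemma hausdorff_dim_eq_0:
  fixes A :: "nat \<Rightarrow> 'a::euclidean_space set"
  assumes "\<And>s \<delta> k. 0 < s \<Longrightarrow> 0 < \<delta> \<Longrightarrow> hausdorff_premeasure s \<delta> (A k) = 0"
  shows "hausdorff_dim (\<Union>k. A k) = 0"
  unfolding hausdorff_dim_def
proof (rule INF_ereal_eq_0)
  fix s :: real assume s: "0 < s"
  have "hausdorff_measure s (\<Union>k. A k) = 0"
    unfolding hausdorff_measure_def
    by (simp add: hausdorff_premeasure_UN_eq_0 assms s)
  then show "s \<in> {s. 0 \<le> s \<and> hausdorff_measure s (\<Union>k. A k) = 0}" using s by simp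
qed auto

text \<open>
  Turns a family over an arbitrary countable index set into the sequences that the definition of the
  premeasure requires; the unused positions of the sequence hold the empty set, which has weight 0.
\<close>
lemma hausdorff_premeasure_le_sums:
  fixes J :: "'i \<Rightarrow> 'a::euclidean_space set"
  assumes I: "countable I" "A \<subseteq> (\<Union>i\<in>I. J i)" and s: "0 < s" and d: "0 < \<delta>"
    and J: "\<And>i. i \<in> I \<Longrightarrow> bounded (J i) \<and> diameter (J i) \<le> \<delta>"
    and sums: "\<And>F. finite F \<Longrightarrow> F \<subseteq> I \<Longrightarrow> (\<Sum>i\<in>F. diameter (J i) powr s) \<le> \<eta>"
  shows "hausdorff_premeasure s \<delta> A \<le> ennreal \<eta>"
proof -
  define e where "e = to_nat_on I"
  have inj: "inj_on e I" unfolding e_def using I(1) by (rule inj_on_to_nat_on)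
  define U where "U n = (if n \<in> e ` I then J (the_inv_into I e n) else {})" for n
  have Ue: "U (e i) = J i" if "i \<in> I" for i
    using that inj by (simp add: U_def the_inv_into_f_f)
  have cov: "U \<in> delta_covers \<delta> A"
  proof -
    have "bounded (U n) \<and> diameter (U n) \<le> \<delta>" for n
    proof (cases "n \<in> e ` I")
      case True then show ?thesis using Ue J by auto
    next
      case False then show ?thesis using d by (simp add: U_def)
    qed
    moreover have "A \<subseteq> (\<Union>n. U n)" using I(2) Ue by blast
    ultimately show ?thesis unfolding delta_covers_def by blast
  qed
  have "(\<Sum>n. diam_pow s (U n)) \<le> ennreal \<eta>"
    unfolding suminf_eq_SUP
  proof (rule SUP_least)
    fix m
    define F where "F = {i \<in> I. e i < m}"
    have F: "finite F" "F \<subseteq> I"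
    proof -
      have "e ` F \<subseteq> {..<m}" by (auto simp: F_def)
      then have "finite (e ` F)" by (rule finite_subset) simp
      moreover have "inj_on e F" using inj by (rule inj_on_subset) (auto simp: F_def)
      ultimately show "finite F" by (rule finite_imageD)
    qed (auto simp: F_def)
    have "(\<Sum>n<m. diam_pow s (U n)) = (\<Sum>n\<in>e ` F. diam_pow s (U n))"
    proof (rule sum.mono_neutral_right)
      show "\<forall>n\<in>{..<m} - e ` F. diam_pow s (U n) = 0"
        by (auto simp: F_def U_def diam_pow_def)
    qed (auto simp: F_def)
    also have "\<dots> = (\<Sum>i\<in>F. diam_pow s (U (e i)))"
      using inj F by (subst sum.reindex) (auto intro: inj_on_subset)
    also have "\<dots> \<le> (\<Sum>i\<in>F. ennreal (diameter (J i) powr s))"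
      using Ue F s by (intro sum_mono) (auto simp: diam_pow_def)
    also have "\<dots> = ennreal (\<Sum>i\<in>F. diameter (J i) powr s)" by (simp add: sum_ennreal)
    also have "\<dots> \<le> ennreal \<eta>" using sums F by (intro ennreal_leI) auto
    finally show "(\<Sum>n<m. diam_pow s (U n)) \<le> ennreal \<eta>" .
  qed
  then show ?thesis unfolding hausdorff_premeasure_def by (intro order_trans[OF INF_lower[OF cov]])
qed

section \<open>Values of digit sequences\<close>

lemma base_value_summable:
  assumes D: "sset c \<subseteq> {..D}" and x: "1 < x"
  shows "summable (\<lambda>i. real (c !! i) / x ^ (i + 1))"
proof (rule summable_comparison_test')
  show "summable (\<lambda>i. real D * (1 / x) ^ (i + 1))"
    using x by (intro summable_mult) (simp add: summable_geometric)
  fix i :: nat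
  have "c !! i \<le> D" using D snth_sset[of c i] by blast
  then show "norm (real (c !! i) / x ^ (i + 1)) \<le> real D * (1 / x) ^ (i + 1)"
    using x by (simp add: power_one_over divide_right_mono)
qed

lemma base_value_nonneg: "1 < x \<Longrightarrow> sset c \<subseteq> {..D} \<Longrightarrow> 0 \<le> base_value c x"
  unfolding base_value_def using base_value_summable by (intro suminf_nonneg) auto

lemma base_value_le:
  assumes D: "sset c \<subseteq> {..D}" and x: "1 < x"
  shows "base_value c x \<le> real D / (x - 1)"
proof -
  have "(\<lambda>i. (1 / x) ^ i) sums (1 / (1 - 1 / x))" using x by (intro geometric_sums) auto
  then have "(\<lambda>i. real D / x * (1 / x) ^ i) sums (real D / x * (1 / (1 - 1 / x)))" by (rule sums_mult)
  moreover have "real D / x * (1 / (1 - 1 / x)) = real D / (x - 1)" using x by (simp add: field_simps)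
  moreover have "(\<lambda>i. real D / x * (1 / x) ^ i) = (\<lambda>i. real D / x ^ (i + 1))"
    by (simp add: power_one_over)
  ultimately have s: "(\<lambda>i. real D / x ^ (i + 1)) sums (real D / (x - 1))" by metis
  have "base_value c x \<le> (\<Sum>i. real D / x ^ (i + 1))"
    unfolding base_value_def
  proof (rule suminf_le)
    fix i have "c !! i \<le> D" using D snth_sset[of c i] by blast
    then show "real (c !! i) / x ^ (i + 1) \<le> real D / x ^ (i + 1)"
      using x by (intro divide_right_mono) auto
  qed (use base_value_summable[OF D x] s sums_summable in auto)
  then show ?thesis using s by (simp add: sums_iff)
qed

lemma base_value_Stream:
  assumes D: "sset c \<subseteq> {..D}" and x: "1 < x"
  shows "base_value (a ## c) x = (real a + base_value c x) / x"
proof -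
  have "(\<lambda>i. real (c !! i) / x ^ (i + 1)) sums base_value c x"
    unfolding base_value_def using base_value_summable[OF D x] by (rule summable_sums)
  then have "(\<lambda>i. real (c !! i) / x ^ (i + 1) / x) sums (base_value c x / x)" by (rule sums_divide)
  then have "(\<lambda>i. real ((a ## c) !! Suc i) / x ^ (Suc i + 1)) sums (base_value c x / x)"
    by (simp add: mult.commute)
  then have "(\<lambda>i. real ((a ## c) !! i) / x ^ (i + 1)) sums
      (base_value c x / x + real ((a ## c) !! 0) / x ^ (0 + 1))"
    by (rule sums_Suc)
  then show ?thesis unfolding base_value_def by (simp add: sums_iff add_divide_distrib)
qed

lemma base_value_shift_diff:
  assumes "sset c \<subseteq> {..D}" "sset d \<subseteq> {..D}" "set z \<subseteq> {..D}" and x: "1 < x"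
  shows "base_value (z @- c) x - base_value (z @- d) x = (base_value c x - base_value d x) / x ^ length z"
  using assms(3)
proof (induction z)
  case (Cons a z)
  have "sset (z @- c) \<subseteq> {..D}" "sset (z @- d) \<subseteq> {..D}" using Cons.prems assms by auto
  then have "base_value ((a # z) @- c) x - base_value ((a # z) @- d) x =
      (base_value (z @- c) x - base_value (z @- d) x) / x"
    using base_value_Stream[OF _ x, of "z @- c" D a] base_value_Stream[OF _ x, of "z @- d" D a]
    by (simp add: diff_divide_distrib add_divide_distrib)
  then show ?case using Cons by simp
qed simp

lemma base_value_shift_ge:
  assumes D: "sset c \<subseteq> {..D}" "set z \<subseteq> {..D}" and x: "1 < x"
  shows "real (sum_list z) / x ^ length z \<le> base_value (z @- c) x"
  using D(2)
proof (induction z)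
  case Nil
  then show ?case using base_value_nonneg[OF x D(1)] by simp
next
  case (Cons a z)
  have "real (sum_list (a # z)) / x ^ length (a # z) = (real a / x ^ length z + real (sum_list z) / x ^ length z) / x"
    by (simp add: add_divide_distrib mult.commute)
  also have "\<dots> \<le> (real a + base_value (z @- c) x) / x"
  proof (intro divide_right_mono add_mono)
    have "1 \<le> x ^ length z" using x by simp
    then show "real a / x ^ length z \<le> real a" using mult_left_mono[of 1 "x ^ length z" "real a"] x by (simp add: divide_le_eq)
  qed (use Cons x in auto)
  also have "\<dots> = base_value ((a # z) @- c) x"
    using Cons.prems D x by (simp add: base_value_Stream[where D=D])
  finally show ?case .
qed

lemma base_value_antimono:
  assumes D: "sset c \<subseteq> {..D}" and x: "1 < x" "x \<le> y"
  shows "base_value c y \<le> base_value c x"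
  unfolding base_value_def
proof (rule suminf_le)
  fix i show "real (c !! i) / y ^ (i + 1) \<le> real (c !! i) / x ^ (i + 1)"
    using x by (intro divide_left_mono power_mono mult_pos_pos zero_less_power) auto
qed (use base_value_summable[OF D] x in auto)

text \<open>
  The first digit alone contributes at least the left-hand side, and the remaining digits are
  monotone in the base.
\<close>
lemma base_value_head_gap:
  assumes D: "sset c \<subseteq> {..D}" and x: "1 < x" "x \<le> y" and h: "1 \<le> shd c"
  shows "1 / x - 1 / y \<le> base_value c x - base_value c y"
proof -
  have D': "sset (stl c) \<subseteq> {..D}" using D by (auto dest: stl_sset)
  have eq: "base_value c t = real (shd c) / t + base_value (stl c) t / t" if "1 < t" for t
    using base_value_Stream[OF D' that, of "shd c"] by (simp add: add_divide_distrib)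
  have "base_value (stl c) y / y \<le> base_value (stl c) x / x"
    using base_value_antimono[OF D' x] base_value_nonneg[OF _ D', of y] x
    by (intro frac_le) auto
  moreover have "1 * (1 / x - 1 / y) \<le> real (shd c) * (1 / x - 1 / y)"
    using h x by (intro mult_right_mono) (auto simp: field_simps)
  ultimately show ?thesis using eq[of x] eq[of y] x by (simp add: algebra_simps)
qed

lemma base_value_strict_antimono:
  assumes D: "sset c \<subseteq> {..D}" and x: "1 < x" "x < y" and h: "1 \<le> shd c"
  shows "base_value c y < base_value c x"
proof -
  have "1 / y < 1 / x" using x by (simp add: field_simps)
  then show ?thesis using base_value_head_gap[OF D x(1) _ h, of y] x by simp
qed

lemma base_value_isCont:
  assumes D: "sset c \<subseteq> {..D}" and x: "1 < x"
  shows "isCont (base_value c) x"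
proof -
  let ?f = "\<lambda>i. case i of 0 \<Rightarrow> 0 | Suc i \<Rightarrow> real (c !! i)"
  have eq: "base_value c y = (\<Sum>i. ?f i * (1 / y) ^ i)" if y: "1 < y" for y
  proof -
    have "(\<lambda>i. ?f (Suc i) * (1 / y) ^ Suc i) sums base_value c y"
      using base_value_summable[OF D y] unfolding base_value_def
      by (simp add: power_one_over summable_sums)
    then have "(\<lambda>i. ?f i * (1 / y) ^ i) sums (base_value c y + ?f 0 * (1 / y) ^ 0)"
      by (rule sums_Suc)
    then show ?thesis by (simp add: sums_iff)
  qed
  \<comment> \<open>Any number strictly between \<open>1 / x\<close> and the radius of convergence 1 serves.\<close>
  define K where "K = 2 / (1 + x)"
  have K: "1 / x < K" "K < 1" "0 < K" using x by (auto simp: K_def field_simps)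
  have "summable (\<lambda>i. ?f i * K ^ i)"
  proof -
    have "1 < 1 / K" using K by simp
    from base_value_summable[OF D this]
    have "summable (\<lambda>i. ?f (Suc i) * K ^ Suc i)" by (simp add: power_one_over)
    then show ?thesis using summable_Suc_iff[of "\<lambda>i. ?f i * K ^ i"] by blast
  qed
  then have "isCont (\<lambda>t. \<Sum>i. ?f i * t ^ i) (1 / x)"
    by (rule isCont_powser) (use K x in auto)
  moreover have "isCont (\<lambda>y. 1 / y) x" using x by (intro continuous_intros) auto
  ultimately have cont: "isCont (\<lambda>y. \<Sum>i. ?f i * (1 / y) ^ i) x" by (rule isCont_o2[rotated])
  have "eventually (\<lambda>y. base_value c y = (\<Sum>i. ?f i * (1 / y) ^ i)) (nhds x)"
  proof (rule eventually_nhds[THEN iffD2], intro exI conjI)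
    show "open {1::real<..}" "x \<in> {1<..}" using x by auto
  qed (use eq in auto)
  from isCont_cong[OF this] cont show ?thesis by (rule iffD2)
qed

text \<open>
  The digit sum of the prefix \<open>z\<close> is at least 2, so the value exceeds 1 at a base close to 1;
  boundedness of the digits makes it at most 1 at a large base. In between, continuity gives a solution,
  and the positive first digit makes it unique.
\<close>
lemma base_of_solves:
  assumes D: "sset c \<subseteq> {..D}" "set z \<subseteq> {..D}" and h: "1 \<le> shd (z @- c)" and z: "2 \<le> sum_list z"
  shows "1 < base_of (z @- c) \<and> base_value (z @- c) (base_of (z @- c)) = 1"
proof -
  let ?V = "base_value (z @- c)"
  have D': "sset (z @- c) \<subseteq> {..D}" using D by simp
  define n where "n = length z"
  have n: "n \<noteq> 0" using z by (auto simp: n_def)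
  \<comment> \<open>At this base each digit of \<open>z\<close> has weight at least 1/2.\<close>
  define a where "a = root n 2"
  have a: "1 < a" "a ^ n = 2" using n by (auto simp: a_def)
  have "a \<le> a ^ n" using a n by (intro self_le_power) auto
  then have a2: "a \<le> 2" using a by simp
  have "1 \<le> real (sum_list z) / a ^ n" using z a by simp
  also have "\<dots> \<le> ?V a" unfolding n_def by (rule base_value_shift_ge[OF D a(1)])
  finally have lo: "1 \<le> ?V a" .
  have "?V (real D + 2) \<le> real D / (real D + 2 - 1)" by (rule base_value_le[OF D']) simp
  also have "\<dots> \<le> 1" by simp
  finally have hi: "?V (real D + 2) \<le> 1" .
  have "\<exists>x. a \<le> x \<and> x \<le> real D + 2 \<and> ?V x = 1"
    using lo hi a a2 base_value_isCont[OF D'] by (intro IVT2) auto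
  then obtain b where "a \<le> b" and Vb: "?V b = 1" by blast
  then have b: "1 < b" "?V b = 1" using a by simp_all
  have "base_of (z @- c) = b" unfolding base_of_def
  proof (rule the_equality)
    fix x assume "1 < x \<and> ?V x = 1"
    then show "x = b"
      using b base_value_strict_antimono[OF D' _ _ h, of x b] base_value_strict_antimono[OF D' _ _ h, of b x]
      by (cases x b rule: linorder_cases) auto
  qed (use b in auto)
  then show ?thesis using b by simp
qed

lemma base_of_le_iff:
  assumes D: "sset c \<subseteq> {..D}" and h: "1 \<le> shd c"
    and b: "1 < base_of c \<and> base_value c (base_of c) = 1" and x: "1 < x"
  shows "base_of c \<le> x \<longleftrightarrow> base_value c x \<le> 1" "x \<le> base_of c \<longleftrightarrow> 1 \<le> base_value c x"
  using base_value_strict_antimono[OF D _ _ h, of x "base_of c"]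
    base_value_strict_antimono[OF D _ _ h, of "base_of c" x] b x
  by (cases x "base_of c" rule: linorder_cases; force)+

text \<open>
  For sequences with associated bases these are the bases \<open>x > 1\<close> between \<open>base_of c\<close> and \<open>base_of d\<close>.
  The formulation by values also covers \<open>c = 1000\<dots>\<close>, whose base would be 1.
\<close>
definition gap :: "nat stream \<Rightarrow> nat stream \<Rightarrow> real set" where
  "gap c d = {x. 1 < x \<and> base_value c x \<le> 1 \<and> 1 \<le> base_value d x}"

text \<open>
  For \<open>x \<le> y\<close> in the gap, \<open>value c x \<le> 1 \<le> value d y\<close>. The drop of \<open>value c\<close> from \<open>x\<close> to \<open>y\<close> is at
  least \<open>(y - x) / M^2\<close>, and it is at most the difference of the two values at \<open>y\<close>, to which only the
  digits after the common prefix contribute.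
\<close>
lemma gap_common_prefix:
  assumes D: "sset c \<subseteq> {..D}" "sset d \<subseteq> {..D}" "set z \<subseteq> {..D}"
    and z: "z \<noteq> []" "1 \<le> hd z" and rho: "1 < \<rho>"
  shows "bounded (gap (z @- c) (z @- d) \<inter> {\<rho>..M})"
    "diameter (gap (z @- c) (z @- d) \<inter> {\<rho>..M}) \<le> M\<^sup>2 * D / (\<rho> - 1) / \<rho> ^ length z"
proof -
  let ?G = "gap (z @- c) (z @- d) \<inter> {\<rho>..M}"
  let ?B = "M\<^sup>2 * D / (\<rho> - 1) / \<rho> ^ length z"
  show "bounded ?G" by (rule bounded_subset[of "{\<rho>..M}"]) auto
  have B: "0 \<le> ?B" using rho by simp
  have le: "y - x \<le> ?B" if xy: "x \<in> ?G" "y \<in> ?G" "x \<le> y" for x y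
  proof -
    have x: "1 < x" "1 < y" "\<rho> \<le> y" "y \<le> M" using xy rho by auto
    have Dc: "sset (z @- c) \<subseteq> {..D}" using D by auto
    have h: "1 \<le> shd (z @- c)" using z by simp
    have "(y - x) / M\<^sup>2 \<le> (y - x) / (x * y)"
    proof -
      have "x * y \<le> M * M" using x xy by (intro mult_mono) auto
      then show ?thesis using x xy by (intro divide_left_mono) (auto simp: power2_eq_square)
    qed
    also have "\<dots> = 1 / x - 1 / y" using x by (simp add: field_simps)
    also have "\<dots> \<le> base_value (z @- c) x - base_value (z @- c) y"
      by (rule base_value_head_gap[OF Dc x(1) xy(3) h])
    also have "\<dots> \<le> base_value (z @- d) y - base_value (z @- c) y"
      using xy unfolding gap_def by simp
    also have "\<dots> = (base_value d y - base_value c y) / y ^ length z"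
      by (rule base_value_shift_diff[OF D(2,1,3) x(2)])
    also have "\<dots> \<le> (real D / (\<rho> - 1)) / \<rho> ^ length z"
    proof (rule frac_le)
      have "base_value d y \<le> real D / (y - 1)" by (rule base_value_le[OF D(2) x(2)])
      also have "\<dots> \<le> real D / (\<rho> - 1)" using x rho by (intro divide_left_mono) auto
      finally show "base_value d y - base_value c y \<le> real D / (\<rho> - 1)"
        using base_value_nonneg[OF x(2) D(1)] by simp
    qed (use x rho in \<open>auto intro: power_mono\<close>)
    finally have "(y - x) / M\<^sup>2 \<le> (real D / (\<rho> - 1)) / \<rho> ^ length z" .
    moreover have "0 < M\<^sup>2" using x by simp
    ultimately show ?thesis by (simp add: pos_divide_le_eq mult.commute)
  qed
  show "diameter ?G \<le> ?B"
  proof (rule diameter_le)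
    fix x y assume "x \<in> ?G" "y \<in> ?G"
    then show "norm (x - y) \<le> ?B" using le[of x y] le[of y x] by (cases "x \<le> y") auto
  qed (use B in simp)
qed

section \<open>Lyndon words and block codes\<close>

text \<open>
  The first difference occurs at a position present in both words. Unlike the dictionary order, this
  relation does not count a proper prefix as smaller, so it survives appending arbitrary words on both
  sides. The order of the digits is a parameter because the largest rotation is a Lyndon word for the
  reversed order.
\<close>
definition lex_lt :: "('a \<Rightarrow> 'a \<Rightarrow> bool) \<Rightarrow> 'a list \<Rightarrow> 'a list \<Rightarrow> bool" where
  "lex_lt R xs ys \<longleftrightarrow> (\<exists>p a s b t. xs = p @ a # s \<and> ys = p @ b # t \<and> R a b)"

definition lex_le :: "('a \<Rightarrow> 'a \<Rightarrow> bool) \<Rightarrow> 'a list \<Rightarrow> 'a list \<Rightarrow> bool" where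
  "lex_le R xs ys \<longleftrightarrow> xs = ys \<or> lex_lt R xs ys"

lemma lex_ltI: "R a b \<Longrightarrow> lex_lt R (p @ a # s) (p @ b # t)"
  unfolding lex_lt_def by blast

lemma lex_lt_append: "lex_lt R xs ys \<Longrightarrow> lex_lt R (xs @ u) (ys @ v)"
  unfolding lex_lt_def by (metis append.assoc append_Cons)

lemma lex_lt_same_prefix: "lex_lt R xs ys \<Longrightarrow> lex_lt R (p @ xs) (p @ ys)"
  unfolding lex_lt_def by (metis append.assoc)

lemma lex_lt_append_le:
  assumes "lex_le R xs ys" "lex_lt R us vs" shows "lex_lt R (xs @ us) (ys @ vs)"
  using assms lex_lt_append lex_lt_same_prefix unfolding lex_le_def by metis

lemma lex_le_take: assumes "lex_le R xs ys" shows "lex_le R (take n xs) (take n ys)"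
proof (cases "xs = ys")
  case False
  then obtain p a s b t where e: "xs = p @ a # s" "ys = p @ b # t" "R a b"
    using assms unfolding lex_le_def lex_lt_def by blast
  show ?thesis
  proof (cases "n \<le> length p")
    case False
    then obtain m where "n - length p = Suc m" using not_less_eq_eq by (cases "n - length p") auto
    then show ?thesis using e False by (auto simp: lex_le_def intro!: lex_ltI)
  qed (simp add: e lex_le_def)
qed (simp add: lex_le_def)

lemma lex_lt_take: assumes "lex_lt R xs ys" "length ys \<le> length xs" shows "lex_lt R (take (length ys) xs) ys"
proof -
  obtain p a s b t where e: "xs = p @ a # s" "ys = p @ b # t" "R a b"
    using assms unfolding lex_lt_def by blast
  then show ?thesis by (auto intro!: lex_ltI)
qed

lemma lex_lt_converse: "lex_lt (\<lambda>a b. R b a) xs ys = lex_lt R ys xs"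
  unfolding lex_lt_def by blast

lemma lex_le_converse: "lex_le (\<lambda>a b. R b a) xs ys = lex_le R ys xs"
  unfolding lex_le_def using lex_lt_converse[of R xs ys] by blast

lemma lex_lt_Cons: "irreflp R \<Longrightarrow> lex_lt R (a # xs) (b # ys) \<longleftrightarrow> R a b \<or> a = b \<and> lex_lt R xs ys"
proof
  assume irr: "irreflp R" and "lex_lt R (a # xs) (b # ys)"
  then obtain p a' s b' t where e: "a # xs = p @ a' # s" "b # ys = p @ b' # t" "R a' b'"
    unfolding lex_lt_def by blast
  then show "R a b \<or> a = b \<and> lex_lt R xs ys"
    by (cases p) (auto intro: lex_ltI)
next
  assume "R a b \<or> a = b \<and> lex_lt R xs ys"
  then show "lex_lt R (a # xs) (b # ys)"
    using lex_ltI[of R a b "[]"] lex_lt_same_prefix[of R xs ys "[a]"] by auto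
qed

lemma lex_lt_Nil [simp]: "\<not> lex_lt R [] ys" "\<not> lex_lt R xs []"
  unfolding lex_lt_def by auto

lemma lex_lt_trans:
  assumes R: "irreflp R" "transp R" and "lex_lt R xs ys" "lex_lt R ys zs"
  shows "lex_lt R xs zs"
  using assms(3,4)
proof (induction xs arbitrary: ys zs)
  case (Cons a xs)
  obtain b ys' where ys: "ys = b # ys'" using Cons.prems by (cases ys) auto
  obtain c zs' where zs: "zs = c # zs'" using Cons.prems by (cases zs) auto
  show ?case
    using Cons R(2) unfolding ys zs lex_lt_Cons[OF R(1)] by (metis transpD)
qed simp

lemma lex_le_lt_trans:
  "irreflp R \<Longrightarrow> transp R \<Longrightarrow> lex_le R xs ys \<Longrightarrow> lex_lt R ys zs \<Longrightarrow> lex_lt R xs zs"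
  using lex_lt_trans unfolding lex_le_def by metis

lemma lex_lt_le_trans:
  "irreflp R \<Longrightarrow> transp R \<Longrightarrow> lex_lt R xs ys \<Longrightarrow> lex_le R ys zs \<Longrightarrow> lex_lt R xs zs"
  using lex_lt_trans unfolding lex_le_def by metis

lemma lex_lt_imp_less: "lex_lt (<) xs ys \<Longrightarrow> xs < (ys :: 'a::linorder list)"
proof (induction xs arbitrary: ys)
  case (Cons a xs)
  then show ?case by (cases ys) (auto simp: lex_lt_Cons irreflp_def)
qed simp

lemma lex_le_imp_le: "lex_le (<) xs ys \<Longrightarrow> xs \<le> (ys :: 'a::linorder list)"
  using lex_lt_imp_less unfolding lex_le_def by (metis order.order_iff_strict)

text \<open>
  A Lyndon word does not have a proper suffix that is also a prefix, so comparing it with its proper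
  suffixes by the strict relation \<open>lex_lt\<close> describes the same words as the strict
  comparison with all other rotations.
\<close>
definition lyndon :: "('a \<Rightarrow> 'a \<Rightarrow> bool) \<Rightarrow> 'a list \<Rightarrow> bool" where
  "lyndon R w \<longleftrightarrow> w \<noteq> [] \<and> (\<forall>x y. w = x @ y \<longrightarrow> x \<noteq> [] \<longrightarrow> y \<noteq> [] \<longrightarrow> lex_lt R w y)"

lemma lyndon_drop: "lyndon R w \<Longrightarrow> 0 < k \<Longrightarrow> k < length w \<Longrightarrow> lex_lt R w (drop k w)"
  unfolding lyndon_def
  by (metis append_take_drop_id drop_eq_Nil2 gr_implies_not0 length_0_conv length_take linorder_not_le min_less_iff_conj nat_less_le take_eq_Nil)

lemma lyndon_le_rotate: assumes "lyndon R w" shows "lex_le R w (rotate k w)"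
proof (cases "k mod length w = 0")
  case False
  have "w \<noteq> []" using assms by (simp add: lyndon_def)
  then have "lex_lt R w (drop (k mod length w) w)" using lyndon_drop[OF assms] False by simp
  from lex_lt_append[OF this, of "[]"] show ?thesis
    unfolding lex_le_def rotate_drop_take by simp
qed (simp add: lex_le_def rotate_drop_take)

text \<open>
  Each letter is replaced by a block that depends on the letter and its predecessor; the additional
  argument is the predecessor of the first letter.
\<close>
fun block_code :: "('b \<Rightarrow> 'b \<Rightarrow> 'a list) \<Rightarrow> 'b \<Rightarrow> 'b list \<Rightarrow> 'a list" where
  "block_code f a [] = []"
| "block_code f a (b # r) = f a b @ block_code f b r"

lemma block_code_append: "block_code f a (x @ y) = block_code f a x @ block_code f (last (a # x)) y"
  by (induction x arbitrary: a) auto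

lemma length_block_code: "(\<And>a b. length (f a b) = n) \<Longrightarrow> length (block_code f a r) = n * length r"
  by (induction r arbitrary: a) auto

lemma set_block_code: "(\<And>a b. set (f a b) \<subseteq> X) \<Longrightarrow> set (block_code f a r) \<subseteq> X"
  by (induction r arbitrary: a) auto

lemma block_code_split:
  assumes "block_code f a r = X @ Y" "Y \<noteq> []"
  shows "\<exists>r1 d r3 j. r = r1 @ d # r3 \<and> j < length (f (last (a # r1)) d) \<and>
     X = block_code f a r1 @ take j (f (last (a # r1)) d) \<and> Y = drop j (f (last (a # r1)) d) @ block_code f d r3"
  using assms(1)
proof (induction r arbitrary: a X)
  case (Cons d r)
  show ?case
  proof (cases "length X < length (f a d)")
    case True
    have "X = take (length X) (f a d)" "Y = drop (length X) (f a d) @ block_code f d r"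
      using Cons.prems True append_eq_append_conv_if[of "f a d" "block_code f d r" X Y]
      by (auto simp: append_eq_conv_conj)
    then show ?thesis using True by (intro exI[of _ "[]"] exI[of _ d] exI[of _ r] exI[of _ "length X"]) auto
  next
    case False
    then obtain X' where X': "X = f a d @ X'" "block_code f d r = X' @ Y"
      using Cons.prems by (auto simp: append_eq_append_conv2)
    from Cons.IH[OF X'(2)] obtain r1 e r3 j where
      "r = r1 @ e # r3 \<and> j < length (f (last (d # r1)) e) \<and>
       X' = block_code f d r1 @ take j (f (last (d # r1)) e) \<and> Y = drop j (f (last (d # r1)) e) @ block_code f e r3" by blast
    then show ?thesis using X' by (intro exI[of _ "d # r1"] exI[of _ e] exI[of _ r3] exI[of _ j]) auto
  qed
qed (use assms(2) in simp)

text \<open>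
  For \<open>Q = R = (<)\<close>, \<open>lo = 0\<close>, \<open>hi = 1\<close> the blocks are \<open>s' = s^-\<close>, \<open>l = L(s)\<close>, \<open>l' = L(s)^+\<close> and \<open>s\<close>.
  For the reversed orders the roles of \<open>s\<close> and \<open>l\<close> are exchanged, as are those of \<open>s'\<close> and \<open>l'\<close>, so one
  lemma handles both the smallest and the largest rotation of \<open>s \<bullet> r\<close>.

  If a suffix begins at the boundary of a block and its first block is not \<open>s'\<close>, the comparison is
  decided there, because \<open>s'\<close> is the smallest of the four blocks; if it is \<open>s'\<close>, the comparison is that of
  \<open>r\<close> with its corresponding suffix. A suffix that begins inside a block starts with a proper
  suffix of a block, and this is at least the prefix of \<open>s\<close> of the same length: for \<open>s'\<close> this uses that \<open>b'\<close> is the immediate predecessor of \<open>b\<close>. It is strictly larger if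
  the letter is \<open>hi\<close>. If the letter is \<open>lo\<close>, the next block begins like \<open>l\<close>, and the rest of \<open>s'\<close> is
  strictly smaller than that.
\<close>
lemma lyndon_block_code:
  fixes R :: "'a \<Rightarrow> 'a \<Rightarrow> bool" and Q :: "'b \<Rightarrow> 'b \<Rightarrow> bool"
  assumes R: "irreflp R" "transp R"
    and s: "s = s0 @ [b]" "s' = s0 @ [b']" and l: "l = l0 @ [c]" "l' = l0 @ [c']"
    and len: "length s0 = length l0"
    and b: "R b' b" "\<And>x. R x b \<Longrightarrow> x = b' \<or> R x b'" and c: "R c c'"
    and lyn: "lyndon R s"
    and H1: "\<And>m. lex_le R s (rotate m l)" and H2: "\<And>m. lex_le R (rotate m s) l"
    and f: "f hi lo = s'" "f lo lo = l" "f lo hi = l'" "f hi hi = s"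
    and r: "set r \<subseteq> {lo, hi}" "lyndon Q r" "hd r = lo" "last r = hi"
    and Q: "\<And>u v. Q u v \<Longrightarrow> u \<in> {lo, hi} \<Longrightarrow> v \<in> {lo, hi} \<Longrightarrow> u = lo \<and> v = hi"
  shows "lyndon R (block_code f hi r)"
proof -
  define n where "n = Suc (length s0)"
  have n: "length s = n" "length s' = n" "length l = n" "length l' = n"
    by (simp_all add: s l len n_def)
  have blk_len: "length (f u v) = n" if "u \<in> {lo, hi}" "v \<in> {lo, hi}" for u v
    using that f n by auto
  have s's: "lex_lt R s' s" using b(1) unfolding s by (intro lex_ltI)
  have ll': "lex_lt R l l'" using c unfolding l by (intro lex_ltI)
  have sl: "lex_le R s l" using H2[of 0] by simp
  have s'l: "lex_lt R s' l" by (rule lex_lt_le_trans[OF R s's sl])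
  have s'l': "lex_lt R s' l'" by (rule lex_lt_trans[OF R s'l ll'])
  have r0: "r \<noteq> []" using r(2) by (simp add: lyndon_def)
  obtain rt where rt: "r = lo # rt" using r0 r(3) by (cases r) auto
  have W: "block_code f hi r = s' @ block_code f lo rt" by (simp add: rt f)
  have mono: "lex_lt R (block_code f a x) (block_code f a y)"
    if xy: "lex_lt Q x y" "set x \<subseteq> {lo, hi}" "set y \<subseteq> {lo, hi}" "a \<in> {lo, hi}" for a x y
  proof -
    obtain p u x1 v y1 where e: "x = p @ u # x1" "y = p @ v # y1" "Q u v"
      using xy(1) unfolding lex_lt_def by blast
    have "u \<in> {lo, hi}" "v \<in> {lo, hi}" using xy(2,3) unfolding e(1,2) by simp_all
    from Q[OF e(3) this] have uv: "u = lo" "v = hi" by simp_all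
    define q where "q = last (a # p)"
    have "set p \<subseteq> {lo, hi}" using xy(2) unfolding e(1) by simp
    then have q: "q \<in> {lo, hi}" using xy(4) last_in_set[of p] unfolding q_def by (cases "p = []") (simp, metis last.simps subsetD)
    have "lex_lt R (f q lo) (f q hi)" using q f ll' s's by auto
    from lex_lt_same_prefix[OF lex_lt_append[OF this]]
    have "lex_lt R (block_code f a p @ f q lo @ block_code f lo x1) (block_code f a p @ f q hi @ block_code f hi y1)" .
    then show ?thesis unfolding e uv block_code_append q_def by simp
  qed
  have F1: "lex_lt R (take (n - j) s0) (drop j s)" if "0 < j" "j < n" for j
  proof -
    have "lex_lt R s (drop j s)" using lyndon_drop[OF lyn] that n by simp
    from lex_lt_take[OF this] have "lex_lt R (take (n - j) s) (drop j s)" using n by simp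
    then show ?thesis using that by (simp add: s n_def)
  qed
  have F2: "lex_le R (take (n - j) s0) (drop j s')" if jn: "0 < j" "j < n" for j
  proof -
    obtain p u x v y where e: "take (n - j) s0 = p @ u # x" "drop j s = p @ v # y" "R u v"
      using F1[OF jn] unfolding lex_lt_def by blast
    have j: "j \<le> length s0" using jn by (simp add: n_def)
    then have ds: "drop j s = drop j s0 @ [b]" "drop j s' = drop j s0 @ [b']" by (simp_all add: s)
    have lx: "length x = length y"
    proof -
      have "length (take (n - j) s0) = length (drop j s)" using jn n by (simp add: n_def)
      then show ?thesis using e by simp
    qed
    show ?thesis
    proof (cases y rule: rev_cases)
      case Nil
      then have "p = drop j s0" "v = b" using e(2) ds by auto
      then show ?thesis using b(2)[of u] e lx Nil ds by (auto simp: lex_le_def intro: lex_ltI)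
    next
      case (snoc y' z)
      then have "drop j s' = p @ v # y' @ [b']" using e(2) ds by auto
      then show ?thesis using e by (auto simp: lex_le_def intro: lex_ltI)
    qed
  qed
  have F3: "lex_le R (take (n - j) s0) (drop j l)" if "0 < j" "j < n" for j
  proof -
    have "rotate j l = drop j l @ take j l" using that n by (simp add: rotate_drop_take)
    then have "lex_le R (take (n - j) s) (take (n - j) (drop j l @ take j l))"
      using lex_le_take[OF H1[of j], of "n - j"] by (simp only:)
    then show ?thesis using that n by (simp add: s n_def)
  qed
  have F6: "lex_lt R (drop (n - j) s') (take j l0)" if "0 < j" "j < n" for j
  proof -
    have "rotate (n - j) s = drop (n - j) s @ take (n - j) s" using that n by (simp add: rotate_drop_take)
    then have "lex_le R (take j (drop (n - j) s @ take (n - j) s)) (take j l)"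
      using lex_le_take[OF H2[of "n - j"], of j] by (simp only:)
    then have "lex_le R (drop (n - j) s) (take j l0)" using that n len by (simp add: l n_def)
    moreover have "lex_lt R (drop (n - j) s') (drop (n - j) s)"
      using that b(1) by (simp add: s n_def lex_ltI)
    ultimately show ?thesis by (rule lex_lt_le_trans[OF R, rotated])
  qed
  have take_s': "take (n - j) s' = take (n - j) s0" if "0 < j" for j using that by (simp add: s n_def)
  have take_l: "take j l = take j l0" "take j l' = take j l0" if "j < n" for j
    using that len by (simp_all add: l n_def)
  show ?thesis unfolding lyndon_def
  proof (intro conjI allI impI)
    show "block_code f hi r \<noteq> []" unfolding W s by simp
    fix X Y assume XY: "block_code f hi r = X @ Y" "X \<noteq> []" "Y \<noteq> []"
    obtain r1 d r3 j where d: "r = r1 @ d # r3" "j < length (f (last (hi # r1)) d)"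
      "X = block_code f hi r1 @ take j (f (last (hi # r1)) d)" "Y = drop j (f (last (hi # r1)) d) @ block_code f d r3"
      using block_code_split[OF XY(1,3)] by blast
    define a where "a = last (hi # r1)"
    have "set r1 \<subseteq> {lo, hi}" and dd: "d \<in> {lo, hi}" using r(1) unfolding d(1) by simp_all
    then have a: "a \<in> {lo, hi}" using last_in_set[of r1] unfolding a_def by (cases "r1 = []") (simp, metis last.simps subsetD)
    have Y: "Y = drop j (f a d) @ block_code f d r3" and jn: "j < n"
      using d blk_len[OF a dd] by (auto simp: a_def)
    show "lex_lt R (block_code f hi r) Y"
    proof (cases "j = 0")
      case True
      then have Y0: "Y = block_code f a (d # r3)" and r1: "r1 \<noteq> []" using Y d XY by auto
      show ?thesis
      proof (cases "a = hi \<and> d = lo")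
        case True
        have "lex_lt Q r (d # r3)" using r(2) d r1 unfolding lyndon_def by blast
        then have "lex_lt R (block_code f hi r) (block_code f hi (d # r3))" using r d by (intro mono) auto
        then show ?thesis using Y0 True by simp
      next
        case False
        then have "f a d = l \<or> f a d = l' \<or> f a d = s" using a dd f by auto
        then have "lex_lt R s' (f a d)" using s'l s'l' s's by auto
        then show ?thesis unfolding W Y0 by (simp add: lex_lt_append)
      qed
    next
      case False
      then have j: "0 < j" by simp
      show ?thesis
      proof (cases "d = hi")
        case True
        have "lex_lt R (take (n - j) s0) (drop j (f a d))"
        proof (cases "a = hi")
          case True
          then show ?thesis using F1[OF j jn] \<open>d = hi\<close> f by simp
        next
          case False
          then have fl: "f a d = l'" using a \<open>d = hi\<close> f by auto
          have "lex_lt R (drop j l) (drop j l')" using jn len c by (simp add: l n_def lex_ltI)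
          then show ?thesis unfolding fl by (rule lex_le_lt_trans[OF R F3[OF j jn]])
        qed
        then have "lex_lt R (take (n - j) s' @ drop (n - j) s' @ block_code f lo rt) Y"
          unfolding Y take_s'[OF j] by (rule lex_lt_append)
        then show ?thesis unfolding W by (simp flip: append_assoc)
      next
        case False
        then have dlo: "d = lo" using dd by simp
        then obtain e r4 where r3: "r3 = e # r4" using d r(4) False by (cases r3) auto
        have e: "e \<in> {lo, hi}" using r(1) unfolding d(1) r3 by simp
        obtain t where t: "block_code f d r3 = take j l0 @ t"
        proof -
          have "f d e = l \<or> f d e = l'" using e f dlo by auto
          then have "take j (f d e) = take j l0" using take_l[OF jn] by auto
          then have "f d e = take j l0 @ drop j (f d e)" by (metis append_take_drop_id)
          then show thesis using that[of "drop j (f d e) @ block_code f e r4"] unfolding r3 block_code.simps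
            by (metis append.assoc)
        qed
        have "f a d = s' \<or> f a d = l" using a dlo f by auto
        then have "lex_le R (take (n - j) s0) (drop j (f a d))" using F2[OF j jn] F3[OF j jn] by auto
        from lex_lt_append[OF lex_lt_append_le[OF this F6[OF j jn]]]
        have "lex_lt R ((take (n - j) s' @ drop (n - j) s') @ block_code f lo rt) ((drop j (f a d) @ take j l0) @ t)"
          unfolding take_s'[OF j] .
        then show ?thesis unfolding W Y t by simp
      qed
    qed
  qed
qed

lemma rotate_inverse: "\<exists>m. S = rotate m (rotate k S)"
proof (cases "S = []")
  case False
  have "rotate (length S - k mod length S) (rotate k S) = rotate (length S - k mod length S) (rotate (k mod length S) S)"
    by (simp add: rotate_conv_mod[of k, symmetric])
  also have "\<dots> = S" using False by (simp add: rotate_rotate less_imp_le)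
  finally show ?thesis by metis
qed simp

lemma max_rot_eqI:
  assumes "L = rotate k S" "lyndon (>) L"
  shows "max_rot S = L"
  unfolding max_rot_def
proof (rule Max_eqI)
  have S: "S \<noteq> []" using assms by (auto simp: lyndon_def)
  have "range (\<lambda>k. rotate k S) \<subseteq> (\<lambda>k. rotate k S) ` {..length S}"
  proof
    fix x assume "x \<in> range (\<lambda>k. rotate k S)"
    then obtain m where m: "x = rotate m S" by blast
    then have "x = rotate (m mod length S) S" by (simp add: rotate_conv_mod[symmetric])
    moreover have "m mod length S \<le> length S" using S by (simp add: less_imp_le)
    ultimately show "x \<in> (\<lambda>k. rotate k S) ` {..length S}"
      by blast
  qed
  then show "finite (range (\<lambda>k. rotate k S))" by (rule finite_subset) simp
  show "L \<in> range (\<lambda>k. rotate k S)" using assms by blast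
  fix y assume "y \<in> range (\<lambda>k. rotate k S)"
  then obtain m where m: "y = rotate m S" by blast
  obtain i where "S = rotate i L" using rotate_inverse[of S k] assms(1) by blast
  then have "y = rotate (m + i) L" by (simp add: m rotate_rotate)
  then have "lex_le (>) L y" using lyndon_le_rotate[OF assms(2)] by simp
  then show "y \<le> L" using lex_le_converse[of "(<)"] lex_le_imp_le by blast
qed

section \<open>The substitution as a block code\<close>

text \<open>
  The last two conditions make \<open>S^-\<close> meaningful and give every sequence that begins with \<open>L\<close> a positive
  first digit.
\<close>
definition lyndon_pair :: "word \<Rightarrow> word \<Rightarrow> bool" where
  "lyndon_pair S L \<longleftrightarrow> lyndon (<) S \<and> lyndon (>) L \<and> (\<exists>k. L = rotate k S) \<and> 0 < last S \<and> 0 < hd L"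

lemma lyndon_pair_max_rot: "lyndon_pair S L \<Longrightarrow> max_rot S = L"
  unfolding lyndon_pair_def using max_rot_eqI by blast

lemma lyndon_pair_bounds:
  assumes "lyndon_pair S L"
  shows "lex_le (<) S (rotate m L)" "lex_le (<) (rotate m S) L"
proof -
  obtain k where k: "L = rotate k S" using assms unfolding lyndon_pair_def by blast
  then show "lex_le (<) S (rotate m L)"
    using lyndon_le_rotate[of "(<)" S] assms by (simp add: rotate_rotate lyndon_pair_def)
  obtain i where "S = rotate i L" using rotate_inverse[of S k] k by auto
  then have "lex_le (>) L (rotate m S)"
    using lyndon_le_rotate[of "(>)" L] assms by (simp add: rotate_rotate lyndon_pair_def)
  then show "lex_le (<) (rotate m S) L" using lex_le_converse[of "(<)"] by blast
qed

text \<open>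
  The four blocks of \<open>\<Phi>_S\<close>: a digit equal to its predecessor \<open>a\<close> continues a run and yields \<open>L(S)\<close> or \<open>S\<close>;
  a digit different from its predecessor opens a run.
\<close>
definition subst_block :: "word \<Rightarrow> nat \<Rightarrow> nat \<Rightarrow> word" where
  "subst_block S a b = (if b = 0 then if a = 0 then max_rot S else word_minus S
     else if a = 0 then word_plus (max_rot S) else S)"

lemma subst_block_simps [simp]:
  "subst_block S 0 0 = max_rot S" "subst_block S (Suc 0) 0 = word_minus S"
  "subst_block S 0 (Suc 0) = word_plus (max_rot S)" "subst_block S (Suc 0) (Suc 0) = S"
  by (simp_all add: subst_block_def)

lemma block_code_subst_block_zeros:
  "block_code (subst_block S) 0 r = word_pow (max_rot S) (length (takeWhile (\<lambda>e. e = 0) r)) @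
     block_code (subst_block S) 0 (dropWhile (\<lambda>e. e = 0) r)"
  by (induction r) (auto simp: subst_block_def word_pow_def)

lemma block_code_subst_block_ones:
  "set r \<subseteq> {0, 1} \<Longrightarrow> block_code (subst_block S) 1 r = word_pow S (length (takeWhile (\<lambda>e. e \<noteq> 0) r)) @
     block_code (subst_block S) 1 (dropWhile (\<lambda>e. e \<noteq> 0) r)"
  by (induction r) (auto simp: subst_block_def word_pow_def)

text \<open>
  The first digit opens a run, so its fictitious predecessor is the opposite digit.
\<close>
lemma subst_word_block_code:
  assumes "set r \<subseteq> {0, 1}" "r \<noteq> [] \<Longrightarrow> a = 1 - hd r"
  shows "subst_word S r = block_code (subst_block S) a r"
  using assms
proof (induction S r arbitrary: a rule: subst_word.induct)
  case (2 S d r)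
  show ?case
  proof (cases "d = 0")
    case True
    let ?r = "dropWhile (\<lambda>e. e = 0) r"
    have "set ?r \<subseteq> set r" by (meson set_dropWhileD subsetI)
    then have sub: "set ?r \<subseteq> {0, 1}" using "2.prems"(1) by auto
    have "0 = 1 - hd ?r" if ne: "?r \<noteq> []"
    proof -
      have "hd ?r \<in> {0, 1}" using hd_in_set[OF ne] sub by blast
      then show ?thesis using hd_dropWhile[OF ne] by auto
    qed
    then have IH: "subst_word S ?r = block_code (subst_block S) 0 ?r" by (rule "2.IH"(1)[OF True sub])
    show ?thesis using "2.prems"(2) True IH block_code_subst_block_zeros[of S r] by simp
  next
    case False
    let ?r = "dropWhile (\<lambda>e. e \<noteq> 0) r"
    have d: "d = 1" using "2.prems"(1) False by simp
    have "set ?r \<subseteq> set r" by (meson set_dropWhileD subsetI)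
    then have sub: "set ?r \<subseteq> {0, 1}" and r: "set r \<subseteq> {0, 1}" using "2.prems"(1) by auto
    have "1 = 1 - hd ?r" if "?r \<noteq> []"
      using hd_dropWhile[OF that] by simp
    then have IH: "subst_word S ?r = block_code (subst_block S) 1 ?r" by (rule "2.IH"(2)[OF False sub])
    show ?thesis using "2.prems"(2) d IH block_code_subst_block_ones[OF r, of S] by simp
  qed
qed simp

lemma word_plus_append: "Y \<noteq> [] \<Longrightarrow> word_plus (X @ Y) = X @ word_plus Y"
  by (simp add: word_plus_def butlast_append)

lemma word_plus_minus: "S \<noteq> [] \<Longrightarrow> 0 < last S \<Longrightarrow> word_plus (word_minus S) = S"
  by (simp add: word_plus_def word_minus_def)

lemma length_max_rot: "lyndon_pair S L \<Longrightarrow> length L = length S"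
  by (auto simp: lyndon_pair_def)

lemma length_subst_block: "lyndon_pair S L \<Longrightarrow> length (subst_block S a b) = length S"
  using lyndon_pair_max_rot[of S L] length_max_rot[of S L]
  by (auto simp: subst_block_def word_plus_def word_minus_def lyndon_pair_def lyndon_def Suc_le_eq)

text \<open>
  The properties of a Farey word \<open>r\<close> and its largest rotation \<open>R\<close> that make \<open>\<Phi>_S(R)\<close> a rotation of
  \<open>\<Phi>_S(r)\<close>: since the last digit of each word is opposite to its first one, the code continues
  consistently when the word is repeated.
\<close>
definition binary_pair :: "word \<Rightarrow> word \<Rightarrow> bool" where
  "binary_pair r R \<longleftrightarrow> set r \<subseteq> {0, 1} \<and> lyndon (<) r \<and> lyndon (>) R \<and> hd r = 0 \<and> last r = 1 \<and>
     hd R = 1 \<and> last R = 0 \<and> (\<exists>x y. r = x @ y \<and> R = y @ x \<and> x \<noteq> [] \<and> y \<noteq> [])"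

lemma binary_pair_lyndon_pair:
  assumes "binary_pair r R" shows "lyndon_pair r R"
proof -
  obtain x y where "r = x @ y" "R = y @ x" using assms unfolding binary_pair_def by blast
  then have "R = rotate (length x) r" by (simp add: rotate_append)
  then show ?thesis using assms unfolding binary_pair_def lyndon_pair_def by auto
qed

lemma block_code_word_plus:
  assumes f: "\<And>a. f a 1 = word_plus (f a 0)" "\<And>a. f a 0 \<noteq> []" and R: "R \<noteq> []" "last R = 0"
  shows "block_code f a (word_plus R) = word_plus (block_code f a R)"
proof -
  obtain R0 where "R = R0 @ [0]" using R by (metis append_butlast_last_id)
  then show ?thesis using f by (simp add: word_plus_append block_code_append) (simp add: word_plus_def block_code_append)
qed

lemma subst_block_plus:
  assumes "lyndon_pair S L" shows "subst_block S a 1 = word_plus (subst_block S a 0)" "subst_block S a 0 \<noteq> []"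
proof -
  have "S \<noteq> []" "0 < last S" using assms by (auto simp: lyndon_pair_def lyndon_def)
  then show "subst_block S a 1 = word_plus (subst_block S a 0)" by (simp add: subst_block_def word_plus_minus)
  show "subst_block S a 0 \<noteq> []" using length_subst_block[OF assms, of a 0] \<open>S \<noteq> []\<close> by auto
qed

text \<open>
  This is \<open>L(S \<bullet> r) = \<Phi>_S(L(r))\<close> together with its companion \<open>L(S \<bullet> r)^+ = \<Phi>_S(L(r)^+)\<close>: turning the
  final 0 of \<open>L(r)\<close> into 1 raises the final block from \<open>L(S)\<close> to \<open>L(S)^+\<close> or from \<open>S^-\<close> to \<open>S\<close>.
\<close>
lemma lyndon_pair_subst:
  assumes S: "lyndon_pair S L" and r: "binary_pair r R"
  shows "subst_word S r = block_code (subst_block S) 1 r"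
    and "lyndon_pair (subst_word S r) (block_code (subst_block S) 0 R)"
    and "max_rot (subst_word S r) = block_code (subst_block S) 0 R"
    and "word_plus (max_rot (subst_word S r)) = block_code (subst_block S) 0 (word_plus R)"
proof -
  let ?f = "subst_block S"
  have mr: "max_rot S = L" by (rule lyndon_pair_max_rot[OF S])
  have ne: "S \<noteq> []" "L \<noteq> []" "0 < last S" "0 < hd L" "lyndon (<) S" "lyndon (>) L"
    using S by (auto simp: lyndon_pair_def lyndon_def)
  have len: "length (butlast S) = length (butlast L)" using length_max_rot[OF S] by simp
  have rr: "set r \<subseteq> {0, 1}" "lyndon (<) r" "lyndon (>) R" "hd r = 0" "last r = 1" "hd R = 1" "last R = 0"
    and rne: "r \<noteq> []" "R \<noteq> []"
    using r by (auto simp: binary_pair_def lyndon_def)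
  obtain x y where xy: "r = x @ y" "R = y @ x" "x \<noteq> []" "y \<noteq> []" using r by (auto simp: binary_pair_def)
  have lasts: "last x = 0" "last y = 1" using rr xy by auto
  show sub: "subst_word S r = block_code ?f 1 r" by (rule subst_word_block_code) (use rr in auto)
  have f: "?f 1 0 = word_minus S" "?f 0 0 = L" "?f 0 1 = word_plus L" "?f 1 1 = S"
    by (auto simp: subst_block_def mr)
  have lyn1: "lyndon (<) (block_code ?f 1 r)"
  proof (rule lyndon_block_code[where s = S and s' = "word_minus S" and l = L and l' = "word_plus L"
        and lo = 0 and hi = 1 and Q = "(<)" and r = r])
    show "S = butlast S @ [last S]" "L = butlast L @ [last L]" using ne by auto
    show "word_minus S = butlast S @ [last S - 1]" "word_plus L = butlast L @ [last L + 1]"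
      by (simp_all add: word_minus_def word_plus_def)
  qed (use ne len f rr lyndon_pair_bounds[OF S] in \<open>auto simp: irreflp_def transp_def\<close>)
  have lyn2: "lyndon (>) (block_code ?f 0 R)"
  proof (rule lyndon_block_code[where s = L and s' = "word_plus L" and l = S and l' = "word_minus S"
        and lo = 1 and hi = 0 and Q = "(>)" and r = R])
    show "S = butlast S @ [last S]" "L = butlast L @ [last L]" using ne by auto
    show "word_minus S = butlast S @ [last S - 1]" "word_plus L = butlast L @ [last L + 1]"
      by (simp_all add: word_minus_def word_plus_def)
    show "lex_le (>) L (rotate m S)" "lex_le (>) (rotate m L) S" for m
      using lyndon_pair_bounds[OF S] lex_le_converse[of "(<)"] by blast+
    show "set R \<subseteq> {1, 0}" using rr xy by auto
  qed (use ne len f rr in \<open>auto simp: irreflp_def transp_def\<close>)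
  have "block_code ?f 0 R = rotate (length (block_code ?f 1 x)) (block_code ?f 1 r)"
    using xy lasts by (simp add: block_code_append rotate_append)
  moreover have "0 < last (block_code ?f 1 r)"
  proof -
    have "last (block_code ?f 1 r) = last (?f (last (1 # butlast r)) 1)"
    proof -
      have "r = butlast r @ [1]" using rne rr by (metis append_butlast_last_id)
      then have "block_code ?f 1 r = block_code ?f 1 (butlast r) @ ?f (last (1 # butlast r)) 1"
        by (metis append_Nil2 block_code.simps block_code_append)
      moreover have "?f (last (1 # butlast r)) 1 \<noteq> []"
        using length_subst_block[OF S] ne by (metis length_0_conv)
      ultimately show ?thesis by simp
    qed
    then show ?thesis using ne by (auto simp: subst_block_def word_plus_def)
  qed
  moreover have "0 < hd (block_code ?f 0 R)"
  proof -
    obtain R' where "R = 1 # R'" using rne rr by (cases R) auto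
    then have "block_code ?f 0 R = word_plus L @ block_code ?f 1 R'" by (simp add: f del: One_nat_def)
    moreover have "0 < hd (word_plus L)" "word_plus L \<noteq> []"
      using ne by (cases "butlast L"; cases L; auto simp: word_plus_def split: if_splits)+
    ultimately show ?thesis by simp
  qed
  ultimately show lp: "lyndon_pair (subst_word S r) (block_code ?f 0 R)"
    unfolding lyndon_pair_def sub using lyn1 lyn2 by blast
  show mx: "max_rot (subst_word S r) = block_code ?f 0 R" by (rule lyndon_pair_max_rot[OF lp])
  show "word_plus (max_rot (subst_word S r)) = block_code ?f 0 (word_plus R)"
    unfolding mx using block_code_word_plus[of ?f R] subst_block_plus[OF S] rne rr by metis
qed

lemma lex_lt_map:
  assumes "\<And>a b. R a b \<Longrightarrow> R (f a) (f b)" "lex_lt R xs ys" shows "lex_lt R (map f xs) (map f ys)"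
proof -
  obtain p a s b t where "xs = p @ a # s" "ys = p @ b # t" "R a b" using assms(2) unfolding lex_lt_def by blast
  then show ?thesis by (simp add: lex_ltI assms(1))
qed

lemma lyndon_map:
  assumes "\<And>a b. R a b \<Longrightarrow> R (f a) (f b)" "lyndon R w" shows "lyndon R (map f w)"
  unfolding lyndon_def
proof (intro conjI allI impI)
  show "map f w \<noteq> []" using assms(2) by (simp add: lyndon_def)
  fix x y assume "map f w = x @ y" "x \<noteq> []" "y \<noteq> []"
  then obtain x' y' where "w = x' @ y'" "y = map f y'" "x' \<noteq> []" "y' \<noteq> []"
    by (auto simp: map_eq_append_conv)
  then show "lex_lt R (map f w) y"
    using assms(2) lex_lt_map[of R f w y'] assms(1) unfolding lyndon_def by blast
qed

lemma lyndon_pair_map_add: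
  assumes "lyndon_pair S L" shows "lyndon_pair (map (\<lambda>d. d + k) S) (map (\<lambda>d. d + k) L)"
proof -
  have ne: "S \<noteq> []" "L \<noteq> []" using assms by (auto simp: lyndon_pair_def lyndon_def)
  have "lyndon (<) (map (\<lambda>d. d + k) S)" "lyndon (>) (map (\<lambda>d. d + k) L)"
    using assms by (auto simp: lyndon_pair_def intro!: lyndon_map)
  moreover obtain m where "L = rotate m S" using assms by (auto simp: lyndon_pair_def)
  then have "map (\<lambda>d. d + k) L = rotate m (map (\<lambda>d. d + k) S)" by (simp add: rotate_map)
  moreover have "0 < last (map (\<lambda>d. d + k) S)" "0 < hd (map (\<lambda>d. d + k) L)"
    using assms ne by (auto simp: lyndon_pair_def last_map hd_map)
  ultimately show ?thesis unfolding lyndon_pair_def by blast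
qed

lemma theta_pow: "(theta ^^ k) w = map (\<lambda>d. d + k) w"
  by (induction k) (auto simp: theta_def)

section \<open>Neighbouring Farey words\<close>

text \<open>
  Neighbours \<open>u, v\<close> in the Farey lists, together with \<open>U = L(u)\<close> and \<open>V = L(v)\<close>. The largest rotation of
  \<open>uv\<close> is \<open>VU\<close>, so the four words can be generated simultaneously.
\<close>
inductive farey_pair :: "word \<Rightarrow> word \<Rightarrow> word \<Rightarrow> word \<Rightarrow> bool" where
  root: "farey_pair [0] [1] [0] [1]"
| left: "farey_pair u v U V \<Longrightarrow> farey_pair u (u @ v) U (V @ U)"
| right: "farey_pair u v U V \<Longrightarrow> farey_pair (u @ v) v (V @ U) V"

text \<open>
  A proper suffix of \<open>uv\<close> is a suffix of \<open>v\<close>, or \<open>t v\<close> with a proper suffix \<open>t\<close> of \<open>u\<close>. The latter is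
  decided within \<open>u\<close>, the former by the hypothesis that \<open>uv\<close> precedes \<open>v\<close>.
\<close>
lemma lyndon_append:
  assumes R: "irreflp R" "transp R" and u: "lyndon R u" and v: "lyndon R v" and uv: "lex_lt R (u @ v) v"
  shows "lyndon R (u @ v)"
  unfolding lyndon_def
proof (intro conjI allI impI)
  show "u @ v \<noteq> []" using u by (simp add: lyndon_def)
  fix x y assume xy: "u @ v = x @ y" "x \<noteq> []" "y \<noteq> []"
  then obtain t where "u = x @ t \<and> t @ v = y \<or> u @ t = x \<and> v = t @ y"
    by (auto simp: append_eq_append_conv2)
  then show "lex_lt R (u @ v) y"
  proof
    assume t: "u = x @ t \<and> t @ v = y"
    show ?thesis
    proof (cases "t = []")
      case True then show ?thesis using t uv by simp
    next
      case False
      then have "lex_lt R u t" using u t xy(2) unfolding lyndon_def by blast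
      then have "lex_lt R (u @ v) (t @ v)" by (rule lex_lt_append)
      then show ?thesis using t by simp
    qed
  next
    assume t: "u @ t = x \<and> v = t @ y"
    show ?thesis
    proof (cases "t = []")
      case True then show ?thesis using t uv by simp
    next
      case False
      then have "lex_lt R v y" using v t xy(3) unfolding lyndon_def by blast
      then show ?thesis using lex_lt_trans[OF R uv] by blast
    qed
  qed
qed

lemma lyndon_singleton: "lyndon R [a]"
  unfolding lyndon_def by (auto simp: Cons_eq_append_conv)

text \<open>
  The relation \<open>uv < v\<close> passes to both children: \<open>u(uv) < uv\<close> by removing the common prefix \<open>u\<close>, and
  \<open>(uv)v < v\<close> because the difference already occurs inside \<open>uv\<close>. For the largest rotations the same
  holds with the reversed order.
\<close>
lemma farey_pair_lyndon:
  assumes "farey_pair u v U V"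
  shows "lyndon (<) u \<and> lyndon (<) v \<and> lex_lt (<) (u @ v) v" (is ?A)
    and "lyndon (>) U \<and> lyndon (>) V \<and> lex_lt (>) (V @ U) U" (is ?B)
proof -
  have lt: "irreflp ((<) :: nat \<Rightarrow> nat \<Rightarrow> bool)" "transp ((<) :: nat \<Rightarrow> nat \<Rightarrow> bool)"
    and gt: "irreflp ((>) :: nat \<Rightarrow> nat \<Rightarrow> bool)" "transp ((>) :: nat \<Rightarrow> nat \<Rightarrow> bool)"
    by (auto simp: irreflp_def transp_def)
  show ?A using assms
  proof (induction rule: farey_pair.induct)
    case root
    show ?case using lex_ltI[of "(<)" "0::nat" 1 "[]" "[1]" "[]"] by (simp add: lyndon_singleton)
  next
    case (left u v U V)
    then show ?case using lyndon_append[OF lt] lex_lt_same_prefix[of _ "u @ v" v u] by blast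
  next
    case (right u v U V)
    then have "lex_lt (<) ((u @ v) @ v) (v @ [])" by (intro lex_lt_append) auto
    then show ?case using right lyndon_append[OF lt] by simp
  qed
  show ?B using assms
  proof (induction rule: farey_pair.induct)
    case root
    show ?case using lex_ltI[of "(>)" "1::nat" 0 "[]" "[0]" "[]"] by (simp add: lyndon_singleton)
  next
    case (left u v U V)
    then have "lex_lt (>) ((V @ U) @ U) (U @ [])" by (intro lex_lt_append) auto
    then show ?case using left lyndon_append[OF gt] by simp
  next
    case (right u v U V)
    then show ?case using lyndon_append[OF gt] lex_lt_same_prefix[of _ "V @ U" U V] by blast
  qed
qed

lemma farey_pair_binary_digits:
  "farey_pair u v U V \<Longrightarrow> set u \<subseteq> {0,1} \<and> set v \<subseteq> {0,1} \<and> set U \<subseteq> {0,1} \<and> set V \<subseteq> {0,1}"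
  by (induction rule: farey_pair.induct) auto

text \<open>
  In the interior of the tree the words are \<open>0p1\<close> and \<open>0q1\<close> with \<open>p10q = q01p\<close>, an identity that
  reproduces itself in both children by associativity. The other two alternatives are the edges of the
  tree, where one of the words is a single digit.
\<close>
lemma farey_pair_form:
  assumes "farey_pair u v U V"
  shows "(\<exists>p q. u = 0 # p @ [1] \<and> v = 0 # q @ [1] \<and> U = 1 # p @ [0] \<and> V = 1 # q @ [0] \<and>
            p @ [1, 0] @ q = q @ [0, 1] @ p) \<or>
    (\<exists>n. u = [0] \<and> v = replicate n 0 @ [1] \<and> U = [0] \<and> V = 1 # replicate n 0) \<or>
    (\<exists>n. u = 0 # replicate n 1 \<and> v = [1] \<and> U = replicate n 1 @ [0] \<and> V = [1])"
    (is "?I u v U V \<or> ?Z u v U V \<or> ?O u v U V")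
  using assms
proof (induction rule: farey_pair.induct)
  case root
  then show ?case by simp
next
  case (left u v U V)
  from left.IH show ?case
  proof (elim disjE exE conjE)
    fix p q assume "u = 0 # p @ [1]" "v = 0 # q @ [1]" "U = 1 # p @ [0]" "V = 1 # q @ [0]"
      "p @ [1, 0] @ q = q @ [0, 1] @ p"
    then have "?I u (u @ v) U (V @ U)"
      by (intro exI[of _ p] exI[of _ "p @ [1, 0] @ q"]) simp
    then show ?thesis by blast
  next
    fix n assume "u = [0]" "v = replicate n 0 @ [1]" "U = [0]" "V = 1 # replicate n 0"
    then have "?Z u (u @ v) U (V @ U)"
      by (intro exI[of _ "Suc n"]) (simp add: replicate_append_same)
    then show ?thesis by blast
  next
    fix n assume h: "u = 0 # replicate n 1" "v = [1]" "U = replicate n 1 @ [0]" "V = [1]"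
    show ?thesis
    proof (cases n)
      case 0
      then have "?Z u (u @ v) U (V @ U)" using h by (intro exI[of _ 1]) simp
      then show ?thesis by blast
    next
      case (Suc m)
      then have "?I u (u @ v) U (V @ U)" using h
        by (intro exI[of _ "replicate m 1"] exI[of _ "replicate (Suc m) 1"])
           (simp add: replicate_append_same replicate_app_Cons_same)
      then show ?thesis by blast
    qed
  qed
next
  case (right u v U V)
  from right.IH show ?case
  proof (elim disjE exE conjE)
    fix p q assume "u = 0 # p @ [1]" "v = 0 # q @ [1]" "U = 1 # p @ [0]" "V = 1 # q @ [0]"
      "p @ [1, 0] @ q = q @ [0, 1] @ p"
    then have "?I (u @ v) v (V @ U) V"
      by (intro exI[of _ "p @ [1, 0] @ q"] exI[of _ q]) simp
    then show ?thesis by blast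
  next
    fix n assume h: "u = [0]" "v = replicate n 0 @ [1]" "U = [0]" "V = 1 # replicate n 0"
    show ?thesis
    proof (cases n)
      case 0
      then have "?O (u @ v) v (V @ U) V" using h by (intro exI[of _ 1]) simp
      then show ?thesis by blast
    next
      case (Suc m)
      then have "?I (u @ v) v (V @ U) V" using h
        by (intro exI[of _ "replicate (Suc m) 0"] exI[of _ "replicate m 0"])
           (simp add: replicate_append_same replicate_app_Cons_same)
      then show ?thesis by blast
    qed
  next
    fix n assume "u = 0 # replicate n 1" "v = [1]" "U = replicate n 1 @ [0]" "V = [1]"
    then have "?O (u @ v) v (V @ U) V"
      by (intro exI[of _ "Suc n"]) (simp add: replicate_append_same)
    then show ?thesis by blast
  qed
qed

lemma farey_pair_conjugate:
  assumes "farey_pair u v U V"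
  shows "\<exists>x y. u @ v = x @ y \<and> V @ U = y @ x \<and> x \<noteq> [] \<and> y \<noteq> []"
  using farey_pair_form[OF assms]
proof (elim disjE exE conjE)
  fix p q assume h: "u = 0 # p @ [1]" "v = 0 # q @ [1]" "U = 1 # p @ [0]" "V = 1 # q @ [0]"
    and e: "p @ [1, 0] @ q = q @ [0, 1] @ p"
  have "u @ v = 0 # (p @ [1, 0] @ q) @ [1]" by (simp add: h)
  also have "\<dots> = (0 # q @ [0]) @ (1 # p @ [1])" unfolding e by simp
  finally have 1: "u @ v = (0 # q @ [0]) @ (1 # p @ [1])" .
  have "V @ U = 1 # (q @ [0, 1] @ p) @ [0]" by (simp add: h)
  also have "\<dots> = (1 # p @ [1]) @ (0 # q @ [0])" unfolding e[symmetric] by simp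
  finally have "V @ U = (1 # p @ [1]) @ (0 # q @ [0])" .
  with 1 show ?thesis by blast
next
  fix n assume "u = [0]" "v = replicate n 0 @ [1]" "U = [0]" "V = 1 # replicate n 0"
  then show ?thesis
    by (intro exI[of _ "replicate (Suc n) 0"] exI[of _ "[1]"]) (simp add: replicate_append_same)
next
  fix n assume "u = 0 # replicate n 1" "v = [1]" "U = replicate n 1 @ [0]" "V = [1]"
  then show ?thesis
    by (intro exI[of _ "[0]"] exI[of _ "replicate (Suc n) 1"]) (simp add: replicate_append_same)
qed

lemma farey_pair_nonempty: "farey_pair u v U V \<Longrightarrow> u \<noteq> [] \<and> v \<noteq> [] \<and> U \<noteq> [] \<and> V \<noteq> []"
  by (induction rule: farey_pair.induct) auto

lemma farey_pair_ends:
  "farey_pair u v U V \<Longrightarrow> hd u = 0 \<and> last v = 1 \<and> hd V = 1 \<and> last U = 0"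
proof (induction rule: farey_pair.induct)
  case (left u v U V)
  then show ?case using farey_pair_nonempty[OF left.hyps] by simp
next
  case (right u v U V)
  then show ?case using farey_pair_nonempty[OF right.hyps] by simp
qed simp

lemma farey_pair_binary_pair:
  assumes "farey_pair u v U V" shows "binary_pair (u @ v) (V @ U)"
proof -
  note ne = farey_pair_nonempty[OF assms]
  have lt: "irreflp ((<) :: nat \<Rightarrow> nat \<Rightarrow> bool)" "transp ((<) :: nat \<Rightarrow> nat \<Rightarrow> bool)"
    and gt: "irreflp ((>) :: nat \<Rightarrow> nat \<Rightarrow> bool)" "transp ((>) :: nat \<Rightarrow> nat \<Rightarrow> bool)"
    by (auto simp: irreflp_def transp_def)
  have "lyndon (<) (u @ v)" "lyndon (>) (V @ U)"
    using farey_pair_lyndon[OF assms] lyndon_append[OF lt] lyndon_append[OF gt] by blast+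
  moreover have "hd (u @ v) = 0" "last (u @ v) = 1" "hd (V @ U) = 1" "last (V @ U) = 0"
    using farey_pair_ends[OF assms] ne by simp_all
  ultimately show ?thesis
    using farey_pair_conjugate[OF assms] farey_pair_binary_digits[OF assms] unfolding binary_pair_def by auto
qed

lemma word_pow_Suc: "word_pow x (Suc n) = x @ word_pow x n"
  by (simp add: word_pow_def)

lemma word_pow_0 [simp]: "word_pow x 0 = []"
  by (simp add: word_pow_def)

text \<open>
  By induction \<open>x^j q = q y^j\<close>, and \<open>x^j\<close> is at least as long as \<open>q\<close>.
\<close>
lemma prefix_of_power:
  assumes e: "x @ q = q @ y" and x: "x \<noteq> []" and j: "length q \<le> j"
  shows "\<exists>t. word_pow x j = q @ t"
proof -
  have "\<exists>y'. word_pow x j @ q = q @ y'" for j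
  proof (induction j)
    case (Suc j)
    then obtain y' where "word_pow x j @ q = q @ y'" ..
    then have "word_pow x (Suc j) @ q = q @ y @ y'" using e
      by (simp add: word_pow_Suc)
    then show ?case by blast
  qed simp
  then obtain y' where y': "word_pow x j @ q = q @ y'" by blast
  have "j \<le> length (word_pow x j)" using x
    by (induction j) (auto simp: word_pow_Suc Suc_le_eq neq_Nil_conv)
  then have "length q \<le> length (word_pow x j)" using j by simp
  then have "take (length q) (word_pow x j) = q" using arg_cong[OF y', of "take (length q)"] by simp
  then show ?thesis by (metis append_take_drop_id)
qed

lemma word_pow_replicate: "word_pow [a] n = replicate n a"
  by (induction n) (auto simp: word_pow_Suc)

text \<open>
  In the interior the two words are \<open>1 (p10)^j p1\<close> and \<open>1 (q01)^(j-1) q0\<close>. The identity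
  \<open>p10q = q01p\<close> shows that \<open>q\<close> is a prefix of a power of \<open>p10\<close> and \<open>p\<close> a prefix of a power of \<open>q01\<close>, so
  both words begin with \<open>1p10q = 1q01p\<close>. On the edges of the tree the claim is read off. The formula is
  uniform because the digits 0 and 1 are their own largest rotations.
\<close>
lemma farey_pair_common_prefix:
  assumes "farey_pair u v U V"
  shows "\<exists>z j t1 t2. word_plus U @ word_pow u j = z @ t1 \<and> word_pow V j = z @ t2 \<and>
     length u + length v \<le> Suc (length z) \<and> z \<noteq> [] \<and> hd z = 1"
  using farey_pair_form[OF assms]
proof (elim disjE exE conjE)
  fix p q assume h: "u = 0 # p @ [1]" "v = 0 # q @ [1]" "U = 1 # p @ [0]" "V = 1 # q @ [0]"
    and e: "p @ [1, 0] @ q = q @ [0, 1] @ p"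
  define z where "z = 1 # p @ [1, 0] @ q"
  define m where "m = length p + length q"
  have shiftU: "(p @ [1]) @ word_pow u j = word_pow (p @ [1, 0]) j @ p @ [1]" for j
    unfolding h by (induction j) (auto simp: word_pow_Suc)
  have shiftV: "word_pow V (Suc j) = 1 # word_pow (q @ [0, 1]) j @ q @ [0]" for j
    unfolding h by (induction j) (auto simp: word_pow_Suc)
  obtain t where t: "word_pow (p @ [1, 0]) (Suc m) = q @ t"
    using prefix_of_power[of "p @ [1, 0]" q "[0, 1] @ p" "Suc m"] e by (auto simp: m_def)
  obtain t' where t': "word_pow (q @ [0, 1]) m = p @ t'"
    using prefix_of_power[of "q @ [0, 1]" p "[1, 0] @ q" m] e by (auto simp: m_def)
  have "word_plus U @ word_pow u (Suc (Suc m)) = 1 # word_pow (p @ [1, 0]) (Suc (Suc m)) @ p @ [1]"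
    using shiftU[of "Suc (Suc m)"] by (simp add: h word_plus_def butlast_append)
  also have "\<dots> = 1 # (p @ [1, 0]) @ (q @ t) @ p @ [1]"
    unfolding word_pow_Suc[of _ "Suc m"] t by simp
  finally have 1: "word_plus U @ word_pow u (Suc (Suc m)) = z @ t @ p @ [1]" by (simp add: z_def)
  have "word_pow V (Suc (Suc m)) = 1 # (q @ [0, 1]) @ (p @ t') @ q @ [0]"
    unfolding shiftV word_pow_Suc[of _ m] t' by simp
  also have "\<dots> = 1 # (q @ [0, 1] @ p) @ t' @ q @ [0]" by simp
  also have "\<dots> = z @ t' @ q @ [0]" unfolding e[symmetric] z_def by simp
  finally have 2: "word_pow V (Suc (Suc m)) = z @ t' @ q @ [0]" .
  have "length u + length v \<le> Suc (length z) \<and> z \<noteq> [] \<and> hd z = 1" by (simp add: z_def h)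
  then show ?thesis using 1 2 by blast
next
  fix n assume h: "u = [0]" "v = replicate n 0 @ [1]" "U = [0]" "V = 1 # replicate n 0"
  have "word_plus U @ word_pow u (Suc n) = V @ [0]" "word_pow V (Suc n) = V @ word_pow V n"
    by (simp_all add: h word_plus_def word_pow_replicate word_pow_Suc[of _ n] replicate_append_same)
  moreover have "length u + length v \<le> Suc (length V)" "V \<noteq> []" "hd V = 1" by (simp_all add: h)
  ultimately show ?thesis by blast
next
  fix n assume h: "u = 0 # replicate n 1" "v = [1]" "U = replicate n 1 @ [0]" "V = [1]"
  have "word_plus U @ word_pow u (Suc n) = word_pow V (Suc n) @ word_pow u (Suc n)"
    by (simp add: h word_plus_def word_pow_replicate replicate_append_same)
  moreover have "word_pow V (Suc n) = word_pow V (Suc n) @ []" by simp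
  moreover have "length u + length v \<le> Suc (length (word_pow V (Suc n)))" "word_pow V (Suc n) \<noteq> []"
    "hd (word_pow V (Suc n)) = 1" by (simp_all add: h word_pow_replicate)
  ultimately show ?thesis by blast
qed

abbreviation farey_neighbours :: "word \<Rightarrow> word \<Rightarrow> bool" where
  "farey_neighbours u v \<equiv> \<exists>U V. farey_pair u v U V"

lemma insert_concats_Cons: "\<exists>ws'. insert_concats (v # ws) = v # ws'"
  by (cases ws) auto

lemma successively_insert_concats:
  "successively farey_neighbours l \<Longrightarrow> successively farey_neighbours (insert_concats l)"
proof (induction l rule: insert_concats.induct)
  case (1 u v ws)
  obtain ws' where ws': "insert_concats (v # ws) = v # ws'" using insert_concats_Cons by blast
  have "farey_neighbours u v" "successively farey_neighbours (v # ws)" using "1.prems" by auto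
  then show ?case using 1 ws' by (auto intro: farey_pair.intros)
qed auto

lemma successively_farey_list: "successively farey_neighbours (farey_list n)"
  by (induction n) (auto intro: successively_insert_concats farey_pair.root simp del: One_nat_def)

lemma set_insert_concats:
  "successively farey_neighbours l \<Longrightarrow> set (insert_concats l) \<subseteq> set l \<union> {u @ v | u v. farey_neighbours u v}"
proof (induction l rule: insert_concats.induct)
  case (1 u v ws)
  have "farey_neighbours u v" "successively farey_neighbours (v # ws)" using "1.prems" by auto
  then show ?case using 1 by auto
qed auto

lemma set_insert_concats_mono: "set l \<subseteq> set (insert_concats l)"
  by (induction l rule: insert_concats.induct) auto

lemma set_farey_list: "set (farey_list n) \<subseteq> {[0], [1]} \<union> {u @ v | u v. farey_neighbours u v}"
proof (induction n)
  case (Suc n)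
  then show ?case using set_insert_concats[OF successively_farey_list[of n]] by auto
qed simp

lemma insert_concats_adjacent:
  "\<exists>xs' ys'. insert_concats (xs @ u # v # ys) = xs' @ u # (u @ v) # v # ys'"
proof (induction xs rule: insert_concats.induct)
  case (1 a b ws)
  then obtain xs' ys' where "insert_concats ((b # ws) @ u # v # ys) = xs' @ u # (u @ v) # v # ys'" by blast
  then have "insert_concats ((a # b # ws) @ u # v # ys) = (a # (a @ b) # xs') @ u # (u @ v) # v # ys'" by simp
  then show ?case by blast
next
  case "2_1"
  then show ?case using insert_concats_Cons[of v ys] by (auto intro: exI[of _ "[]"])
next
  case ("2_2" a)
  obtain ys' where "insert_concats (v # ys) = v # ys'" using insert_concats_Cons by blast
  then have "insert_concats ([a] @ u # v # ys) = [a, a @ u] @ u # (u @ v) # v # ys'" by simp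
  then show ?case by blast
qed

lemma farey_pair_adjacent: "farey_pair u v U V \<Longrightarrow> \<exists>n xs ys. farey_list n = xs @ u # v # ys"
proof (induction rule: farey_pair.induct)
  case root
  have "farey_list 0 = [] @ [0] # [1] # []" by simp
  then show ?case by blast
next
  case (left u v U V)
  then obtain n xs ys where "farey_list n = xs @ u # v # ys" by blast
  then have "\<exists>xs' ys'. farey_list (Suc n) = xs' @ u # (u @ v) # v # ys'"
    using insert_concats_adjacent by simp
  then show ?case by blast
next
  case (right u v U V)
  then obtain n xs ys where "farey_list n = xs @ u # v # ys" by blast
  then obtain xs' ys' where "farey_list (Suc n) = xs' @ u # (u @ v) # v # ys'"
    using insert_concats_adjacent by fastforce
  then have "farey_list (Suc n) = (xs' @ [u]) @ (u @ v) # v # ys'" by simp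
  then show ?case by blast
qed

lemma Farey_eq: "Farey = {u @ v | u v. farey_neighbours u v}"
proof
  show "Farey \<subseteq> {u @ v | u v. farey_neighbours u v}"
    unfolding Farey_def using set_farey_list by blast
  show "{u @ v | u v. farey_neighbours u v} \<subseteq> Farey"
  proof
    fix w assume "w \<in> {u @ v | u v. farey_neighbours u v}"
    then obtain u v U V where w: "w = u @ v" "farey_pair u v U V" by blast
    then obtain n xs ys where "farey_list n = xs @ u # v # ys" using farey_pair_adjacent by blast
    then have "\<exists>xs' ys'. farey_list (Suc n) = xs' @ u # (u @ v) # v # ys'"
      using insert_concats_adjacent by simp
    then have mem: "w \<in> set (farey_list (Suc n))" using w by (auto simp del: farey_list.simps)
    have "2 \<le> length w" using w farey_pair_nonempty[OF w(2)] by (cases u; cases v) auto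
    then have "w \<noteq> [0]" "w \<noteq> [1]" by auto
    then show "w \<in> Farey" unfolding Farey_def using mem by (auto simp del: farey_list.simps)
  qed
qed

lemma Farey_binary_pair: assumes "w \<in> Farey" shows "binary_pair w (max_rot w)"
proof -
  obtain u v U V where w: "w = u @ v" "farey_pair u v U V" using assms unfolding Farey_eq by blast
  have b: "binary_pair (u @ v) (V @ U)" by (rule farey_pair_binary_pair[OF w(2)])
  then show ?thesis using lyndon_pair_max_rot[OF binary_pair_lyndon_pair[OF b]] w by simp
qed

section \<open>Covering the gaps between Farey intervals\<close>

lemma cycle_word_pow: "w \<noteq> [] \<Longrightarrow> cycle w = word_pow w j @- cycle w"
proof (induction j)
  case (Suc j)
  then show ?case using cycle_decomp[of w] by (simp add: word_pow_Suc)
qed simp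

lemma block_code_word_pow:
  assumes "u \<noteq> []" "last u = a" shows "block_code f a (word_pow u j) = word_pow (block_code f a u) j"
  using assms by (induction j) (auto simp: word_pow_Suc block_code_append)

text \<open>
  The code of \<open>L(u)^+ u u u \<dots>\<close>, which determines the right end point of the interval of \<open>u\<close>. For the word
  0 this is the code of \<open>1000\<dots>\<close>, which has to be given separately: only the first 0 is preceded by 1.
\<close>
definition upper_stream :: "(nat \<Rightarrow> nat \<Rightarrow> word) \<Rightarrow> word \<Rightarrow> nat stream" where
  "upper_stream f u = (if u = [0] then f 0 1 @- f 1 0 @- cycle (f 0 0)
     else block_code f 0 (word_plus (max_rot u)) @- cycle (block_code f 1 u))"

text \<open>
  The code of \<open>L(v) L(v) L(v) \<dots>\<close>, which determines the left end point of the interval of \<open>v\<close>; for the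
  word 1 it is the code of \<open>111\<dots>\<close>.
\<close>
definition lower_stream :: "(nat \<Rightarrow> nat \<Rightarrow> word) \<Rightarrow> word \<Rightarrow> nat stream" where
  "lower_stream f v = (if v = [1] then f 0 1 @- cycle (f 1 1) else cycle (block_code f 0 (max_rot v)))"

lemma farey_pair_members:
  "farey_pair u v U V \<Longrightarrow> (u = [0] \<and> U = [0] \<or> u \<in> Farey \<and> binary_pair u U) \<and>
     (v = [1] \<and> V = [1] \<or> v \<in> Farey \<and> binary_pair v V)"
proof (induction rule: farey_pair.induct)
  case (left u v U V)
  then show ?case using farey_pair_binary_pair[OF left.hyps] unfolding Farey_eq by blast
next
  case (right u v U V)
  then show ?case using farey_pair_binary_pair[OF right.hyps] unfolding Farey_eq by blast
qed simp

lemma binary_pair_max_rot: "binary_pair r R \<Longrightarrow> max_rot r = R"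
  using binary_pair_lyndon_pair lyndon_pair_max_rot by blast

lemma block_code_nonempty: "(\<And>a b. f a b \<noteq> []) \<Longrightarrow> r \<noteq> [] \<Longrightarrow> block_code f a r \<noteq> []"
  by (cases r) auto

lemma upper_stream_prefix:
  assumes f: "\<And>a b. f a b \<noteq> []" and u: "u = [0] \<and> U = [0] \<or> binary_pair u U"
  shows "\<exists>c. upper_stream f u = block_code f 0 (word_plus U @ word_pow u j) @- c"
  using u
proof
  assume u: "u = [0] \<and> U = [0]"
  have U: "word_plus U = [1]" using u by (simp add: word_plus_def)
  show ?thesis
  proof (cases j)
    case 0
    then show ?thesis using u U by (auto simp: upper_stream_def)
  next
    case (Suc i)
    have "block_code f 0 (word_pow [0] i) = word_pow (f 0 0) i" using block_code_word_pow[of "[0]" 0 f i] by simp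
    moreover have "cycle (f 0 0) = word_pow (f 0 0) i @- cycle (f 0 0)" by (rule cycle_word_pow[OF f])
    ultimately have "upper_stream f u = block_code f 0 (word_plus U @ word_pow u j) @- cycle (f 0 0)"
      using u unfolding upper_stream_def Suc word_pow_Suc U by simp
    then show ?thesis by blast
  qed
next
  assume b: "binary_pair u U"
  have ne: "u \<noteq> []" "U \<noteq> []" "last u = 1" "u \<noteq> [0]"
    using b unfolding binary_pair_def lyndon_def by auto
  have "last (word_plus U) = 1" using b by (simp add: binary_pair_def word_plus_def)
  moreover have "word_plus U \<noteq> []" by (simp add: word_plus_def)
  ultimately have "block_code f 0 (word_plus U @ word_pow u j) = block_code f 0 (word_plus U) @ word_pow (block_code f 1 u) j"
    using block_code_word_pow[OF ne(1,3)] by (simp add: block_code_append)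
  moreover have "cycle (block_code f 1 u) = word_pow (block_code f 1 u) j @- cycle (block_code f 1 u)"
    by (rule cycle_word_pow[OF block_code_nonempty[OF f ne(1)]])
  ultimately show ?thesis
    unfolding upper_stream_def binary_pair_max_rot[OF b] using ne(4)
    by (intro exI[of _ "cycle (block_code f 1 u)"]) simp
qed

lemma lower_stream_prefix:
  assumes f: "\<And>a b. f a b \<noteq> []" and v: "v = [1] \<and> V = [1] \<or> binary_pair v V"
  shows "\<exists>c. lower_stream f v = block_code f 0 (word_pow V j) @- c"
  using v
proof
  assume v: "v = [1] \<and> V = [1]"
  show ?thesis
  proof (cases j)
    case 0
    then show ?thesis by auto
  next
    case (Suc i)
    have "block_code f 1 (word_pow [1] i) = word_pow (f 1 1) i" using block_code_word_pow[of "[1]" 1 f i] by simp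
    moreover have "cycle (f 1 1) = word_pow (f 1 1) i @- cycle (f 1 1)" by (rule cycle_word_pow[OF f])
    ultimately have "lower_stream f v = block_code f 0 (word_pow V j) @- cycle (f 1 1)"
      using v unfolding lower_stream_def Suc word_pow_Suc by simp
    then show ?thesis by blast
  qed
next
  assume b: "binary_pair v V"
  have ne: "v \<noteq> []" "V \<noteq> []" "last V = 0" "v \<noteq> [1]"
    using b unfolding binary_pair_def lyndon_def by auto
  have "block_code f 0 (word_pow V j) = word_pow (block_code f 0 V) j" by (rule block_code_word_pow[OF ne(2,3)])
  moreover have "cycle (block_code f 0 V) = word_pow (block_code f 0 V) j @- cycle (block_code f 0 V)"
    by (rule cycle_word_pow[OF block_code_nonempty[OF f ne(2)]])
  ultimately show ?thesis
    unfolding lower_stream_def binary_pair_max_rot[OF b] using ne(4)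
    by (intro exI[of _ "cycle (block_code f 0 V)"]) simp
qed

lemma sset_upper_lower_stream:
  assumes f: "\<And>a b. f a b \<noteq> []" "\<And>a b. set (f a b) \<subseteq> {..D}" and w: "w \<noteq> []"
  shows "sset (upper_stream f w) \<subseteq> {..D}" "sset (lower_stream f w) \<subseteq> {..D}"
proof -
  have e: "set (block_code f a r) \<subseteq> {..D}" for a r by (rule set_block_code[OF f(2)])
  have ne: "block_code f 1 w \<noteq> []" by (rule block_code_nonempty[OF f(1) w])
  have "max_rot w \<noteq> []"
  proof -
    have "finite (range (\<lambda>k. rotate k w))"
    proof (rule finite_subset)
      show "range (\<lambda>k. rotate k w) \<subseteq> {xs. set xs \<subseteq> set w \<and> length xs = length w}" by auto
      show "finite {xs. set xs \<subseteq> set w \<and> length xs = length w}" by (rule finite_lists_length_eq) simp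
    qed
    then have "max_rot w \<in> range (\<lambda>k. rotate k w)" unfolding max_rot_def by (rule Max_in) auto
    then obtain k where "max_rot w = rotate k w" by blast
    then show ?thesis using w by simp
  qed
  then have ne0: "block_code f 0 (max_rot w) \<noteq> []" by (rule block_code_nonempty[OF f(1)])
  show "sset (upper_stream f w) \<subseteq> {..D}" unfolding upper_stream_def
    using sset_cycle[OF f(1), of 0 0] sset_cycle[OF ne] f(2) e by simp
  show "sset (lower_stream f w) \<subseteq> {..D}" unfolding lower_stream_def
    using sset_cycle[OF f(1), of 1 1] sset_cycle[OF ne0] f(2) e by simp
qed

lemma gap_farey_pair:
  assumes p: "farey_pair u v U V"
    and f: "\<And>a b. f a b \<noteq> []" "\<And>a b. set (f a b) \<subseteq> {..D}" "1 \<le> hd (f 0 1)" and rho: "1 < \<rho>"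
    and N: "N < length u + length v"
  shows "bounded (gap (upper_stream f u) (lower_stream f v) \<inter> {\<rho>..M})"
    "diameter (gap (upper_stream f u) (lower_stream f v) \<inter> {\<rho>..M}) \<le> M\<^sup>2 * D / (\<rho> - 1) / \<rho> ^ N"
proof -
  obtain z j t1 t2 where z: "word_plus U @ word_pow u j = z @ t1" "word_pow V j = z @ t2"
     "length u + length v \<le> Suc (length z)" "z \<noteq> []" "hd z = 1"
    using farey_pair_common_prefix[OF p] by blast
  note m = farey_pair_members[OF p]
  obtain c where c: "upper_stream f u = block_code f 0 (z @ t1) @- c"
    using upper_stream_prefix[where f=f and u=u and U=U and j=j] f(1) m z(1) by auto
  obtain d where d: "lower_stream f v = block_code f 0 (z @ t2) @- d"
    using lower_stream_prefix[where f=f and v=v and V=V and j=j] f(1) m z(2) by auto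
  define y where "y = block_code f 0 z"
  define c' where "c' = block_code f (last (0 # z)) t1 @- c"
  define d' where "d' = block_code f (last (0 # z)) t2 @- d"
  have c': "upper_stream f u = y @- c'" and d': "lower_stream f v = y @- d'"
    by (simp_all add: c d y_def c'_def d'_def block_code_append)
  obtain z' where z': "z = 1 # z'" using z by (cases z) auto
  have "y \<noteq> []" "1 \<le> hd y" using f(1)[of 0 1] f(3) by (simp_all add: y_def z')
  moreover have "sset c' \<subseteq> {..D}" "sset d' \<subseteq> {..D}" "set y \<subseteq> {..D}"
    using sset_upper_lower_stream[where f=f and D=D] f(1,2) farey_pair_nonempty[OF p] c' d'
    by (metis le_sup_iff sset_shift)+
  ultimately have g: "bounded (gap (y @- c') (y @- d') \<inter> {\<rho>..M})"
    "diameter (gap (y @- c') (y @- d') \<inter> {\<rho>..M}) \<le> M\<^sup>2 * D / (\<rho> - 1) / \<rho> ^ length y"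
    using gap_common_prefix[OF _ _ _ _ _ rho] by blast+
  show "bounded (gap (upper_stream f u) (lower_stream f v) \<inter> {\<rho>..M})" using g(1) c' d' by simp
  have "length z \<le> length (block_code f a z)" for a
  proof (induction z arbitrary: a)
    case (Cons b z)
    have "0 < length (f a b)" using f(1) by simp
    then have "length (b # z) \<le> length (f a b) + length (block_code f b z)" using Cons.IH[of b] unfolding list.size by linarith
    then show ?case by simp
  qed simp
  then have "N \<le> length y" using z(3) N unfolding y_def by (meson less_Suc_eq_le order_less_le_trans order_trans)
  then have "\<rho> ^ N \<le> \<rho> ^ length y" using rho by (intro power_increasing) auto
  then have "M\<^sup>2 * D / (\<rho> - 1) / \<rho> ^ length y \<le> M\<^sup>2 * D / (\<rho> - 1) / \<rho> ^ N"
    using rho by (intro divide_left_mono) auto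
  then show "diameter (gap (upper_stream f u) (lower_stream f v) \<inter> {\<rho>..M}) \<le> M\<^sup>2 * D / (\<rho> - 1) / \<rho> ^ N"
    using g(2) c' d' by simp
qed

lemma coverable_Un:
  assumes "coverable A \<delta> a" "coverable B \<delta> b" shows "coverable (A \<union> B) \<delta> (a + b)"
proof -
  from assms(1) obtain \<U> where U: "finite \<U>" "\<forall>U\<in>\<U>. bounded U \<and> diameter U \<le> \<delta>" "A \<subseteq> \<Union>\<U>" "real (card \<U>) \<le> a"
    by (rule coverableE)
  from assms(2) obtain \<V> where V: "finite \<V>" "\<forall>U\<in>\<V>. bounded U \<and> diameter U \<le> \<delta>" "B \<subseteq> \<Union>\<V>" "real (card \<V>) \<le> b"
    by (rule coverableE)
  have "real (card (\<U> \<union> \<V>)) \<le> a + b" using card_Un_le[of \<U> \<V>] U(4) V(4) by linarith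
  moreover have "finite (\<U> \<union> \<V>)" "\<forall>U\<in>\<U> \<union> \<V>. bounded U \<and> diameter U \<le> \<delta>" "A \<union> B \<subseteq> \<Union>(\<U> \<union> \<V>)"
    using U V by auto
  ultimately show ?thesis unfolding coverable_def by blast
qed

text \<open>
  The cover consists of the leaves of the tree below \<open>(u, v)\<close>, cut where the total length exceeds \<open>N\<close>. The
  quantity \<open>1 / (|u| |v|)\<close> of a node is the sum of those of its two children, and it is at least
  \<open>1/N^2\<close> at a leaf; so there are at most \<open>N^2 / (|u| |v|)\<close> leaves.
\<close>
lemma farey_tree_cover:
  fixes G :: "word \<Rightarrow> word \<Rightarrow> real set"
  assumes leaf: "\<And>u v. farey_neighbours u v \<Longrightarrow> N < length u + length v \<Longrightarrow> bounded (G u v) \<and> diameter (G u v) \<le> \<delta>"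
    and split: "\<And>u v. G u v \<subseteq> G u (u @ v) \<union> J (u @ v) \<union> G (u @ v) v"
    and uv: "farey_neighbours u v" "length u \<le> N" "length v \<le> N"
  shows "coverable (G u v - (\<Union>w\<in>Farey. J w)) \<delta> ((real N)\<^sup>2 / (real (length u) * real (length v)))"
  using uv
proof (induction "2 * N - (length u + length v)" arbitrary: u v rule: less_induct)
  case less
  obtain U V where p: "farey_pair u v U V" using less.prems(1) by blast
  have pos: "0 < length u" "0 < length v" using farey_pair_nonempty[OF p] by auto
  show ?case
  proof (cases "N < length u + length v")
    case True
    let ?X = "G u v - (\<Union>w\<in>Farey. J w)"
    have "bounded (G u v)" "diameter (G u v) \<le> \<delta>" using leaf[OF less.prems(1) True] by auto
    then have "bounded ?X" "diameter ?X \<le> \<delta>"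
      by (auto intro: bounded_subset order_trans[OF diameter_subset])
    moreover have "real (length u) * real (length v) \<le> real N * real N"
      using less.prems by (intro mult_mono) auto
    then have "1 \<le> (real N)\<^sup>2 / (real (length u) * real (length v))"
      using pos by (simp add: power2_eq_square)
    ultimately show ?thesis unfolding coverable_def by (intro exI[of _ "{?X}"]) auto
  next
    case False
    let ?w = "u @ v"
    let ?E = "\<Union>w\<in>Farey. J w"
    have dec: "2 * N - (length u + length ?w) < 2 * N - (length u + length v)"
      "2 * N - (length ?w + length v) < 2 * N - (length u + length v)"
      using pos False unfolding length_append by linarith+
    have l: "coverable (G u ?w - ?E) \<delta> ((real N)\<^sup>2 / (real (length u) * real (length ?w)))"
      by (rule less.hyps[OF dec(1)]) (use False less.prems farey_pair.left[OF p] in auto)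
    have r: "coverable (G ?w v - ?E) \<delta> ((real N)\<^sup>2 / (real (length ?w) * real (length v)))"
      by (rule less.hyps[OF dec(2)]) (use False less.prems farey_pair.right[OF p] in auto)
    have "?w \<in> Farey" using p unfolding Farey_eq by blast
    then have sub: "G u v - ?E \<subseteq> (G u ?w - ?E) \<union> (G ?w v - ?E)" using split[of u v] by blast
    have "c / (a * (a + b)) + c / ((a + b) * b) = c / (a * b)" if "0 < a" "0 < b" for a b c :: real
    proof -
      have "a + b \<noteq> 0" using that by simp
      then have "c / (a * (a + b)) + c / ((a + b) * b) = (c * b + c * a) / (a * b * (a + b))"
        using that by (simp add: divide_simps)
      also have "\<dots> = c / (a * b)" using that \<open>a + b \<noteq> 0\<close> by (simp add: divide_simps) (simp add: algebra_simps)
      finally show ?thesis .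
    qed
    from this[of "real (length u)" "real (length v)" "(real N)\<^sup>2"]
    have "(real N)\<^sup>2 / (real (length u) * real (length ?w)) + (real N)\<^sup>2 / (real (length ?w) * real (length v))
      = (real N)\<^sup>2 / (real (length u) * real (length v))"
      using pos by simp
    then show ?thesis using coverable_subset[OF coverable_Un[OF l r] sub] by simp
  qed
qed

lemma thin_farey_complement:
  fixes f :: "nat \<Rightarrow> nat \<Rightarrow> word"
  assumes f: "\<And>a b. f a b \<noteq> []" "\<And>a b. set (f a b) \<subseteq> {..D}" "1 \<le> hd (f 0 1)" and rho: "1 < \<rho>"
  shows "thin ((gap (upper_stream f [0]) (lower_stream f [1]) -
            (\<Union>w\<in>Farey. gap (lower_stream f w) (upper_stream f w))) \<inter> {\<rho>..M})"
proof (rule thinI_polynomial[OF rho, where C = "M\<^sup>2 * D / (\<rho> - 1)"])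
  fix N :: nat assume N: "1 \<le> N"
  define G where "G u v = gap (upper_stream f u) (lower_stream f v) \<inter> {\<rho>..M}" for u v
  define J where "J w = gap (lower_stream f w) (upper_stream f w)" for w
  have "coverable (G [0] [1] - (\<Union>w\<in>Farey. J w)) (M\<^sup>2 * D / (\<rho> - 1) / \<rho> ^ N)
     ((real N)\<^sup>2 / (real (length [0::nat]) * real (length [1::nat])))"
  proof (rule farey_tree_cover)
    show "farey_neighbours [0] [1]" using farey_pair.root by blast
    fix u v
    show "bounded (G u v) \<and> diameter (G u v) \<le> M\<^sup>2 * D / (\<rho> - 1) / \<rho> ^ N"
      if uv: "farey_neighbours u v" "N < length u + length v"
    proof -
      obtain U V where p: "farey_pair u v U V" using uv(1) by blast
      show ?thesis unfolding G_def
        using gap_farey_pair[where f = f and D = D, OF p f(1) f(2) f(3) rho uv(2)] by blast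
    qed
    show "G u v \<subseteq> G u (u @ v) \<union> J (u @ v) \<union> G (u @ v) v"
      unfolding G_def J_def gap_def by auto
  qed (use N in auto)
  then have "coverable (G [0] [1] - (\<Union>w\<in>Farey. J w)) (M\<^sup>2 * D / (\<rho> - 1) / \<rho> ^ N) ((real N)\<^sup>2)" by simp
  then show "coverable ((gap (upper_stream f [0]) (lower_stream f [1]) -
            (\<Union>w\<in>Farey. gap (lower_stream f w) (upper_stream f w))) \<inter> {\<rho>..M})
     (M\<^sup>2 * D / (\<rho> - 1) / \<rho> ^ N) ((real N)\<^sup>2)"
    by (rule coverable_subset) (auto simp: G_def J_def)
qed

section \<open>The sets E and E^S\<close>

lemma lyndon_hd_max: assumes "lyndon (>) (L :: nat list)" "d \<in> set L" shows "d \<le> hd L"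
proof -
  obtain x y where L: "L = x @ d # y" using split_list[OF assms(2)] by blast
  show ?thesis
  proof (cases x)
    case (Cons a x')
    then have "lex_lt (>) L (d # y)" using assms(1) L unfolding lyndon_def by blast
    moreover have "L = a # x' @ d # y" using L Cons by simp
    ultimately show ?thesis using Cons by (auto simp: lex_lt_Cons irreflp_def)
  qed (simp add: L)
qed

lemma lyndon_pair_sets:
  assumes "lyndon_pair S L"
  shows "set L = set S" "set S \<subseteq> {..hd L}" "set (word_plus L) \<subseteq> {..hd L + 1}" "S \<noteq> []" "L \<noteq> []"
proof -
  show 1: "set L = set S" "S \<noteq> []" "L \<noteq> []" using assms by (auto simp: lyndon_pair_def lyndon_def)
  show "set S \<subseteq> {..hd L}" using lyndon_hd_max[of L] assms 1 by (auto simp: lyndon_pair_def)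
  then have "set L \<subseteq> {..hd L + 1}" "last L \<le> hd L" using 1 last_in_set[of L] by auto
  then show "set (word_plus L) \<subseteq> {..hd L + 1}"
    unfolding word_plus_def using in_set_butlastD[of _ L] by auto
qed

lemma hd_word_plus: "L \<noteq> [] \<Longrightarrow> hd L \<le> hd (word_plus L)"
  by (cases L rule: rev_cases) (auto simp: word_plus_def hd_append)

lemma word_plus_nonempty [simp]: "word_plus L \<noteq> []"
  by (simp add: word_plus_def)

lemma sum_list_ge_hd: "L \<noteq> [] \<Longrightarrow> hd L \<le> sum_list (L :: nat list)"
  by (cases L) auto

lemma base_of_pair_solves:
  assumes p: "lyndon_pair S L"
  shows "1 < beta_l S \<and> base_value (cycle L) (beta_l S) = 1"
    "1 < beta_r S \<and> base_value (word_plus L @- cycle S) (beta_r S) = 1"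
    "1 < beta_star S \<and> base_value (word_plus L @- word_minus S @- cycle L) (beta_star S) = 1"
proof -
  note ne = lyndon_pair_sets(4,5)[OF p]
  have h: "1 \<le> hd L" "max_rot S = L" using p lyndon_pair_max_rot[OF p] by (auto simp: lyndon_pair_def)
  have hp: "1 \<le> hd (word_plus L)" using hd_word_plus[OF ne(2)] h by simp
  obtain D where D: "set L \<union> set S \<union> set (word_plus L) \<union> set (word_minus S) \<subseteq> {..D}"
    using finite_nat_set_iff_bounded_le[of "set L \<union> set S \<union> set (word_plus L) \<union> set (word_minus S)"]
    by auto
  have c1: "cycle L = (L @ L) @- cycle L" using cycle_decomp[OF ne(2)] by simp
  have c2: "word_plus L @- cycle S = (word_plus L @ S) @- cycle S" using cycle_decomp[OF ne(1)] by simp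
  have c3: "word_plus L @- word_minus S @- cycle L = (word_plus L @ word_minus S @ L) @- cycle L"
    using cycle_decomp[OF ne(2)] by simp
  have sp: "1 \<le> sum_list (word_plus L)" "1 \<le> sum_list L"
    using sum_list_ge_hd[OF ne(2)] sum_list_ge_hd[of "word_plus L"] h hp by auto
  have "last S \<le> sum_list S" using member_le_sum_list[of "last S" S] ne by simp
  then have sS: "1 \<le> sum_list S" using p by (simp add: lyndon_pair_def)
  show "1 < beta_l S \<and> base_value (cycle L) (beta_l S) = 1"
    unfolding beta_l_def h(2) using base_of_solves[of "cycle L" D "L @ L"] D sset_cycle[OF ne(2)] h ne sp c1
    by simp
  show "1 < beta_r S \<and> base_value (word_plus L @- cycle S) (beta_r S) = 1"
    unfolding beta_r_def h(2) using base_of_solves[of "cycle S" D "word_plus L @ S"] D sset_cycle[OF ne(1)] hp ne sp sS c2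
    by simp
  show "1 < beta_star S \<and> base_value (word_plus L @- word_minus S @- cycle L) (beta_star S) = 1"
    unfolding beta_star_def h(2) using base_of_solves[of "cycle L" D "word_plus L @ word_minus S @ L"] D
      sset_cycle[OF ne(2)] hp ne sp c3
    by simp
qed

lemma J_int_eq_gap:
  assumes p: "lyndon_pair S L"
  shows "J_int S = gap (cycle L) (word_plus L @- cycle S)"
proof -
  note ne = lyndon_pair_sets(4,5)[OF p]
  have h: "1 \<le> hd L" "max_rot S = L" using p lyndon_pair_max_rot[OF p] by (auto simp: lyndon_pair_def)
  have hp: "1 \<le> hd (word_plus L)" using hd_word_plus[OF ne(2)] h by simp
  have D: "sset (cycle L) \<subseteq> {..hd L + 1}" "sset (word_plus L @- cycle S) \<subseteq> {..hd L + 1}"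
    using lyndon_pair_sets[OF p] sset_cycle[OF ne(1)] sset_cycle[OF ne(2)] by auto
  have s: "1 \<le> shd (cycle L)" "1 \<le> shd (word_plus L @- cycle S)" using h hp ne by auto
  note sol = base_of_pair_solves[OF p]
  have l: "beta_l S \<le> x \<longleftrightarrow> base_value (cycle L) x \<le> 1" if "1 < x" for x
    using base_of_le_iff(1)[OF D(1) s(1) _ that] sol(1) unfolding beta_l_def h(2) by blast
  have r: "x \<le> beta_r S \<longleftrightarrow> 1 \<le> base_value (word_plus L @- cycle S) x" if "1 < x" for x
    using base_of_le_iff(2)[OF D(2) s(2) _ that] sol(2) unfolding beta_r_def h(2) by blast
  show ?thesis
  proof (rule set_eqI)
    fix x show "x \<in> J_int S \<longleftrightarrow> x \<in> gap (cycle L) (word_plus L @- cycle S)"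
    proof (cases "1 < x")
      case True then show ?thesis using l r by (simp add: J_int_def gap_def)
    next
      case False then show ?thesis using sol(1) by (auto simp: J_int_def gap_def)
    qed
  qed
qed

lemma Farey_e_lyndon_pair:
  assumes "s \<in> Farey_e" shows "lyndon_pair s (max_rot s)"
proof -
  obtain k w where s: "s = (theta ^^ k) w" "w \<in> Farey_hat" using assms unfolding Farey_e_def by blast
  have "\<exists>L. lyndon_pair w L"
  proof (cases "w = [1]")
    case True
    have "lyndon_pair [1] [1]" by (auto simp: lyndon_pair_def lyndon_singleton intro: exI[of _ 0])
    then show ?thesis using True by blast
  next
    case False
    then show ?thesis using s(2) Farey_binary_pair binary_pair_lyndon_pair unfolding Farey_hat_def by blast
  qed
  then obtain L where "lyndon_pair w L" ..
  from lyndon_pair_map_add[OF this, of k] have "lyndon_pair s (map (\<lambda>d. d + k) L)" unfolding s theta_pow .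
  then show ?thesis using lyndon_pair_max_rot by metis
qed

lemma Lambda_foldl_lyndon_pair:
  assumes "lyndon_pair s (max_rot s)" "set ss \<subseteq> Farey"
  shows "lyndon_pair (foldl subst_word s ss) (max_rot (foldl subst_word s ss))"
  using assms(2)
proof (induction ss rule: rev_induct)
  case (snoc r ss)
  then have "lyndon_pair (foldl subst_word s ss) (max_rot (foldl subst_word s ss))" and r: "r \<in> Farey" by auto
  from lyndon_pair_subst(2,3)[OF this(1) Farey_binary_pair[OF r]] show ?case by simp
qed (simp add: assms)

lemma Lambda_lyndon_pair: "S \<in> Lambda_e m \<Longrightarrow> lyndon_pair S (max_rot S)"
  unfolding Lambda_e_def using Lambda_foldl_lyndon_pair Farey_e_lyndon_pair by blast

lemma Farey_not_digit: "w \<in> Farey \<Longrightarrow> w \<noteq> [0] \<and> w \<noteq> [1]"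
  unfolding Farey_def by blast

lemma J_int_subst:
  assumes p: "lyndon_pair S (max_rot S)" and r: "r \<in> Farey"
  shows "J_int (subst_word S r) = gap (lower_stream (subst_block S) r) (upper_stream (subst_block S) r)"
proof -
  have b: "binary_pair r (max_rot r)" by (rule Farey_binary_pair[OF r])
  note s = lyndon_pair_subst[OF p b]
  show ?thesis
    using J_int_eq_gap[OF s(2)] s(1,3,4) Farey_not_digit[OF r]
    by (simp add: lower_stream_def upper_stream_def)
qed

lemma finite_union_digits: "\<exists>D. \<forall>a b. set (subst_block S a b) \<subseteq> {..D}"
proof -
  let ?X = "set (max_rot S) \<union> set (word_minus S) \<union> set (word_plus (max_rot S)) \<union> set S"
  obtain D where "?X \<subseteq> {..D}" using finite_nat_set_iff_bounded_le[of ?X] by auto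
  then show ?thesis by (intro exI[of _ D]) (auto simp: subst_block_def)
qed

text \<open>
  The streams assigned to the words 0 and 1 by the block code of \<open>S\<close> are those of \<open>\<beta>_*^S\<close> and \<open>\<beta>_r^S\<close>, so
  \<open>E^S\<close> is contained in the gap at the root of the tree. Its lower bound \<open>\<beta>_*^S\<close> exceeds 1, so the
  estimates hold on all of it.
\<close>
theorem box_dim_E_rel:
  assumes "S \<in> Lambda_all" shows "has_box_dim (E_rel S) 0"
proof -
  have p: "lyndon_pair S (max_rot S)" using assms Lambda_lyndon_pair unfolding Lambda_all_def by blast
  note ne = lyndon_pair_sets(4,5)[OF p]
  let ?L = "max_rot S" and ?f = "subst_block S"
  have h: "1 \<le> hd ?L" using p by (simp add: lyndon_pair_def)
  have f1: "?f a b \<noteq> []" for a b using length_subst_block[OF p, of a b] ne by auto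
  obtain D where f2: "\<And>a b. set (?f a b) \<subseteq> {..D}" using finite_union_digits by blast
  have f3: "1 \<le> hd (?f 0 1)" using hd_word_plus[OF ne(2)] h by simp
  note sol = base_of_pair_solves[OF p]
  have "thin ((gap (upper_stream ?f [0]) (lower_stream ?f [1]) -
            (\<Union>w\<in>Farey. gap (lower_stream ?f w) (upper_stream ?f w))) \<inter> {beta_star S..beta_r S})"
    by (rule thin_farey_complement[where f = ?f and D = D, OF f1 f2 f3]) (use sol(3) in blast)
  moreover have "E_rel S \<subseteq> (gap (upper_stream ?f [0]) (lower_stream ?f [1]) -
            (\<Union>w\<in>Farey. gap (lower_stream ?f w) (upper_stream ?f w))) \<inter> {beta_star S..beta_r S}"
  proof
    fix x assume x: "x \<in> E_rel S"
    then have xJ: "x \<in> J_int S" and xI: "x \<notin> I_int S" and xr: "\<And>r. r \<in> Farey \<Longrightarrow> x \<notin> J_int (subst_word S r)"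
      unfolding E_rel_def by auto
    have b: "beta_star S \<le> x" "x \<le> beta_r S" using xJ xI unfolding J_int_def I_int_def by auto
    have x1: "1 < x" using b sol(3) by simp
    have D: "sset (word_plus ?L @- word_minus S @- cycle ?L) \<subseteq> {..D}"
      using f2[of 0 1] f2[of 1 0] f2[of 0 0] sset_cycle[OF ne(2)] by auto
    have "1 \<le> shd (word_plus ?L @- word_minus S @- cycle ?L)" using f3 by simp
    from base_of_le_iff(1)[OF D this _ x1] have "base_value (word_plus ?L @- word_minus S @- cycle ?L) x \<le> 1"
      using b(1) sol(3) unfolding beta_star_def by blast
    moreover have "1 \<le> base_value (word_plus ?L @- cycle S) x"
      using xJ J_int_eq_gap[OF p] by (simp add: gap_def)
    ultimately have "x \<in> gap (upper_stream ?f [0]) (lower_stream ?f [1])"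
      using x1 by (simp add: gap_def upper_stream_def lower_stream_def)
    then show "x \<in> (gap (upper_stream ?f [0]) (lower_stream ?f [1]) -
            (\<Union>w\<in>Farey. gap (lower_stream ?f w) (upper_stream ?f w))) \<inter> {beta_star S..beta_r S}"
      using b xr J_int_subst[OF p] by auto
  qed
  ultimately show ?thesis using thin_subset thin_has_box_dim_0 by blast
qed

text \<open>
  The map \<open>\<theta>^k\<close> as a block code with blocks of length 1. Capping the digit at 1 bounds the blocks for all
  arguments and changes nothing on binary words.
\<close>
definition shift_block :: "nat \<Rightarrow> nat \<Rightarrow> nat \<Rightarrow> word" where
  "shift_block k a b = [min b 1 + k]"

lemma block_code_shift_block: "set r \<subseteq> {0, 1} \<Longrightarrow> block_code (shift_block k) a r = map (\<lambda>d. d + k) r"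
  by (induction r arbitrary: a) (auto simp: shift_block_def)

lemma word_plus_map_add: "L \<noteq> [] \<Longrightarrow> word_plus (map (\<lambda>d. d + k) L) = map (\<lambda>d. d + k) (word_plus L)"
  by (simp add: word_plus_def map_butlast last_map)

lemma J_int_theta:
  assumes w: "w \<in> Farey"
  shows "J_int ((theta ^^ k) w) = gap (lower_stream (shift_block k) w) (upper_stream (shift_block k) w)"
proof -
  have b: "binary_pair w (max_rot w)" by (rule Farey_binary_pair[OF w])
  have ne: "max_rot w \<noteq> []" using b by (simp add: binary_pair_def lyndon_def)
  have p: "lyndon_pair (map (\<lambda>d. d + k) w) (map (\<lambda>d. d + k) (max_rot w))"
    by (rule lyndon_pair_map_add[OF binary_pair_lyndon_pair[OF b]])
  have sw: "set w \<subseteq> {0, 1}" using b by (simp add: binary_pair_def)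
  then have sL: "set (max_rot w) \<subseteq> {0, 1}"
    using lyndon_pair_sets(1)[OF binary_pair_lyndon_pair[OF b]] by simp
  have "last (max_rot w) = 0" using b by (simp add: binary_pair_def)
  then have sP: "set (word_plus (max_rot w)) \<subseteq> {0, 1}"
    using sL in_set_butlastD[of _ "max_rot w"] by (auto simp: word_plus_def)
  show ?thesis
    using J_int_eq_gap[OF p] Farey_not_digit[OF w]
    by (simp add: theta_pow lower_stream_def upper_stream_def block_code_shift_block[OF sw]
        block_code_shift_block[OF sL] block_code_shift_block[OF sP] word_plus_map_add[OF ne])
qed

lemma base_value_cycle_digit: "1 < x \<Longrightarrow> base_value (cycle [a]) x = real a / (x - 1)"
proof -
  assume x: "1 < x"
  have "cycle [a] = a ## cycle [a]" using cycle_decomp[of "[a]"] by simp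
  then have "base_value (cycle [a]) x = (real a + base_value (cycle [a]) x) / x"
    using base_value_Stream[of "cycle [a]" a x a] sset_cycle[of "[a]"] x by simp
  then show ?thesis using x by (simp add: field_simps)
qed

text \<open>
  The least \<open>k\<close> with \<open>x \<le> k + 2\<close> is the right one: \<open>k + 2\<close> is the left end point of the interval of the
  one-digit word \<open>k + 1\<close>, and for \<open>k > 0\<close> the point \<open>x\<close> lies to the right of the interval of the word \<open>k\<close>.
\<close>
lemma E_set_cover:
  assumes x: "x \<in> E_set"
  obtains k where "x \<in> gap (upper_stream (shift_block k) [0]) (lower_stream (shift_block k) [1]) -
            (\<Union>w\<in>Farey. gap (lower_stream (shift_block k) w) (upper_stream (shift_block k) w))"
proof -
  have x1: "1 < x" and xJ: "\<And>s. s \<in> Farey_e \<Longrightarrow> x \<notin> J_int s" using x unfolding E_set_def by auto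
  have ex: "\<exists>k::nat. x \<le> real k + 2"
    using real_arch_simple[of x] by (meson add_increasing2 zero_le_numeral)
  define k where "k = (LEAST k::nat. x \<le> real k + 2)"
  have k: "x \<le> real k + 2" unfolding k_def by (rule LeastI_ex[OF ex])
  have cyc: "cycle [a] = a ## cycle [a]" for a :: nat using cycle_decomp[of "[a]"] by simp
  have lo: "lower_stream (shift_block k) [1] = cycle [Suc k]"
    using cyc[of "Suc k"] by (simp add: lower_stream_def shift_block_def)
  have up: "upper_stream (shift_block k) [0] = Suc k ## cycle [k]"
    using cyc[of k] by (simp add: upper_stream_def shift_block_def)
  have "1 \<le> base_value (cycle [Suc k]) x" using base_value_cycle_digit[OF x1, of "Suc k"] k x1 by simp
  moreover have "base_value (Suc k ## cycle [k]) x \<le> 1"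
  proof (cases k)
    case 0
    have "base_value (Suc k ## cycle [k]) x = (real (Suc k) + base_value (cycle [k]) x) / x"
      using base_value_Stream[of "cycle [k]" k x "Suc k"] sset_cycle[of "[k]"] x1 by simp
    then show ?thesis using base_value_cycle_digit[OF x1, of k] 0 x1 by simp
  next
    case (Suc i)
    then have "\<not> x \<le> real i + 2" using not_less_Least[of i "\<lambda>k. x \<le> real k + 2"] unfolding k_def by simp
    then have kx: "real k + 1 < x" using Suc by simp
    have kE: "[k] \<in> Farey_e"
    proof -
      have "[k] = (theta ^^ i) [1]" by (simp add: theta_pow Suc)
      then show ?thesis unfolding Farey_e_def Farey_hat_def by blast
    qed
    have "[k] = max_rot [k]" by (auto simp: max_rot_def)
    then have "lyndon_pair [k] [k]" using Farey_e_lyndon_pair[OF kE] by simp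
    from J_int_eq_gap[OF this] have "J_int [k] = gap (cycle [k]) (Suc k ## cycle [k])"
      by (simp add: word_plus_def)
    then have "\<not> (base_value (cycle [k]) x \<le> 1 \<and> 1 \<le> base_value (Suc k ## cycle [k]) x)"
      using xJ[OF kE] x1 by (simp add: gap_def)
    moreover have "base_value (cycle [k]) x \<le> 1"
      using base_value_cycle_digit[OF x1, of k] kx x1 by simp
    ultimately show ?thesis by simp
  qed
  ultimately have "x \<in> gap (upper_stream (shift_block k) [0]) (lower_stream (shift_block k) [1])"
    unfolding lo up gap_def using x1 by simp
  moreover have "x \<notin> gap (lower_stream (shift_block k) w) (upper_stream (shift_block k) w)" if "w \<in> Farey" for w
  proof -
    have "(theta ^^ k) w \<in> Farey_e" using that unfolding Farey_e_def Farey_hat_def by blast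
    then show ?thesis using xJ J_int_theta[OF that] by blast
  qed
  ultimately show thesis using that by blast
qed

lemma exhaustion_above_1:
  fixes x :: real assumes "1 < x"
  shows "\<exists>j. x \<in> {1 + 1 / real (Suc j)..real (Suc j)}"
proof -
  obtain n where n: "inverse (real (Suc n)) < x - 1" using reals_Archimedean[of "x - 1"] assms by auto
  obtain m where m: "x \<le> real m" using real_arch_simple by blast
  have "1 / real (Suc (max n m)) \<le> 1 / real (Suc n)" by (intro divide_left_mono) auto
  then have "1 + 1 / real (Suc (max n m)) \<le> x" using n by (simp add: inverse_eq_divide)
  moreover have "x \<le> real (Suc (max n m))" using m by simp
  ultimately show ?thesis by (intro exI[of _ "max n m"]) simp
qed

theorem packing_dim_E_set: "packing_dim E_set = 0"
proof -
  define X where "X k = gap (upper_stream (shift_block k) [0]) (lower_stream (shift_block k) [1]) -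
            (\<Union>w\<in>Farey. gap (lower_stream (shift_block k) w) (upper_stream (shift_block k) w))" for k
  define F where "F i = (case prod_decode i of (k, j) \<Rightarrow> X k \<inter> {1 + 1 / real (Suc j)..real (Suc j)})" for i
  show ?thesis
  proof (rule packing_dim_eq_0)
    show "thin (F i)" for i
    proof -
      obtain k j where i: "prod_decode i = (k, j)" by force
      show ?thesis unfolding F_def i X_def prod.case
        by (rule thin_farey_complement[where D = "Suc k"]) (auto simp: shift_block_def)
    qed
    show "E_set \<subseteq> (\<Union>i. F i)"
    proof
      fix x assume x: "x \<in> E_set"
      obtain k where k: "x \<in> X k" unfolding X_def by (rule E_set_cover[OF x])
      have "1 < x" using x by (simp add: E_set_def)
      then obtain j where j: "x \<in> {1 + 1 / real (Suc j)..real (Suc j)}" using exhaustion_above_1 by blast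
      then have "x \<in> F (prod_encode (k, j))" using k by (simp add: F_def)
      then show "x \<in> (\<Union>i. F i)" by blast
    qed
  qed
qed

section \<open>The set of bases in intervals of every level\<close>

fun adjacent_weight :: "word list \<Rightarrow> real" where
  "adjacent_weight (u # v # ws) = 1 / (real (length u) * real (length v))\<^sup>2 + adjacent_weight (v # ws)"
| "adjacent_weight ws = 0"

definition quartic_weight :: "word \<Rightarrow> real" where
  "quartic_weight w = 1 / real (length w) ^ 4"

text \<open>
  After clearing denominators this is \<open>4ab \<le> (a + b)^2\<close>.
\<close>
lemma weight_split:
  fixes a b :: real assumes "0 < a" "0 < b"
  shows "1 / (a + b) ^ 4 + (1 / (a * (a + b))\<^sup>2 + 1 / ((a + b) * b)\<^sup>2) / 8 \<le> 1 / (a * b)\<^sup>2 / 8"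
proof -
  have ab: "0 < a + b" using assms by simp
  have "4 * (a * b) \<le> (a + b)\<^sup>2" using zero_le_power2[of "a - b"] by (simp add: power2_eq_square algebra_simps)
  have "1 / (a * b)\<^sup>2 - (1 / (a * (a + b))\<^sup>2 + 1 / ((a + b) * b)\<^sup>2) = 2 * (a * b) * (a + b)\<^sup>2 / (a\<^sup>2 * b\<^sup>2 * (a + b) ^ 4)"
  proof -
    have "1 / (a * b)\<^sup>2 = (a + b) ^ 4 / (a\<^sup>2 * b\<^sup>2 * (a + b) ^ 4)" using assms ab by (simp add: power_mult_distrib)
    moreover have "1 / (a * (a + b))\<^sup>2 = b\<^sup>2 * (a + b)\<^sup>2 / (a\<^sup>2 * b\<^sup>2 * (a + b) ^ 4)"
      using assms ab by (simp add: power_mult_distrib divide_simps)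
    moreover have "1 / ((a + b) * b)\<^sup>2 = a\<^sup>2 * (a + b)\<^sup>2 / (a\<^sup>2 * b\<^sup>2 * (a + b) ^ 4)"
      using assms ab by (simp add: power_mult_distrib divide_simps)
    moreover have "(a + b) ^ 4 - (b\<^sup>2 * (a + b)\<^sup>2 + a\<^sup>2 * (a + b)\<^sup>2) = 2 * (a * b) * (a + b)\<^sup>2"
      by (simp add: power2_eq_square power4_eq_xxxx algebra_simps)
    ultimately show ?thesis by (simp only: diff_divide_distrib[symmetric] add_divide_distrib[symmetric])
  qed
  moreover have "2 * (a * b) * (a + b)\<^sup>2 \<ge> 8 * (a * b)\<^sup>2"
    using mult_left_mono[OF \<open>4 * (a * b) \<le> (a + b)\<^sup>2\<close>, of "2 * (a * b)"] assms
    by (simp add: power2_eq_square algebra_simps)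
  then have "8 * (a * b)\<^sup>2 / (a\<^sup>2 * b\<^sup>2 * (a + b) ^ 4) \<le> 2 * (a * b) * (a + b)\<^sup>2 / (a\<^sup>2 * b\<^sup>2 * (a + b) ^ 4)"
    using assms by (intro divide_right_mono) auto
  moreover have "8 * (a * b)\<^sup>2 / (a\<^sup>2 * b\<^sup>2 * (a + b) ^ 4) = 8 * (1 / (a + b) ^ 4)"
    using assms ab by (simp add: power_mult_distrib)
  moreover have "p + q / 8 \<le> r / 8" if "r - q = y" "t \<le> y" "t = 8 * p" for p q r t y :: real
    using that by simp
  ultimately show ?thesis by blast
qed

lemma quartic_weight_nonneg: "0 \<le> quartic_weight w"
  by (simp add: quartic_weight_def)

lemma adjacent_weight_nonneg: "0 \<le> adjacent_weight l"
  by (induction l rule: adjacent_weight.induct) auto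

text \<open>
  A weight of \<open>1 / (8 |u|^2 |v|^2)\<close> is stored between neighbours \<open>u, v\<close>. When \<open>uv\<close> is inserted, this suffices
  to pay for \<open>|uv|^-4\<close> and for the weights stored in the two new places.
\<close>
lemma insert_concats_weight:
  assumes "\<forall>w\<in>set l. w \<noteq> []"
  shows "sum_list (map quartic_weight (insert_concats l)) + adjacent_weight (insert_concats l) / 8
     \<le> sum_list (map quartic_weight l) + adjacent_weight l / 8"
  using assms
proof (induction l rule: insert_concats.induct)
  case (1 u v ws)
  obtain ws' where ws': "insert_concats (v # ws) = v # ws'" using insert_concats_Cons by blast
  have "0 < real (length u)" "0 < real (length v)" using "1.prems" by auto
  from weight_split[OF this]
  have "quartic_weight (u @ v) + (1 / (real (length u) * real (length (u @ v)))\<^sup>2 +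
      1 / (real (length (u @ v)) * real (length v))\<^sup>2) / 8 \<le> 1 / (real (length u) * real (length v))\<^sup>2 / 8"
    by (simp add: quartic_weight_def)
  moreover have "sum_list (map quartic_weight (v # ws')) + adjacent_weight (v # ws') / 8
     \<le> sum_list (map quartic_weight (v # ws)) + adjacent_weight (v # ws) / 8"
    using 1 ws' by simp
  ultimately show ?case unfolding insert_concats.simps ws' adjacent_weight.simps by (simp add: add_divide_distrib)
qed auto

lemma farey_list_nonempty_words: "w \<in> set (farey_list n) \<Longrightarrow> w \<noteq> []"
  using set_farey_list[of n] farey_pair_nonempty by fastforce

lemma farey_list_weight: "sum_list (map quartic_weight (farey_list n)) + adjacent_weight (farey_list n) / 8 \<le> 2 + 1 / 8"
proof (induction n)
  case 0
  then show ?case by (simp add: quartic_weight_def)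
next
  case (Suc n)
  then show ?case using insert_concats_weight[of "farey_list n"] farey_list_nonempty_words[of _ n] by simp
qed

lemma sum_set_le_sum_list: "(\<And>x. 0 \<le> g x) \<Longrightarrow> (\<Sum>x\<in>set xs. g x) \<le> (sum_list (map g xs) :: real)"
proof (induction xs)
  case (Cons a xs)
  then show ?case by (cases "a \<in> set xs") (auto simp: insert_absorb add_increasing)
qed simp

lemma farey_list_mono: "m \<le> n \<Longrightarrow> set (farey_list m) \<subseteq> set (farey_list n)"
  by (rule lift_Suc_mono_le[of "\<lambda>n. set (farey_list n)"]) (auto intro: set_insert_concats_mono[THEN subsetD])

text \<open>
  The words 0 and 1 contribute 2 to the sum over a Farey list, and the weight stored initially is 1/8.
\<close>
lemma Farey_weight:
  assumes F: "finite F" "F \<subseteq> Farey" shows "(\<Sum>w\<in>F. quartic_weight w) \<le> 1 / 8"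
proof -
  have "\<exists>n. F \<subseteq> set (farey_list n)" using F
  proof (induction F rule: finite_induct)
    case (insert w F)
    then obtain n where n: "F \<subseteq> set (farey_list n)" by blast
    obtain m where "w \<in> set (farey_list m)" using insert unfolding Farey_def by blast
    then have "insert w F \<subseteq> set (farey_list (max m n))"
      using n farey_list_mono[of m "max m n"] farey_list_mono[of n "max m n"] by auto
    then show ?case by blast
  qed simp
  then obtain n where n: "F \<subseteq> set (farey_list n)" by blast
  have roots: "{[0], [1]} \<subseteq> set (farey_list n)" using farey_list_mono[of 0 n] by simp
  have "(\<Sum>w\<in>F. quartic_weight w) + 2 = (\<Sum>w\<in>F. quartic_weight w) + (\<Sum>w\<in>{[0], [1]}. quartic_weight w)"
    by (simp add: quartic_weight_def)
  also have "\<dots> = (\<Sum>w\<in>F \<union> {[0], [1]}. quartic_weight w)"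
    using F Farey_not_digit by (intro sum.union_disjoint[symmetric]) auto
  also have "\<dots> \<le> (\<Sum>w\<in>set (farey_list n). quartic_weight w)"
    using n roots quartic_weight_nonneg by (intro sum_mono2) auto
  also have "\<dots> \<le> sum_list (map quartic_weight (farey_list n))"
    by (rule sum_set_le_sum_list[OF quartic_weight_nonneg])
  also have "\<dots> \<le> 2 + 1 / 8" using farey_list_weight[of n] adjacent_weight_nonneg[of "farey_list n"] by simp
  finally show ?thesis by simp
qed

lemma sum_image_product_le:
  fixes g :: "'c \<Rightarrow> real"
  assumes F: "finite F" "F \<subseteq> (\<lambda>(x, y). h x y) ` (X \<times> Y)"
    and g: "\<And>x y. x \<in> X \<Longrightarrow> y \<in> Y \<Longrightarrow> g (h x y) = gx x * gy y"
    and nn: "\<And>x. 0 \<le> gx x" "\<And>y. 0 \<le> gy y"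
    and X: "\<And>A. finite A \<Longrightarrow> A \<subseteq> X \<Longrightarrow> (\<Sum>x\<in>A. gx x) \<le> a"
    and Y: "\<And>B. finite B \<Longrightarrow> B \<subseteq> Y \<Longrightarrow> (\<Sum>y\<in>B. gy y) \<le> b"
  shows "(\<Sum>z\<in>F. g z) \<le> a * b"
proof -
  obtain C where C: "C \<subseteq> X \<times> Y" "finite C" "F = (\<lambda>(x, y). h x y) ` C"
    using finite_subset_image[OF F] by blast
  define A B where "A = fst ` C" and "B = snd ` C"
  have AB: "finite A" "finite B" "A \<subseteq> X" "B \<subseteq> Y" "C \<subseteq> A \<times> B" using C by (auto simp: A_def B_def rev_image_eqI)
  have "(\<Sum>z\<in>F. g z) \<le> (\<Sum>p\<in>C. g ((\<lambda>(x, y). h x y) p))"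
    unfolding C(3) using C g nn by (intro sum_image_le[unfolded o_def]) (auto simp: g subset_iff)
  also have "\<dots> = (\<Sum>(x, y)\<in>C. gx x * gy y)" using C g by (intro sum.cong) auto
  also have "\<dots> \<le> (\<Sum>(x, y)\<in>A \<times> B. gx x * gy y)" using AB nn by (intro sum_mono2) auto
  also have "\<dots> = (\<Sum>x\<in>A. gx x) * (\<Sum>y\<in>B. gy y)" by (simp add: sum_product sum.cartesian_product)
  also have "\<dots> \<le> a * b"
  proof (rule mult_mono[OF X Y])
    show "0 \<le> a" using X[of "{}"] by simp
    show "0 \<le> (\<Sum>y\<in>B. gy y)" using nn by (intro sum_nonneg)
  qed (use AB in auto)
  finally show ?thesis .
qed

text \<open>
  The words of \<open>\<Lambda>_e(m)\<close> whose first factor comes from a shift by at most \<open>D\<close>. Without such a restriction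
  the words of bounded length would be infinite in number.
\<close>
definition Lambda_digits :: "nat \<Rightarrow> nat \<Rightarrow> word set" where
  "Lambda_digits D m = {foldl subst_word ((theta ^^ k) w) ss | k w ss.
     k \<le> D \<and> w \<in> Farey_hat \<and> set ss \<subseteq> Farey \<and> 1 + length ss = m}"

lemma Lambda_digits_subset: "Lambda_digits D m \<subseteq> Lambda_e m"
  unfolding Lambda_digits_def Lambda_e_def Farey_e_def by blast

lemma length_subst_word:
  assumes "lyndon_pair S (max_rot S)" "r \<in> Farey"
  shows "length (subst_word S r) = length S * length r"
  using lyndon_pair_subst(1)[OF assms(1) Farey_binary_pair[OF assms(2)]] length_block_code[of "subst_block S"]
    length_subst_block[OF assms(1)] by simp

text \<open>
  Lengths are multiplied by the substitution, so each additional Farey factor contributes the factor 1/8.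
  There are \<open>D + 1\<close> shifts for the first factor, which is the shift of the word 1, of weight 1, or of a
  Farey word; the latter have total weight at most 1/8.
\<close>
lemma Lambda_digits_weight:
  assumes "finite F" "F \<subseteq> Lambda_digits D (Suc m)"
  shows "(\<Sum>S\<in>F. quartic_weight S) \<le> 2 * (real D + 1) * (1 / 8) ^ m"
  using assms
proof (induction m arbitrary: F)
  case 0
  have sub: "F \<subseteq> (\<lambda>(k, w). (theta ^^ k) w) ` ({..D} \<times> Farey_hat)"
    using 0 unfolding Lambda_digits_def by auto
  have hat: "(\<Sum>w\<in>B. quartic_weight w) \<le> 2" if B: "finite B" "B \<subseteq> Farey_hat" for B
  proof -
    have "(\<Sum>w\<in>B. quartic_weight w) \<le> (\<Sum>w\<in>(B - {[1]}) \<union> {[1]}. quartic_weight w)"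
      using B quartic_weight_nonneg by (intro sum_mono2) auto
    also have "\<dots> = (\<Sum>w\<in>B - {[1]}. quartic_weight w) + 1"
      using B by (subst sum.union_disjoint) (auto simp: quartic_weight_def)
    also have "(\<Sum>w\<in>B - {[1]}. quartic_weight w) \<le> 1 / 8"
      using B by (intro Farey_weight) (auto simp: Farey_hat_def)
    finally show ?thesis by simp
  qed
  have "(\<Sum>S\<in>F. quartic_weight S) \<le> (real D + 1) * 2"
  proof (rule sum_image_product_le[OF 0(1) sub])
    show "quartic_weight ((theta ^^ k) w) = 1 * quartic_weight w" for k w
      by (simp add: theta_pow quartic_weight_def)
    show "(\<Sum>x\<in>A. 1) \<le> real D + 1" if "finite A" "A \<subseteq> {..D}" for A
      using card_mono[OF _ that(2)] by simp
  qed (use hat quartic_weight_nonneg in auto)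
  then show ?case by simp
next
  case (Suc m)
  have sub: "F \<subseteq> (\<lambda>(S, r). subst_word S r) ` (Lambda_digits D (Suc m) \<times> Farey)"
  proof
    fix T assume "T \<in> F"
    then obtain k w ss where T: "T = foldl subst_word ((theta ^^ k) w) ss" "k \<le> D" "w \<in> Farey_hat"
      "set ss \<subseteq> Farey" "length ss = Suc m" using Suc.prems unfolding Lambda_digits_def by auto
    obtain ss' r where ss: "ss = ss' @ [r]" using T(5) by (cases ss rule: rev_cases) auto
    have "foldl subst_word ((theta ^^ k) w) ss' \<in> Lambda_digits D (Suc m)"
      using T ss unfolding Lambda_digits_def by auto
    moreover have "T = subst_word (foldl subst_word ((theta ^^ k) w) ss') r" "r \<in> Farey" using T ss by auto
    ultimately show "T \<in> (\<lambda>(S, r). subst_word S r) ` (Lambda_digits D (Suc m) \<times> Farey)" by blast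
  qed
  have "(\<Sum>S\<in>F. quartic_weight S) \<le> (2 * (real D + 1) * (1 / 8) ^ m) * (1 / 8)"
  proof (rule sum_image_product_le[OF Suc.prems(1) sub])
    fix S r assume S: "S \<in> Lambda_digits D (Suc m)" and r: "r \<in> Farey"
    have "lyndon_pair S (max_rot S)" using S Lambda_digits_subset Lambda_lyndon_pair by blast
    from length_subst_word[OF this r]
    show "quartic_weight (subst_word S r) = quartic_weight S * quartic_weight r"
      by (simp add: quartic_weight_def power_mult_distrib)
  qed (use Suc.IH Farey_weight quartic_weight_nonneg in auto)
  then show ?case by simp
qed

lemma Lambda_e_length: "S \<in> Lambda_e m \<Longrightarrow> m \<le> length S"
proof -
  have "lyndon_pair s (max_rot s) \<Longrightarrow> set ss \<subseteq> Farey \<Longrightarrow> Suc (length ss) \<le> length (foldl subst_word s ss)" for s ss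
  proof (induction ss rule: rev_induct)
    case Nil
    then show ?case using lyndon_pair_sets(4) by (simp add: Suc_le_eq)
  next
    case (snoc r ss)
    let ?S = "foldl subst_word s ss"
    have p: "lyndon_pair ?S (max_rot ?S)" using Lambda_foldl_lyndon_pair snoc.prems by simp
    have r: "r \<in> Farey" using snoc.prems by simp
    have r2: "2 \<le> length r"
    proof -
      obtain x y where "r = x @ y" "x \<noteq> []" "y \<noteq> []" using Farey_binary_pair[OF r] unfolding binary_pair_def by blast
      then show ?thesis by (cases x; cases y) auto
    qed
    have "Suc (length ss) * 2 \<le> length ?S * length r" using snoc r2 by (intro mult_le_mono) auto
    then show ?case using length_subst_word[OF p r] by simp
  qed
  then show "S \<in> Lambda_e m \<Longrightarrow> m \<le> length S"
    unfolding Lambda_e_def using Farey_e_lyndon_pair by fastforce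
qed

text \<open>
  The largest digit of \<open>S\<close> is the first one of \<open>L(S)\<close>, and the block \<open>L(S)^+\<close> occurs in \<open>S \<bullet> r\<close>.
\<close>
lemma subst_word_keeps_digits:
  assumes p: "lyndon_pair S (max_rot S)" and r: "r \<in> Farey" and d: "d \<in> set S"
  shows "\<exists>d'\<in>set (subst_word S r). d \<le> d'"
proof -
  let ?L = "max_rot S"
  have b: "binary_pair r (max_rot r)" by (rule Farey_binary_pair[OF r])
  note s = lyndon_pair_subst[OF p b]
  have "max_rot r \<noteq> []" "hd (max_rot r) = 1" using b by (auto simp: binary_pair_def lyndon_def)
  then obtain t where "max_rot r = 1 # t" by (cases "max_rot r") auto
  then have "max_rot (subst_word S r) = word_plus ?L @ block_code (subst_block S) 1 t" using s(3) by simp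
  then have "hd (word_plus ?L) \<in> set (max_rot (subst_word S r))" by (metis Un_iff hd_in_set set_append word_plus_nonempty)
  then have "hd (word_plus ?L) \<in> set (subst_word S r)" using lyndon_pair_sets(1)[OF s(2)] s(3) by simp
  moreover have "d \<le> hd (word_plus ?L)"
    using lyndon_pair_sets(2)[OF p] d hd_word_plus[OF lyndon_pair_sets(5)[OF p]] by (auto intro: order_trans)
  ultimately show ?thesis by blast
qed

text \<open>
  The digits added by the initial shift are never lost, so a bound for the digits of the product is also
  a bound for that shift.
\<close>
lemma Lambda_e_bounded_digits:
  assumes S: "S \<in> Lambda_e m" "set S \<subseteq> {..D}" shows "S \<in> Lambda_digits D m"
proof -
  obtain k w ss where e: "S = foldl subst_word ((theta ^^ k) w) ss" "w \<in> Farey_hat" "set ss \<subseteq> Farey" "1 + length ss = m"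
    using S unfolding Lambda_e_def Farey_e_def by blast
  let ?s = "(theta ^^ k) w"
  have s: "lyndon_pair ?s (max_rot ?s)" using e(2) Farey_e_lyndon_pair unfolding Farey_e_def by blast
  have "\<exists>d\<in>set (foldl subst_word ?s ss). k \<le> d" using e(3)
  proof (induction ss rule: rev_induct)
    case Nil
    have "w \<noteq> []" using lyndon_pair_sets(4)[OF s] by (simp add: theta_pow)
    then show ?case by (cases w) (auto simp: theta_pow)
  next
    case (snoc r ss)
    then obtain d where d: "d \<in> set (foldl subst_word ?s ss)" "k \<le> d" by auto
    have "lyndon_pair (foldl subst_word ?s ss) (max_rot (foldl subst_word ?s ss))"
      using Lambda_foldl_lyndon_pair[OF s] snoc.prems by simp
    from subst_word_keeps_digits[OF this _ d(1), of r] snoc.prems d(2) show ?case by (auto intro: order_trans)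
  qed
  then have "k \<le> D" using S(2) e(1) by auto
  then show ?thesis unfolding Lambda_digits_def using e by blast
qed

text \<open>
  The first digit \<open>d\<close> of the expansion satisfies \<open>d / x \<le> 1\<close>.
\<close>
lemma J_int_digit_bound:
  assumes p: "lyndon_pair S (max_rot S)" and x: "x \<in> J_int S" "x \<le> real D"
  shows "hd (max_rot S) \<le> D"
proof -
  let ?L = "max_rot S"
  note ne = lyndon_pair_sets(4,5)[OF p]
  have g: "1 < x" "base_value (cycle ?L) x \<le> 1" using x J_int_eq_gap[OF p] by (auto simp: gap_def)
  have c: "cycle ?L = [hd ?L] @- (tl ?L @- cycle ?L)" using cycle_decomp[OF ne(2)] ne(2)
    by (metis append_Cons append_Nil list.collapse shift_append)
  have set: "set ?L \<subseteq> {..hd ?L}" using lyndon_pair_sets(1,2)[OF p] by simp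
  then have D: "sset (tl ?L @- cycle ?L) \<subseteq> {..hd ?L}" using sset_cycle[OF ne(2)] list.set_sel(2)[OF ne(2)] by auto
  have "real (sum_list [hd ?L]) / x ^ length [hd ?L] \<le> base_value ([hd ?L] @- (tl ?L @- cycle ?L)) x"
    by (rule base_value_shift_ge[OF D _ g(1)]) simp
  then have "real (hd ?L) / x \<le> 1" using g(2) c by simp
  then have "real (hd ?L) \<le> real D" using g(1) x(2) by (simp add: divide_le_eq)
  then show ?thesis by simp
qed

text \<open>
  Both end points have expansions that begin with \<open>L(S)\<close> without its last digit.
\<close>
lemma J_int_diameter:
  assumes p: "lyndon_pair S (max_rot S)" and len: "2 \<le> length S" and rho: "1 < \<rho>"
    and D: "hd (max_rot S) \<le> D"
  shows "bounded (J_int S \<inter> {\<rho>..M})"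
    "diameter (J_int S \<inter> {\<rho>..M}) \<le> M\<^sup>2 * real (D + 1) / (\<rho> - 1) * \<rho> / \<rho> ^ length S"
proof -
  let ?L = "max_rot S"
  note sets = lyndon_pair_sets[OF p]
  define z where "z = butlast ?L"
  have lenL: "length ?L = length S" by (rule length_max_rot[OF p])
  have z: "z \<noteq> []" "Suc (length z) = length S" using len lenL by (auto simp: z_def length_0_conv[symmetric] simp del: length_0_conv)
  have L: "?L = z @ [last ?L]" using sets(5) by (simp add: z_def)
  have c: "cycle ?L = z @- ([last ?L] @- cycle ?L)"
    using cycle_decomp[OF sets(5)] L by (metis shift_append)
  have d: "word_plus ?L @- cycle S = z @- ([last ?L + 1] @- cycle S)"
    by (simp add: word_plus_def z_def)
  have sL: "set ?L \<subseteq> {..D + 1}" "set S \<subseteq> {..D + 1}" "last ?L + 1 \<le> D + 1"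
    using sets D last_in_set[OF sets(5)] by (auto intro: order_trans)
  have sz: "set z \<subseteq> {..D + 1}" using sL(1) in_set_butlastD unfolding z_def by fastforce
  have "hd z = hd ?L" using L z(1) by (metis hd_append2)
  then have hz: "1 \<le> hd z" using p by (simp add: lyndon_pair_def)
  have s1: "sset ([last ?L] @- cycle ?L) \<subseteq> {..D + 1}" "sset ([last ?L + 1] @- cycle S) \<subseteq> {..D + 1}"
    using sset_cycle[OF sets(4)] sset_cycle[OF sets(5)] sL by auto
  note g = gap_common_prefix[OF s1 sz z(1) hz rho, of M, folded c d, folded J_int_eq_gap[OF p]]
  show "bounded (J_int S \<inter> {\<rho>..M})" by (rule g(1))
  have "\<rho> ^ length S = \<rho> * \<rho> ^ length z" using z(2) by (metis power_Suc)
  then show "diameter (J_int S \<inter> {\<rho>..M}) \<le> M\<^sup>2 * real (D + 1) / (\<rho> - 1) * \<rho> / \<rho> ^ length S"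
    using g(2) rho by simp
qed

text \<open>
  For each \<open>m\<close> the intervals \<open>J^S\<close> with \<open>S \<in> \<Lambda>_e(m)\<close> cover the set, and only words with digits at most
  \<open>D\<close> are needed. Each positive power of their diameters is exponentially small in \<open>|S|\<close>, hence \<open>O(|S|^-4)\<close>, and the
  sum of the latter tends to 0 with growing \<open>m\<close>. The bound with exponent 1 makes the individual
  diameters small.
\<close>
lemma hausdorff_premeasure_E_inf:
  assumes s: "0 < s" and \<delta>: "0 < \<delta>" and rho: "1 < \<rho>"
  shows "hausdorff_premeasure s \<delta> (E_inf \<inter> {\<rho>..real D}) = 0"
proof -
  define C where "C = (real D)\<^sup>2 * real (D + 1) / (\<rho> - 1) * \<rho>"
  have C: "0 \<le> C" using rho by (simp add: C_def)
  have diam0: "0 \<le> diameter (J_int S \<inter> {\<rho>..real D})" for S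
    by (rule diameter_ge_0) (auto intro: bounded_subset[of "{\<rho>..real D}"])
  have bound: "\<exists>B\<ge>0. \<forall>m\<ge>2. \<forall>S\<in>Lambda_digits D m. hd (max_rot S) \<le> D \<longrightarrow>
      diameter (J_int S \<inter> {\<rho>..real D}) powr t \<le> B * quartic_weight S" if t: "0 < t" for t
  proof -
    have "1 < \<rho> powr t" using rho t by simp
    from quartic_le_exponential[OF this] obtain K where K: "K > 0" "\<And>n. (real n + 1) ^ 4 \<le> K * (\<rho> powr t) ^ n" by metis
    have "diameter (J_int S \<inter> {\<rho>..real D}) powr t \<le> C powr t * K * quartic_weight S"
      if S: "S \<in> Lambda_digits D m" "2 \<le> m" "hd (max_rot S) \<le> D" for S m
    proof -
      have Se: "S \<in> Lambda_e m" using S(1) Lambda_digits_subset by blast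
      have p: "lyndon_pair S (max_rot S)" by (rule Lambda_lyndon_pair[OF Se])
      have len: "2 \<le> length S" using Lambda_e_length[OF Se] S(2) by simp
      have "diameter (J_int S \<inter> {\<rho>..real D}) powr t \<le> (C / \<rho> ^ length S) powr t"
        using J_int_diameter(2)[OF p len rho S(3), of "real D"] diam0 t unfolding C_def by (intro powr_mono2) auto
      also have "\<dots> = C powr t / (\<rho> powr t) ^ length S"
        using C rho by (simp add: powr_divide powr_realpow[symmetric] powr_powr mult.commute)
      also have "\<dots> \<le> C powr t * (K * quartic_weight S)"
      proof -
        have pos: "0 < real (length S) ^ 4" "0 < (\<rho> powr t) ^ length S" using len rho by auto
        have "real (length S) ^ 4 \<le> (real (length S) + 1) ^ 4" by (intro power_mono) auto
        also have "\<dots> \<le> K * (\<rho> powr t) ^ length S" by (rule K(2))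
        finally have "1 / (\<rho> powr t) ^ length S \<le> K * quartic_weight S"
          using pos by (simp add: quartic_weight_def field_simps)
        then have "C powr t * (1 / (\<rho> powr t) ^ length S) \<le> C powr t * (K * quartic_weight S)"
          by (intro mult_left_mono) auto
        then show ?thesis by simp
      qed
      finally show ?thesis by (simp add: mult.assoc)
    qed
    then show ?thesis using K(1) by (intro exI[of _ "C powr t * K"]) auto
  qed
  obtain B where B: "0 \<le> B" "\<And>m S. 2 \<le> m \<Longrightarrow> S \<in> Lambda_digits D m \<Longrightarrow> hd (max_rot S) \<le> D \<Longrightarrow>
      diameter (J_int S \<inter> {\<rho>..real D}) powr s \<le> B * quartic_weight S" using bound[OF s] by blast
  obtain B' where B': "0 \<le> B'" "\<And>m S. 2 \<le> m \<Longrightarrow> S \<in> Lambda_digits D m \<Longrightarrow> hd (max_rot S) \<le> D \<Longrightarrow>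
      diameter (J_int S \<inter> {\<rho>..real D}) powr 1 \<le> B' * quartic_weight S" using bound[of 1] by auto
  define W where "W m = 2 * (real D + 1) * (1 / 8) ^ m" for m :: nat
  have W0: "W \<longlonglongrightarrow> 0" unfolding W_def by (intro tendsto_mult_right_zero LIMSEQ_power_zero) simp
  have "hausdorff_premeasure s \<delta> (E_inf \<inter> {\<rho>..real D}) \<le> 0 + ennreal \<eta>" if \<eta>: "0 < \<eta>" for \<eta>
  proof -
    have "(\<lambda>m. B * W m) \<longlonglongrightarrow> 0" "(\<lambda>m. B' * W m) \<longlonglongrightarrow> 0"
      using tendsto_mult_right_zero[OF W0] by auto
    then have "eventually (\<lambda>m. B * W m < \<eta> \<and> B' * W m < \<delta> \<and> 1 \<le> m) sequentially"
      using \<eta> \<delta> by (auto intro!: eventually_conj order_tendstoD(2) eventually_ge_at_top)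
    then obtain m where m: "B * W m < \<eta>" "B' * W m < \<delta>" "1 \<le> m" by (auto simp: eventually_sequentially)
    define I where "I = {S \<in> Lambda_digits D (Suc m). hd (max_rot S) \<le> D}"
    have "hausdorff_premeasure s \<delta> (E_inf \<inter> {\<rho>..real D}) \<le> ennreal (B * W m)"
    proof (rule hausdorff_premeasure_le_sums[where I = I and J = "\<lambda>S. J_int S \<inter> {\<rho>..real D}", OF _ _ s \<delta>])
      show "countable I" by (rule countableI_type)
      show "E_inf \<inter> {\<rho>..real D} \<subseteq> (\<Union>S\<in>I. J_int S \<inter> {\<rho>..real D})"
      proof
        fix x assume x: "x \<in> E_inf \<inter> {\<rho>..real D}"
        then obtain S where S: "S \<in> Lambda_e (Suc m)" "x \<in> J_int S" unfolding E_inf_def by force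
        have p: "lyndon_pair S (max_rot S)" by (rule Lambda_lyndon_pair[OF S(1)])
        have h: "hd (max_rot S) \<le> D" using J_int_digit_bound[OF p S(2)] x by simp
        then have "set S \<subseteq> {..D}" using lyndon_pair_sets(2)[OF p] by auto
        then have "S \<in> I" using Lambda_e_bounded_digits[OF S(1)] h by (simp add: I_def)
        then show "x \<in> (\<Union>S\<in>I. J_int S \<inter> {\<rho>..real D})" using S(2) x by blast
      qed
      show "bounded (J_int S \<inter> {\<rho>..real D}) \<and> diameter (J_int S \<inter> {\<rho>..real D}) \<le> \<delta>" if S: "S \<in> I" for S
      proof
        show "bounded (J_int S \<inter> {\<rho>..real D})" by (rule bounded_subset[of "{\<rho>..real D}"]) auto
        have "diameter (J_int S \<inter> {\<rho>..real D}) \<le> B' * quartic_weight S"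
          using B'(2)[of "Suc m" S] S m(3) diam0[of S] by (simp add: I_def)
        also have "\<dots> \<le> B' * W m"
          using Lambda_digits_weight[of "{S}" D m] S B'(1) unfolding W_def I_def by (intro mult_left_mono) auto
        finally show "diameter (J_int S \<inter> {\<rho>..real D}) \<le> \<delta>" using m(2) by simp
      qed
      show "(\<Sum>S\<in>F. diameter (J_int S \<inter> {\<rho>..real D}) powr s) \<le> B * W m" if F: "finite F" "F \<subseteq> I" for F
      proof -
        have "(\<Sum>S\<in>F. diameter (J_int S \<inter> {\<rho>..real D}) powr s) \<le> (\<Sum>S\<in>F. B * quartic_weight S)"
          using F m(3) by (intro sum_mono B(2)[of "Suc m"]) (auto simp: I_def)
        also have "\<dots> = B * (\<Sum>S\<in>F. quartic_weight S)" by (simp add: sum_distrib_left)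
        also have "\<dots> \<le> B * W m"
          unfolding W_def using F B(1) by (intro mult_left_mono Lambda_digits_weight) (auto simp: I_def)
        finally show ?thesis .
      qed
    qed
    also have "\<dots> \<le> ennreal \<eta>" using m(1) by (intro ennreal_leI) simp
    finally show ?thesis by simp
  qed
  then have "hausdorff_premeasure s \<delta> (E_inf \<inter> {\<rho>..real D}) \<le> 0" by (rule ennreal_le_epsilon)
  then show ?thesis by simp
qed

theorem hausdorff_dim_E_inf: "hausdorff_dim E_inf = 0"
proof -
  have "1 < x" if "x \<in> E_inf" for x
  proof -
    obtain S where "S \<in> Lambda_e 1" "x \<in> J_int S" using \<open>x \<in> E_inf\<close> unfolding E_inf_def by force
    then show ?thesis using J_int_eq_gap[OF Lambda_lyndon_pair] by (auto simp: gap_def)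
  qed
  then have "E_inf = (\<Union>j. E_inf \<inter> {1 + 1 / real (Suc j)..real (Suc j)})"
    using exhaustion_above_1 by blast
  moreover have "hausdorff_dim (\<Union>j. E_inf \<inter> {1 + 1 / real (Suc j)..real (Suc j)}) = 0"
    by (rule hausdorff_dim_eq_0, rule hausdorff_premeasure_E_inf) auto
  ultimately show ?thesis by simp
qed

theorem theorem3p2:
  shows "packing_dim E_set = 0
    \<and> (\<forall>S\<in>Lambda_all. has_box_dim (E_rel S) 0)
    \<and> hausdorff_dim E_inf = 0"
  using packing_dim_E_set box_dim_E_rel hausdorff_dim_E_inf by blast

end
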